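(* Let $\mathcal S$ be a monoidal admissible class of spans in a monoidal category $\mathsf C$ such that every cospan in $\mathsf C$ whose legs are in $\mathcal S$ has an $\mathcal S$-relative pullback. Use the same notation $\mathcal S$ for the induced class of spans in the category of monoids in $\mathsf C$. Then the following two categories are equivalent. $\bullet$ The category $\mathsf{CatMon}_{\mathcal S}(\mathsf C)$. Its objects are the $\mathcal S$-relative categories $(B,A,i,s,t,d)$ in the category of monoids in $\mathsf C$ such that the morphism $q_n:(A\Box_BI)\otimes A^{\Box_B(n-1)}\to A^{\Box_Bn}$ is invertible for every positive integer $n$. Its morphisms are the $\mathcal S$-relative functors in the category of monoids in $\mathsf C$. $\bullet$ The category $\mathsf{Xmod}_{\mathcal S}(\mathsf C)$. An object consists of monoids $B$ and $Y$ in $\mathsf C$, monoid morphisms $e:Y\to I$ and $k:Y\to B$ and a distributive law $x:B\otimes Y\to Y\otimes B$, subject to: (a') the spans $B\xleftarrow{k}Y\xrightarrow{1}Y$, $Y\xleftarrow{1}Y\xrightarrow{e}I$ and $B\xleftarrow{1}B\xrightarrow{1}B$ belong to $\mathcal S$; (b') $(e\otimes1)\circ x=1\otimes e$ and $m\circ(k\otimes1)\circ x=m\circ(1\otimes k)$; (c') the morphism $f:Y\to(Y\otimes B)\Box_BI$ is invertible and the morphisms $b_n:Y^{n}\otimes B\to(Y\otimes B)\Box_B(Y^{n-1}\otimes B)$ are invertible for all positive integers $n$; (d') regarding $Y\otimes B$ as a monoid via the structure induced by the distributive law $x$ (and $(Y\otimes B)\Box_B(Y\otimes B)$ with the resulting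 monoid structure, with multiplication $m$), the following two morphisms $Y\otimes B\otimes Y\to Y\otimes B$ are equal: $$(m\otimes1)\circ(1\otimes x)=(m\otimes1)\circ b_2^{-1}\circ m\circ(b_2\otimes b_2)\circ(u\otimes1\otimes1\otimes1\otimes u\otimes u),$$ where $u\otimes1\otimes1\otimes1\otimes u\otimes u:Y\otimes B\otimes Y\to(Y^2\otimes B)\otimes(Y^2\otimes B)$. A morphism $(B,Y,e,k,x)\to(B',Y',e',k',x')$ is a pair of monoid morphisms $(b:B\to B',\ y:Y\to Y')$ such that $e'\circ y=e$, $k'\circ y=b\circ k$ and $x'\circ(b\otimes y)=(y\otimes b)\circ x$.
   Context: Notation. $\mathsf C$ is a monoidal category with product $\otimes$ and unit $I$; its coherence isomorphisms are suppressed; $X^n$ is the $n$-fold $\otimes$-power. Identity morphisms are written $1$. The multiplication and unit of any monoid are denoted $m$ and $u$; $I$ is regarded as a monoid in the trivial way. Admissible class. A class $\mathcal S$ of spans in a category is admissible if: (POST) if $X\xleftarrow{f}A\xrightarrow{g}Y$ is in $\mathcal S$ then so is $X'\xleftarrow{f'\circ f}A\xrightarrow{g'\circ g}Y'$ for all $f':X\to X'$, $g':Y\to Y'$; (PRE) if $X\xleftarrow{f}A\xrightarrow{g}Y$ is in $\mathcal S$ then so is $X\xleftarrow{f\circ h}D\xrightarrow{g\circ h}Y$ for every $h:D\to A$. Monoidal class. A class $\mathcal S$ of spans in $\mathsf C$ is monoidal if it is unital, i.e. $I\xleftarrow{1}I\xrightarrow{1}I$ is in $\mathcal S$, and multiplicative,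 i.e. whenever $X\xleftarrow{f}A\xrightarrow{g}Y$ and $X'\xleftarrow{f'}A'\xrightarrow{g'}Y'$ are in $\mathcal S$, so is $X\otimes X'\xleftarrow{f\otimes f'}A\otimes A'\xrightarrow{g\otimes g'}Y\otimes Y'$. The induced class of spans in the category of monoids in $\mathsf C$ consists of the spans of monoid morphisms which belong to $\mathcal S$ as spans in $\mathsf C$. Legs. A cospan $A\xrightarrow{f}B\xleftarrow{g}C$ has its legs in $\mathcal S$ if $A\xleftarrow{1}A\xrightarrow{f}B$ and $B\xleftarrow{g}C\xrightarrow{1}C$ are in $\mathcal S$. A span $B\xleftarrow{t}A\xrightarrow{s}B$ has its legs in $\mathcal S$ if $B\xleftarrow{t}A\xrightarrow{1}A$ and $A\xleftarrow{1}A\xrightarrow{s}B$ are in $\mathcal S$. Relative pullback. An $\mathcal S$-relative pullback of a cospan $A\xrightarrow{f}B\xleftarrow{g}C$ is a span $A\xleftarrow{p_A}A\Box_BC\xrightarrow{p_C}C$ in $\mathcal S$ with $f\circ p_A=g\circ p_C$ such that: (universality) for every span $A\xleftarrow{a}D\xrightarrow{c}C$ in $\mathcal S$ with $f\circ a=g\circ c$ there is a unique $h:D\to A\Box_BC$ with $p_A\circ h=a$, $p_C\circ h=c$; (reflection) if for some $d:D\to A\Box_BC$, $e:D\to E$ both $A\xleftarrow{p_A\circ d}D\xrightarrow{e}E$ and $C\xleftarrow{p_C\circ d}D\xrightarrow{e}E$ are in $\mathcal S$, then so is $A\Box_BC\xleftarrow{d}D\xrightarrow{e}E$, and symmetrically,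 if both $E\xleftarrow{e}D\xrightarrow{p_A\circ d}A$ and $E\xleftarrow{e}D\xrightarrow{p_C\circ d}C$ are in $\mathcal S$, then so is $E\xleftarrow{e}D\xrightarrow{d}A\Box_BC$. If $f,g$ are monoid morphisms (and $\mathcal S$ is monoidal admissible), $A\Box_BC$ carries the unique monoid structure making $p_A,p_C$ monoid morphisms; this is the relative pullback in the category of monoids. Given morphisms with $f'\circ a=b\circ f$, $g'\circ c=b\circ g$, $a\Box c:A\Box_BC\to A'\Box_{B'}C'$ is the unique morphism with $p_{A'}\circ(a\Box c)=a\circ p_A$, $p_{C'}\circ(a\Box c)=c\circ p_C$. Relative category. If $B\xleftarrow{1}B\xrightarrow{1}B$ is in $\mathcal S$, the spans $B\xleftarrow{t}A\xrightarrow{s}B$ with legs in $\mathcal S$ (morphisms: morphisms of spans) form a monoidal category: the product of $(t,A,s)$ and $(t',A',s')$ is the $\mathcal S$-relative pullback $A\Box_BA'$ of $A\xrightarrow{s}B\xleftarrow{t'}A'$ with legs $t\circ p_1$ and $s'\circ p_2$, the unit is $B\xleftarrow{1}B\xrightarrow{1}B$; the coherence isomorphisms are suppressed. $A^{\Box_Bn}$ is the $n$-fold power, $A^{\Box_B0}=B$. An $\mathcal S$-relative category is a monoid in this monoidal category: it is given by morphisms $s,t:A\to B$, $i:B\to A$ with $s\circ i=1=t\circ i$, and $d:A\Box_BA\to A$ with $s\circ d=s\circ p_2$, $t\circ d=t\circ p_1$, $d\circ(1\Box i)=1=d\circ(i\Box1)$, $d\circ(d\Box1)=d\circ(1\Box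 d)$. In the category of monoids all objects are monoids and all these morphisms are monoid morphisms. An $\mathcal S$-relative functor $(B,A,i,s,t,d)\to(B',A',i',s',t',d')$ is a pair of morphisms (here: monoid morphisms) $(b:B\to B',a:A\to A')$ with $s'\circ a=b\circ s$, $t'\circ a=b\circ t$, $i'\circ b=a\circ i$, $a\circ d=d'\circ(a\Box a)$. The morphisms $q_n$. $A\Box_BI$ is the $\mathcal S$-relative pullback of $A\xrightarrow{s}B\xleftarrow{u}I$. For $n\ge0$, $q_{n+1}$ is the composite $$(A\Box_BI)\otimes A^{\Box_Bn}\xrightarrow{p_A\otimes1}A\otimes A^{\Box_Bn}\xrightarrow{(1\Box i\Box\cdots\Box i)\otimes(i\Box1\Box\cdots\Box1)}A^{\Box_B(n+1)}\otimes A^{\Box_B(n+1)}\xrightarrow{m}A^{\Box_B(n+1)},$$ where $1\Box i\Box\cdots\Box i:A\cong A\Box_BB\Box_B\cdots\Box_BB\to A^{\Box_B(n+1)}$ and $i\Box1\Box\cdots\Box1:A^{\Box_Bn}\cong B\Box_BA^{\Box_Bn}\to A^{\Box_B(n+1)}$. Distributive law. For monoids $B,Y$, a distributive law is a morphism $x:B\otimes Y\to Y\otimes B$ with $x\circ(u\otimes1)=1\otimes u$, $x\circ(1\otimes u)=u\otimes1$, $x\circ(m\otimes1)=(1\otimes m)\circ(x\otimes1)\circ(1\otimes x)$ and $x\circ(1\otimes m)=(m\otimes1)\circ(1\otimes x)\circ(x\otimes1)$. It induces a monoid structure on $Y\otimes B$ with multiplication $(m\otimes m)\circ(1\otimes x\otimes1)$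 and unit $u\otimes u$. The morphisms $f$ and $b_n$. $(Y\otimes B)\Box_BI$ is the $\mathcal S$-relative pullback of $Y\otimes B\xrightarrow{e\otimes1}B\xleftarrow{u}I$ and $f:Y\to(Y\otimes B)\Box_BI$ is the unique morphism with $p_{Y\otimes B}\circ f=1\otimes u$, $p_I\circ f=e$. Let $m^{(n)}:B^{n+1}\to B$ be the $n$-fold iterated multiplication ($m^{(0)}=1$). For $n\ge0$, $(Y\otimes B)\Box_B(Y^n\otimes B)$ is the $\mathcal S$-relative pullback of $e\otimes1:Y\otimes B\to B$ and $m^{(n)}\circ(k^{\otimes n}\otimes1):Y^n\otimes B\to B$, and $b_{n+1}:Y^{n+1}\otimes B\to(Y\otimes B)\Box_B(Y^n\otimes B)$ is the unique morphism with $p_{Y^n\otimes B}\circ b_{n+1}=e\otimes1$ and $p_{Y\otimes B}\circ b_{n+1}=(1\otimes m^{(n)})\circ(1\otimes k^{\otimes n}\otimes1)$ (existence follows from (a')). In particular $b_2:Y^2\otimes B\to(Y\otimes B)\Box_B(Y\otimes B)$, with $(Y\otimes B)\Box_B(Y\otimes B)$ the relative pullback of the monoid morphisms $e\otimes1$ and $m\circ(k\otimes1)$. *)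

theory Defs
  imports Main
begin

section \<open>Categories, functors, equivalence\<close>

record ('o, 'a) cat =
  Obj :: "'o set"
  Arr :: "'a set"
  Dom :: "'a \<Rightarrow> 'o"
  Cod :: "'a \<Rightarrow> 'o"
  Ident :: "'o \<Rightarrow> 'a"  ("\<one>\<index>")
  Comp :: "'a \<Rightarrow> 'a \<Rightarrow> 'a"  (infixr "\<cdot>\<index>" 65)

definition hom :: "('o, 'a, 'z) cat_scheme \<Rightarrow> 'o \<Rightarrow> 'o \<Rightarrow> 'a set" where
  "hom C X Y = {f \<in> Arr C. Dom C f = X \<and> Cod C f = Y}"

locale category =
  fixes C :: "('o, 'a, 'z) cat_scheme" (structure)
  assumes Dom_Obj: "f \<in> Arr C \<Longrightarrow> Dom C f \<in> Obj C"
    and Cod_Obj: "f \<in> Arr C \<Longrightarrow> Cod C f \<in> Obj C"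
    and Ident_hom: "X \<in> Obj C \<Longrightarrow> \<one> X \<in> hom C X X"
    and Comp_hom: "f \<in> hom C X Y \<Longrightarrow> g \<in> hom C Y Z \<Longrightarrow> g \<cdot> f \<in> hom C X Z"
    and Comp_Ident_right: "f \<in> hom C X Y \<Longrightarrow> f \<cdot> \<one> X = f"
    and Comp_Ident_left: "f \<in> hom C X Y \<Longrightarrow> \<one> Y \<cdot> f = f"
    and Comp_assoc: "f \<in> hom C W X \<Longrightarrow> g \<in> hom C X Y \<Longrightarrow> h \<in> hom C Y Z \<Longrightarrow>
      (h \<cdot> g) \<cdot> f = h \<cdot> (g \<cdot> f)"

definition inverse_arrows :: "('o, 'a, 'z) cat_scheme \<Rightarrow> 'a \<Rightarrow> 'a \<Rightarrow> bool" where
  "inverse_arrows C f g \<longleftrightarrow>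
     f \<in> Arr C \<and> g \<in> Arr C \<and> Dom C g = Cod C f \<and> Cod C g = Dom C f \<and>
     Comp C g f = Ident C (Dom C f) \<and> Comp C f g = Ident C (Cod C f)"

definition invertible :: "('o, 'a, 'z) cat_scheme \<Rightarrow> 'a \<Rightarrow> bool" where
  "invertible C f \<longleftrightarrow> (\<exists>g. inverse_arrows C f g)"

definition Inv :: "('o, 'a, 'z) cat_scheme \<Rightarrow> 'a \<Rightarrow> 'a" where
  "Inv C f = (THE g. inverse_arrows C f g)"

definition is_functor ::
  "('o, 'a, 'z) cat_scheme \<Rightarrow> ('p, 'b, 'y) cat_scheme \<Rightarrow> ('o \<Rightarrow> 'p) \<Rightarrow> ('a \<Rightarrow> 'b) \<Rightarrow> bool" where
  "is_functor C D Fo Fa \<longleftrightarrow>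
     (\<forall>X \<in> Obj C. Fo X \<in> Obj D) \<and>
     (\<forall>f \<in> Arr C. Fa f \<in> hom D (Fo (Dom C f)) (Fo (Cod C f))) \<and>
     (\<forall>X \<in> Obj C. Fa (Ident C X) = Ident D (Fo X)) \<and>
     (\<forall>f \<in> Arr C. \<forall>g \<in> Arr C. Dom C g = Cod C f \<longrightarrow> Fa (Comp C g f) = Comp D (Fa g) (Fa f))"

definition natural_iso ::
  "('o, 'a, 'z) cat_scheme \<Rightarrow> ('p, 'b, 'y) cat_scheme \<Rightarrow>
   ('o \<Rightarrow> 'p) \<Rightarrow> ('a \<Rightarrow> 'b) \<Rightarrow> ('o \<Rightarrow> 'p) \<Rightarrow> ('a \<Rightarrow> 'b) \<Rightarrow> ('o \<Rightarrow> 'b) \<Rightarrow> bool" where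
  "natural_iso C D Fo Fa Go Ga \<tau> \<longleftrightarrow>
     (\<forall>X \<in> Obj C. \<tau> X \<in> hom D (Fo X) (Go X) \<and> invertible D (\<tau> X)) \<and>
     (\<forall>f \<in> Arr C. Comp D (\<tau> (Cod C f)) (Fa f) = Comp D (Ga f) (\<tau> (Dom C f)))"

definition equivalent_categories ::
  "('o, 'a, 'z) cat_scheme \<Rightarrow> ('p, 'b, 'y) cat_scheme \<Rightarrow> bool" where
  "equivalent_categories C D \<longleftrightarrow>
     category C \<and> category D \<and>
     (\<exists>Fo Fa Go Ga \<eta> \<epsilon>.
        is_functor C D Fo Fa \<and> is_functor D C Go Ga \<and>
        natural_iso C C (\<lambda>X. X) (\<lambda>f. f) (Go \<circ> Fo) (Ga \<circ> Fa) \<eta> \<and>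
        natural_iso D D (Fo \<circ> Go) (Fa \<circ> Ga) (\<lambda>X. X) (\<lambda>f. f) \<epsilon>)"


section \<open>Monoidal categories\<close>

text \<open>
  Monoidal categories are not assumed to be strict. The coherence isomorphisms
  \<open>\<alpha> X Y Z : (X \<otimes> Y) \<otimes> Z \<rightarrow> X \<otimes> (Y \<otimes> Z)\<close>, \<open>\<ell> X : I \<otimes> X \<rightarrow> X\<close> and
  \<open>\<rho> X : X \<otimes> I \<rightarrow> X\<close> are inserted explicitly wherever the usual notation suppresses them.
\<close>

record ('o, 'a) moncat = "('o, 'a) cat" +
  Tensor_obj :: "'o \<Rightarrow> 'o \<Rightarrow> 'o"  (infixr "\<odot>\<index>" 75)
  Tensor :: "'a \<Rightarrow> 'a \<Rightarrow> 'a"  (infixr "\<otimes>\<index>" 75)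
  Unit_obj :: "'o"  ("\<I>\<index>")
  Assoc :: "'o \<Rightarrow> 'o \<Rightarrow> 'o \<Rightarrow> 'a"  ("\<alpha>\<index>")
  Lunit :: "'o \<Rightarrow> 'a"  ("\<ell>\<index>")
  Runit :: "'o \<Rightarrow> 'a"  ("\<rho>\<index>")

locale monoidal_category = category C
  for C :: "('o, 'a) moncat" (structure) +
  assumes Unit_Obj: "\<I> \<in> Obj C"
    and Tensor_Obj: "X \<in> Obj C \<Longrightarrow> Y \<in> Obj C \<Longrightarrow> X \<odot> Y \<in> Obj C"
    and Tensor_hom: "f \<in> hom C X Y \<Longrightarrow> f' \<in> hom C X' Y' \<Longrightarrow> f \<otimes> f' \<in> hom C (X \<odot> X') (Y \<odot> Y')"
    and Tensor_Ident: "X \<in> Obj C \<Longrightarrow> Y \<in> Obj C \<Longrightarrow> \<one> X \<otimes> \<one> Y = \<one> (X \<odot> Y)"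
    and Tensor_Comp: "f \<in> hom C X Y \<Longrightarrow> g \<in> hom C Y Z \<Longrightarrow> f' \<in> hom C X' Y' \<Longrightarrow> g' \<in> hom C Y' Z' \<Longrightarrow>
      (g \<cdot> f) \<otimes> (g' \<cdot> f') = (g \<otimes> g') \<cdot> (f \<otimes> f')"
    and Assoc_hom: "X \<in> Obj C \<Longrightarrow> Y \<in> Obj C \<Longrightarrow> Z \<in> Obj C \<Longrightarrow>
      \<alpha> X Y Z \<in> hom C ((X \<odot> Y) \<odot> Z) (X \<odot> (Y \<odot> Z))"
    and Assoc_iso: "X \<in> Obj C \<Longrightarrow> Y \<in> Obj C \<Longrightarrow> Z \<in> Obj C \<Longrightarrow> invertible C (\<alpha> X Y Z)"
    and Assoc_natural: "f \<in> hom C X X' \<Longrightarrow> g \<in> hom C Y Y' \<Longrightarrow> h \<in> hom C Z Z' \<Longrightarrow>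
      \<alpha> X' Y' Z' \<cdot> ((f \<otimes> g) \<otimes> h) = (f \<otimes> (g \<otimes> h)) \<cdot> \<alpha> X Y Z"
    and Lunit_hom: "X \<in> Obj C \<Longrightarrow> \<ell> X \<in> hom C (\<I> \<odot> X) X"
    and Lunit_iso: "X \<in> Obj C \<Longrightarrow> invertible C (\<ell> X)"
    and Lunit_natural: "f \<in> hom C X Y \<Longrightarrow> \<ell> Y \<cdot> (\<one> \<I> \<otimes> f) = f \<cdot> \<ell> X"
    and Runit_hom: "X \<in> Obj C \<Longrightarrow> \<rho> X \<in> hom C (X \<odot> \<I>) X"
    and Runit_iso: "X \<in> Obj C \<Longrightarrow> invertible C (\<rho> X)"
    and Runit_natural: "f \<in> hom C X Y \<Longrightarrow> \<rho> Y \<cdot> (f \<otimes> \<one> \<I>) = f \<cdot> \<rho> X"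
    and triangle: "X \<in> Obj C \<Longrightarrow> Y \<in> Obj C \<Longrightarrow>
      (\<one> X \<otimes> \<ell> Y) \<cdot> \<alpha> X \<I> Y = \<rho> X \<otimes> \<one> Y"
    and pentagon: "W \<in> Obj C \<Longrightarrow> X \<in> Obj C \<Longrightarrow> Y \<in> Obj C \<Longrightarrow> Z \<in> Obj C \<Longrightarrow>
      (\<one> W \<otimes> \<alpha> X Y Z) \<cdot> \<alpha> W (X \<odot> Y) Z \<cdot> (\<alpha> W X Y \<otimes> \<one> Z)
        = \<alpha> W X (Y \<odot> Z) \<cdot> \<alpha> (W \<odot> X) Y Z"


section \<open>Monoids\<close>

record ('o, 'a) mon =
  Car :: 'o
  Mul :: 'a
  Unt :: 'a

context
  fixes C :: "('o, 'a) moncat" (structure)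
begin

definition monoid_in :: "('o, 'a) mon \<Rightarrow> bool" where
  "monoid_in M \<longleftrightarrow>
     Car M \<in> Obj C \<and> Mul M \<in> hom C (Car M \<odot> Car M) (Car M) \<and> Unt M \<in> hom C \<I> (Car M) \<and>
     Mul M \<cdot> (Mul M \<otimes> \<one> (Car M)) = Mul M \<cdot> (\<one> (Car M) \<otimes> Mul M) \<cdot> \<alpha> (Car M) (Car M) (Car M) \<and>
     Mul M \<cdot> (Unt M \<otimes> \<one> (Car M)) = \<ell> (Car M) \<and>
     Mul M \<cdot> (\<one> (Car M) \<otimes> Unt M) = \<rho> (Car M)"

definition monoid_hom :: "('o, 'a) mon \<Rightarrow> ('o, 'a) mon \<Rightarrow> 'a \<Rightarrow> bool" where
  "monoid_hom M N f \<longleftrightarrow>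
     f \<in> hom C (Car M) (Car N) \<and> f \<cdot> Mul M = Mul N \<cdot> (f \<otimes> f) \<and> f \<cdot> Unt M = Unt N"

definition trivial_monoid :: "('o, 'a) mon" where
  "trivial_monoid = \<lparr>Car = \<I>, Mul = \<ell> \<I>, Unt = \<one> \<I>\<rparr>"

definition distributive_law :: "('o, 'a) mon \<Rightarrow> ('o, 'a) mon \<Rightarrow> 'a \<Rightarrow> bool" where
  "distributive_law MB MY x \<longleftrightarrow>
     (let B = Car MB; Y = Car MY in
        x \<in> hom C (B \<odot> Y) (Y \<odot> B) \<and>
        x \<cdot> (Unt MB \<otimes> \<one> Y) = (\<one> Y \<otimes> Unt MB) \<cdot> Inv C (\<rho> Y) \<cdot> \<ell> Y \<and>
        x \<cdot> (\<one> B \<otimes> Unt MY) = (Unt MY \<otimes> \<one> B) \<cdot> Inv C (\<ell> B) \<cdot> \<rho> B \<and>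
        x \<cdot> (Mul MB \<otimes> \<one> Y) =
          (\<one> Y \<otimes> Mul MB) \<cdot> \<alpha> Y B B \<cdot> (x \<otimes> \<one> B) \<cdot> Inv C (\<alpha> B Y B) \<cdot> (\<one> B \<otimes> x) \<cdot> \<alpha> B B Y \<and>
        x \<cdot> (\<one> B \<otimes> Mul MY) =
          (Mul MY \<otimes> \<one> B) \<cdot> Inv C (\<alpha> Y Y B) \<cdot> (\<one> Y \<otimes> x) \<cdot> \<alpha> Y B Y \<cdot> (x \<otimes> \<one> Y) \<cdot> Inv C (\<alpha> B Y Y))"

text \<open>
  The coherence isomorphisms in the multiplication bring \<open>(Y \<otimes> B) \<otimes> (Y \<otimes> B)\<close> to
  \<open>Y \<otimes> ((B \<otimes> Y) \<otimes> B)\<close>, and after the application of \<open>x\<close> to \<open>(Y \<otimes> Y) \<otimes> (B \<otimes> B)\<close>.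
\<close>

definition distributive_monoid :: "('o, 'a) mon \<Rightarrow> ('o, 'a) mon \<Rightarrow> 'a \<Rightarrow> ('o, 'a) mon" where
  "distributive_monoid MB MY x =
     (let B = Car MB; Y = Car MY in
        \<lparr>Car = Y \<odot> B,
         Mul = (Mul MY \<otimes> Mul MB) \<cdot>
           Inv C (\<alpha> Y Y (B \<odot> B)) \<cdot> (\<one> Y \<otimes> \<alpha> Y B B) \<cdot>
           (\<one> Y \<otimes> (x \<otimes> \<one> B)) \<cdot>
           (\<one> Y \<otimes> Inv C (\<alpha> B Y B)) \<cdot> \<alpha> Y B (Y \<odot> B),
         Unt = (Unt MY \<otimes> Unt MB) \<cdot> Inv C (\<ell> \<I>)\<rparr>)"

text \<open>
  \<open>tpow X Z n\<close> is \<open>X\<^sup>n \<otimes> Z\<close> bracketed to the right, \<open>X \<otimes> (X \<otimes> \<dots> (X \<otimes> Z))\<close>; for \<open>n = 0\<close> it is \<open>Z\<close>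
  itself rather than \<open>I \<otimes> Z\<close>. Likewise \<open>tpow_arr f g n\<close> is \<open>f \<otimes> \<dots> \<otimes> f \<otimes> g\<close>, and \<open>iter_mul M n\<close> is the
  \<open>n\<close>-fold iterated multiplication on the \<open>(n+1)\<close>-fold power \<open>tpow (Car M) (Car M) n\<close>.
\<close>

primrec tpow :: "'o \<Rightarrow> 'o \<Rightarrow> nat \<Rightarrow> 'o" where
  "tpow X Z 0 = Z"
| "tpow X Z (Suc n) = X \<odot> tpow X Z n"

primrec tpow_arr :: "'a \<Rightarrow> 'a \<Rightarrow> nat \<Rightarrow> 'a" where
  "tpow_arr f g 0 = g"
| "tpow_arr f g (Suc n) = f \<otimes> tpow_arr f g n"

primrec iter_mul :: "('o, 'a) mon \<Rightarrow> nat \<Rightarrow> 'a" where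
  "iter_mul M 0 = \<one> (Car M)"
| "iter_mul M (Suc n) = Mul M \<cdot> (\<one> (Car M) \<otimes> iter_mul M n)"

end


section \<open>Classes of spans\<close>

text \<open>
  A class of spans is a binary predicate \<open>S\<close> on arrows: \<open>S f g\<close> says that the span with left leg \<open>f\<close>
  and right leg \<open>g\<close> belongs to the class.
\<close>

definition span_class :: "('o, 'a, 'z) cat_scheme \<Rightarrow> ('a \<Rightarrow> 'a \<Rightarrow> bool) \<Rightarrow> bool" where
  "span_class C S \<longleftrightarrow> (\<forall>f g. S f g \<longrightarrow> f \<in> Arr C \<and> g \<in> Arr C \<and> Dom C f = Dom C g)"

definition admissible :: "('o, 'a, 'z) cat_scheme \<Rightarrow> ('a \<Rightarrow> 'a \<Rightarrow> bool) \<Rightarrow> bool" where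
  "admissible C S \<longleftrightarrow> span_class C S \<and>
     (\<forall>f g f' g'. S f g \<and> f' \<in> Arr C \<and> Dom C f' = Cod C f \<and> g' \<in> Arr C \<and> Dom C g' = Cod C g
        \<longrightarrow> S (Comp C f' f) (Comp C g' g)) \<and>
     (\<forall>f g h. S f g \<and> h \<in> Arr C \<and> Cod C h = Dom C f \<longrightarrow> S (Comp C f h) (Comp C g h))"

definition monoidal_class :: "('o, 'a) moncat \<Rightarrow> ('a \<Rightarrow> 'a \<Rightarrow> bool) \<Rightarrow> bool" where
  "monoidal_class C S \<longleftrightarrow> span_class C S \<and>
     S (Ident C (Unit_obj C)) (Ident C (Unit_obj C)) \<and>
     (\<forall>f g f' g'. S f g \<and> S f' g' \<longrightarrow> S (Tensor C f f') (Tensor C g g'))"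

definition cospan_legs_in :: "('o, 'a, 'z) cat_scheme \<Rightarrow> ('a \<Rightarrow> 'a \<Rightarrow> bool) \<Rightarrow> 'a \<Rightarrow> 'a \<Rightarrow> bool" where
  "cospan_legs_in C S f g \<longleftrightarrow> S (Ident C (Dom C f)) f \<and> S g (Ident C (Dom C g))"

definition span_legs_in :: "('o, 'a, 'z) cat_scheme \<Rightarrow> ('a \<Rightarrow> 'a \<Rightarrow> bool) \<Rightarrow> 'a \<Rightarrow> 'a \<Rightarrow> bool" where
  "span_legs_in C S t s \<longleftrightarrow> S t (Ident C (Dom C t)) \<and> S (Ident C (Dom C s)) s"


section \<open>Relative pullbacks\<close>

definition relative_pullback ::
  "('o, 'a, 'z) cat_scheme \<Rightarrow> ('a \<Rightarrow> 'a \<Rightarrow> bool) \<Rightarrow> 'a \<Rightarrow> 'a \<Rightarrow> 'a \<Rightarrow> 'a \<Rightarrow> bool" where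
  "relative_pullback C S f g p q \<longleftrightarrow>
     S p q \<and> Cod C p = Dom C f \<and> Cod C q = Dom C g \<and> Comp C f p = Comp C g q \<and>
     (\<forall>a c. S a c \<and> Cod C a = Dom C f \<and> Cod C c = Dom C g \<and> Comp C f a = Comp C g c \<longrightarrow>
        (\<exists>!h. h \<in> hom C (Dom C a) (Dom C p) \<and> Comp C p h = a \<and> Comp C q h = c)) \<and>
     (\<forall>d e. d \<in> Arr C \<and> e \<in> Arr C \<and> Dom C d = Dom C e \<and> Cod C d = Dom C p \<longrightarrow>
        (S (Comp C p d) e \<and> S (Comp C q d) e \<longrightarrow> S d e) \<and>
        (S e (Comp C p d) \<and> S e (Comp C q d) \<longrightarrow> S e d))"

definition has_relative_pullbacks :: "('o, 'a, 'z) cat_scheme \<Rightarrow> ('a \<Rightarrow> 'a \<Rightarrow> bool) \<Rightarrow> bool" where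
  "has_relative_pullbacks C S \<longleftrightarrow>
     (\<forall>f g. f \<in> Arr C \<and> g \<in> Arr C \<and> Cod C f = Cod C g \<and> cospan_legs_in C S f g \<longrightarrow>
        (\<exists>p q. relative_pullback C S f g p q))"

text \<open>
  \<open>rpb f g\<close> is a relative pullback of the cospan \<open>(f, g)\<close>, chosen once and for all; it is meaningful
  only if some relative pullback exists.
\<close>

context
  fixes C :: "('o, 'a) moncat" (structure) and S :: "'a \<Rightarrow> 'a \<Rightarrow> bool"
begin

definition rpb :: "'a \<Rightarrow> 'a \<Rightarrow> 'a \<times> 'a" where
  "rpb f g = (SOME (p, q). relative_pullback C S f g p q)"

definition pr1 :: "'a \<Rightarrow> 'a \<Rightarrow> 'a" where
  "pr1 f g = fst (rpb f g)"

definition pr2 :: "'a \<Rightarrow> 'a \<Rightarrow> 'a" where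
  "pr2 f g = snd (rpb f g)"

definition rpb_obj :: "'a \<Rightarrow> 'a \<Rightarrow> 'o" where
  "rpb_obj f g = Dom C (pr1 f g)"

definition pairing :: "'a \<Rightarrow> 'a \<Rightarrow> 'a \<Rightarrow> 'a \<Rightarrow> 'a" where
  "pairing f g a c =
     (THE h. h \<in> hom C (Dom C a) (rpb_obj f g) \<and> pr1 f g \<cdot> h = a \<and> pr2 f g \<cdot> h = c)"

text \<open>\<open>box f g f' g' a c\<close> is \<open>a \<box> c\<close>, from the pullback of \<open>(f, g)\<close> to that of \<open>(f', g')\<close>.\<close>

definition box :: "'a \<Rightarrow> 'a \<Rightarrow> 'a \<Rightarrow> 'a \<Rightarrow> 'a \<Rightarrow> 'a \<Rightarrow> 'a" where
  "box f g f' g' a c = pairing f' g' (a \<cdot> pr1 f g) (c \<cdot> pr2 f g)"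

definition rpb_mon :: "('o, 'a) mon \<Rightarrow> ('o, 'a) mon \<Rightarrow> 'a \<Rightarrow> 'a \<Rightarrow> ('o, 'a) mon" where
  "rpb_mon MA MC f g =
     (THE M. Car M = rpb_obj f g \<and> monoid_in C M \<and>
        monoid_hom C M MA (pr1 f g) \<and> monoid_hom C M MC (pr2 f g))"


section \<open>Relative categories\<close>

text \<open>
  A span from \<open>B\<close> to \<open>B\<close> is given by its left leg \<open>t\<close> and its right leg \<open>s\<close>. The product of
  \<open>(t, s)\<close> and \<open>(t', s')\<close> has the relative pullback of \<open>s\<close> and \<open>t'\<close> as its apex.
\<close>

definition span_prod :: "'a \<times> 'a \<Rightarrow> 'a \<times> 'a \<Rightarrow> 'a \<times> 'a" where
  "span_prod = (\<lambda>(t, s) (t', s'). (t \<cdot> pr1 s t', s' \<cdot> pr2 s t'))"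

text \<open>The coherence isomorphisms of this product: \<open>A \<cong> A \<box> B\<close>, \<open>A \<cong> B \<box> A\<close> and
  \<open>(A \<box> A') \<box> A'' \<cong> A \<box> (A' \<box> A'')\<close>.\<close>

definition to_box_right :: "'o \<Rightarrow> 'a \<Rightarrow> 'a" where
  "to_box_right B s = pairing s (\<one> B) (\<one> (Dom C s)) s"

definition to_box_left :: "'o \<Rightarrow> 'a \<Rightarrow> 'a" where
  "to_box_left B t = pairing (\<one> B) t t (\<one> (Dom C t))"

definition box_assoc :: "'a \<times> 'a \<Rightarrow> 'a \<times> 'a \<Rightarrow> 'a \<times> 'a \<Rightarrow> 'a" where
  "box_assoc = (\<lambda>(t, s) (t', s') (t'', s'').
     let P = pr1 (s' \<cdot> pr2 s t') t''; Q = pr2 (s' \<cdot> pr2 s t') t'' in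
       pairing s (t' \<cdot> pr1 s' t'') (pr1 s t' \<cdot> P) (pairing s' t'' (pr2 s t' \<cdot> P) Q))"

definition relative_category :: "'o \<Rightarrow> 'o \<Rightarrow> 'a \<Rightarrow> 'a \<Rightarrow> 'a \<Rightarrow> 'a \<Rightarrow> bool" where
  "relative_category B A i s t d \<longleftrightarrow>
     B \<in> Obj C \<and> A \<in> Obj C \<and> S (\<one> B) (\<one> B) \<and>
     s \<in> hom C A B \<and> t \<in> hom C A B \<and> span_legs_in C S t s \<and>
     i \<in> hom C B A \<and> s \<cdot> i = \<one> B \<and> t \<cdot> i = \<one> B \<and>
     d \<in> hom C (rpb_obj s t) A \<and> s \<cdot> d = s \<cdot> pr2 s t \<and> t \<cdot> d = t \<cdot> pr1 s t \<and>
     d \<cdot> box s (\<one> B) s t (\<one> A) i \<cdot> to_box_right B s = \<one> A \<and>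
     d \<cdot> box (\<one> B) t s t i (\<one> A) \<cdot> to_box_left B t = \<one> A \<and>
     d \<cdot> box (s \<cdot> pr2 s t) t s t d (\<one> A) =
       d \<cdot> box s (t \<cdot> pr1 s t) s t (\<one> A) d \<cdot> box_assoc (t, s) (t, s) (t, s)"

text \<open>
  \<open>box_pow\<close> is the \<open>n\<close>-fold power of the span \<open>(t, s)\<close>, bracketed to the right and ending in the unit
  \<open>B\<close>; in particular its first power is \<open>A \<box> B\<close>, which is isomorphic but not equal to \<open>A\<close>.
  \<open>box_pow_unit\<close> is the arrow \<open>i \<box> \<dots> \<box> i\<close> from \<open>B \<cong> B \<box> \<dots> \<box> B\<close> to this power.
\<close>

primrec box_pow :: "'o \<Rightarrow> 'a \<Rightarrow> 'a \<Rightarrow> nat \<Rightarrow> 'a \<times> 'a" where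
  "box_pow B s t 0 = (\<one> B, \<one> B)"
| "box_pow B s t (Suc n) = span_prod (t, s) (box_pow B s t n)"

primrec box_pow_mon :: "('o, 'a) mon \<Rightarrow> ('o, 'a) mon \<Rightarrow> 'a \<Rightarrow> 'a \<Rightarrow> nat \<Rightarrow> ('o, 'a) mon" where
  "box_pow_mon MB MA s t 0 = MB"
| "box_pow_mon MB MA s t (Suc n) =
     rpb_mon MA (box_pow_mon MB MA s t n) s (fst (box_pow (Car MB) s t n))"

primrec box_pow_unit :: "'o \<Rightarrow> 'a \<Rightarrow> 'a \<Rightarrow> 'a \<Rightarrow> nat \<Rightarrow> 'a" where
  "box_pow_unit B i s t 0 = \<one> B"
| "box_pow_unit B i s t (Suc n) =
     box (\<one> B) (\<one> B) s (fst (box_pow B s t n)) i (box_pow_unit B i s t n) \<cdot>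
     to_box_right B (\<one> B)"

end


section \<open>Relative categories in the category of monoids\<close>

record ('o, 'a) catmon_obj =
  cat_B :: "('o, 'a) mon"
  cat_A :: "('o, 'a) mon"
  cat_i :: 'a
  cat_s :: 'a
  cat_t :: 'a
  cat_d :: 'a

context
  fixes C :: "('o, 'a) moncat" (structure) and S :: "'a \<Rightarrow> 'a \<Rightarrow> bool"
begin

definition relative_category_in_monoids :: "('o, 'a) catmon_obj \<Rightarrow> bool" where
  "relative_category_in_monoids X \<longleftrightarrow>
     (let B = cat_B X; A = cat_A X; i = cat_i X; s = cat_s X; t = cat_t X; d = cat_d X in
        monoid_in C B \<and> monoid_in C A \<and>
        monoid_hom C B A i \<and> monoid_hom C A B s \<and> monoid_hom C A B t \<and>
        monoid_hom C (rpb_mon C S A A s t) A d \<and>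
        relative_category C S (Car B) (Car A) i s t d)"

text \<open>\<open>q_Suc X n\<close> is the arrow \<open>q\<^sub>n\<^sub>+\<^sub>1\<close>, so that \<open>n\<close> ranges over all natural numbers.\<close>

definition q_Suc :: "('o, 'a) catmon_obj \<Rightarrow> nat \<Rightarrow> 'a" where
  "q_Suc X n =
     (let B = Car (cat_B X); A = Car (cat_A X); i = cat_i X; s = cat_s X; t = cat_t X;
          pw = box_pow_mon C S (cat_B X) (cat_A X) s t;
          tn = fst (box_pow C S B s t n)
      in Mul (pw (Suc n)) \<cdot>
         ((box C S s (\<one> B) s tn (\<one> A) (box_pow_unit C S B i s t n) \<cdot> to_box_right C S B s) \<otimes>
          (box C S (\<one> B) tn s tn i (\<one> (Car (pw n))) \<cdot> to_box_left C S B tn)) \<cdot>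
         (pr1 C S s (Unt (cat_B X)) \<otimes> \<one> (Car (pw n))))"

definition catmon_object :: "('o, 'a) catmon_obj \<Rightarrow> bool" where
  "catmon_object X \<longleftrightarrow> relative_category_in_monoids X \<and> (\<forall>n. invertible C (q_Suc X n))"

definition relative_functor ::
  "('o, 'a) catmon_obj \<Rightarrow> ('o, 'a) catmon_obj \<Rightarrow> 'a \<Rightarrow> 'a \<Rightarrow> bool" where
  "relative_functor X X' b a \<longleftrightarrow>
     monoid_hom C (cat_B X) (cat_B X') b \<and> monoid_hom C (cat_A X) (cat_A X') a \<and>
     cat_s X' \<cdot> a = b \<cdot> cat_s X \<and> cat_t X' \<cdot> a = b \<cdot> cat_t X \<and> cat_i X' \<cdot> b = a \<cdot> cat_i X \<and>
     a \<cdot> cat_d X = cat_d X' \<cdot> box C S (cat_s X) (cat_t X) (cat_s X') (cat_t X') a a"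

text \<open>Morphisms carry their source and target, so that these are determined by the morphism.\<close>

definition CatMon ::
  "(('o, 'a) catmon_obj, ('o, 'a) catmon_obj \<times> ('o, 'a) catmon_obj \<times> 'a \<times> 'a) cat" where
  "CatMon =
     \<lparr>Obj = {X. catmon_object X},
      Arr = {(X, X', b, a). catmon_object X \<and> catmon_object X' \<and> relative_functor X X' b a},
      Dom = (\<lambda>(X, X', b, a). X),
      Cod = (\<lambda>(X, X', b, a). X'),
      Ident = (\<lambda>X. (X, X, \<one> (Car (cat_B X)), \<one> (Car (cat_A X)))),
      Comp = (\<lambda>(_, X'', b', a') (X, _, b, a). (X, X'', b' \<cdot> b, a' \<cdot> a))\<rparr>"

end


section \<open>Crossed modules of monoids\<close>

record ('o, 'a) xmod_obj =
  xmod_B :: "('o, 'a) mon"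
  xmod_Y :: "('o, 'a) mon"
  xmod_e :: 'a
  xmod_k :: 'a
  xmod_x :: 'a

context
  fixes C :: "('o, 'a) moncat" (structure) and S :: "'a \<Rightarrow> 'a \<Rightarrow> bool"
begin

text \<open>\<open>counit_left X Z\<close> is \<open>e \<otimes> 1 : Y \<otimes> Z \<rightarrow> I \<otimes> Z \<cong> Z\<close>.\<close>

definition counit_left :: "('o, 'a) xmod_obj \<Rightarrow> 'o \<Rightarrow> 'a" where
  "counit_left X Z = \<ell> Z \<cdot> (xmod_e X \<otimes> \<one> Z)"

text \<open>\<open>xmod_act X n\<close> is \<open>m\<^sup>(\<^sup>n\<^sup>) \<circ> (k\<^sup>n \<otimes> 1) : Y\<^sup>n \<otimes> B \<rightarrow> B\<close>.\<close>

definition xmod_act :: "('o, 'a) xmod_obj \<Rightarrow> nat \<Rightarrow> 'a" where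
  "xmod_act X n = iter_mul C (xmod_B X) n \<cdot> tpow_arr C (xmod_k X) (\<one> (Car (xmod_B X))) n"

definition f_map :: "('o, 'a) xmod_obj \<Rightarrow> 'a" where
  "f_map X =
     (let B = Car (xmod_B X); Y = Car (xmod_Y X); u = Unt (xmod_B X) in
        pairing C S (counit_left X B) u ((\<one> Y \<otimes> u) \<cdot> Inv C (\<rho> Y)) (xmod_e X))"

text \<open>\<open>b_Suc X n\<close> is the arrow \<open>b\<^sub>n\<^sub>+\<^sub>1\<close>, so that \<open>n\<close> ranges over all natural numbers.\<close>

definition b_Suc :: "('o, 'a) xmod_obj \<Rightarrow> nat \<Rightarrow> 'a" where
  "b_Suc X n =
     (let B = Car (xmod_B X); Y = Car (xmod_Y X) in
        pairing C S (counit_left X B) (xmod_act X n)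
          ((\<one> Y \<otimes> iter_mul C (xmod_B X) n) \<cdot> (\<one> Y \<otimes> tpow_arr C (xmod_k X) (\<one> B) n))
          (counit_left X (tpow C Y B n)))"

text \<open>
  The equation is stated on \<open>Y \<otimes> (B \<otimes> Y)\<close>. The last factor of the right hand side is
  \<open>u \<otimes> 1 \<otimes> 1 \<otimes> 1 \<otimes> u \<otimes> u\<close>, with codomain \<open>(Y \<otimes> (Y \<otimes> B)) \<otimes> (Y \<otimes> (Y \<otimes> B))\<close>. Note that
  \<open>xmod_act X 1 = m \<circ> (k \<otimes> 1)\<close> in any monoidal category.
\<close>

definition peiffer :: "('o, 'a) xmod_obj \<Rightarrow> bool" where
  "peiffer X \<longleftrightarrow>
     (let MB = xmod_B X; MY = xmod_Y X; x = xmod_x X; B = Car MB; Y = Car MY;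
          YB = distributive_monoid C MB MY x;
          P = rpb_mon C S YB YB (counit_left X B) (xmod_act X 1);
          b2 = b_Suc X 1
      in (Mul MY \<otimes> \<one> B) \<cdot> Inv C (\<alpha> Y Y B) \<cdot> (\<one> Y \<otimes> x) =
         (Mul MY \<otimes> \<one> B) \<cdot> Inv C (\<alpha> Y Y B) \<cdot> Inv C b2 \<cdot> Mul P \<cdot> (b2 \<otimes> b2) \<cdot>
         (((Unt MY \<otimes> \<one> (Y \<odot> B)) \<cdot> Inv C (\<ell> (Y \<odot> B))) \<otimes>
          ((\<one> Y \<otimes> ((Unt MY \<otimes> Unt MB) \<cdot> Inv C (\<ell> \<I>))) \<cdot> Inv C (\<rho> Y))) \<cdot>
         Inv C (\<alpha> Y B Y))"

definition xmod_object :: "('o, 'a) xmod_obj \<Rightarrow> bool" where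
  "xmod_object X \<longleftrightarrow>
     (let MB = xmod_B X; MY = xmod_Y X; B = Car MB; Y = Car MY;
          e = xmod_e X; k = xmod_k X; x = xmod_x X
      in monoid_in C MB \<and> monoid_in C MY \<and>
         monoid_hom C MY (trivial_monoid C) e \<and> monoid_hom C MY MB k \<and>
         distributive_law C MB MY x \<and>
         S k (\<one> Y) \<and> S (\<one> Y) e \<and> S (\<one> B) (\<one> B) \<and>
         counit_left X B \<cdot> x = \<rho> B \<cdot> (\<one> B \<otimes> e) \<and>
         Mul MB \<cdot> (k \<otimes> \<one> B) \<cdot> x = Mul MB \<cdot> (\<one> B \<otimes> k) \<and>
         invertible C (f_map X) \<and> (\<forall>n. invertible C (b_Suc X n)) \<and>
         peiffer X)"

definition xmod_morphism ::
  "('o, 'a) xmod_obj \<Rightarrow> ('o, 'a) xmod_obj \<Rightarrow> 'a \<Rightarrow> 'a \<Rightarrow> bool" where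
  "xmod_morphism X X' b y \<longleftrightarrow>
     monoid_hom C (xmod_B X) (xmod_B X') b \<and> monoid_hom C (xmod_Y X) (xmod_Y X') y \<and>
     xmod_e X' \<cdot> y = xmod_e X \<and> xmod_k X' \<cdot> y = b \<cdot> xmod_k X \<and>
     xmod_x X' \<cdot> (b \<otimes> y) = (y \<otimes> b) \<cdot> xmod_x X"

definition Xmod ::
  "(('o, 'a) xmod_obj, ('o, 'a) xmod_obj \<times> ('o, 'a) xmod_obj \<times> 'a \<times> 'a) cat" where
  "Xmod =
     \<lparr>Obj = {X. xmod_object X},
      Arr = {(X, X', b, y). xmod_object X \<and> xmod_object X' \<and> xmod_morphism X X' b y},
      Dom = (\<lambda>(X, X', b, y). X),
      Cod = (\<lambda>(X, X', b, y). X'),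
      Ident = (\<lambda>X. (X, X, \<one> (Car (xmod_B X)), \<one> (Car (xmod_Y X)))),
      Comp = (\<lambda>(_, X'', b', y') (X, _, b, y). (X, X'', b' \<cdot> b, y' \<cdot> y))\<rparr>"

end

end

theory Submission
  imports Defs
begin

text \<open>
  For a relative category \<open>(B, A, i, s, t, d)\<close> in monoids, let \<open>Y\<close> be the relative pullback of \<open>s\<close> along the
  unit of \<open>B\<close>, with projection \<open>j : Y \<rightarrow> A\<close>. Invertibility of \<open>q\<^sub>1 = m \<circ> (j \<otimes> i)\<close> says that \<open>A\<close> is
  \<open>Y \<otimes> B\<close> with the multiplication of the distributive law \<open>x = q\<^sub>1\<^sup>-\<^sup>1 \<circ> m \<circ> (i \<otimes> j)\<close>. Every morphism
  \<open>q\<^sub>n\<close> has the form \<open>m \<circ> ((\<rho> \<circ> j) \<otimes> \<lambda>)\<close> for monoid morphisms \<open>\<rho> = 1 \<box> i \<box> \<dots> \<box> i\<close> and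
  \<open>\<lambda> = i \<box> 1\<close>, and composing the \<open>q\<^sub>n\<close> with each other gives isomorphisms \<open>Y\<^sup>n \<otimes> B \<rightarrow> A\<^sup>\<box>\<^sup>n\<close> if and
  only if all \<open>b\<^sub>n\<close> are invertible. The unit laws force \<open>d\<close> to be the identity on the images of \<open>\<rho>\<close> and
  \<open>\<lambda>\<close>, so \<open>d\<close> corresponds to \<open>m \<otimes> 1 : Y \<otimes> Y \<otimes> B \<rightarrow> Y \<otimes> B\<close>; the remaining condition, that this
  be multiplicative, reduces to \<open>d (\<lambda>(a) \<rho>(j y)) = a \<cdot> j y\<close>, which is the Peiffer condition.
  Associativity of \<open>d\<close> is then an equality of monoid morphisms on \<open>A \<box> (A \<box> A)\<close>, checked on the images
  of \<open>\<rho> \<circ> j\<close> and \<open>\<lambda>\<close>.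
\<close>

section \<open>Categories\<close>

text \<open>The obstacle is what the usual notation suppresses: the category is not strict, the
  powers of A end in a factor B, and a pairing into a relative pullback exists only for spans in
  \<open>S\<close>. The last is met by the reflection clause, which supplies membership in
  \<open>S\<close> for composite legs and iterated pairings. The second is met by defining
  \<open>qn\<close> over any \<open>N\<close> with a split left leg (\<open>over\<close>): this
  covers the powers ending in B, on which q_n is defined, as well as A and A \<box> A, on which d
  and its associativity are studied.

  In \<open>split_graph\<close> the monoid Y with j is kept abstract. It is the kernel of s in one
  direction and the factor Y of Y \<otimes> B in the other; that it is a kernel is then the separate
  condition that f is invertible, so both directions use the same lemmas.

  One equation suffices for multiplicativity of d because every element of A \<box> A is a product
  \<rho>(j y) \<lambda>(a). In a product of two of these, d lets the outer factors out, and only the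
  inner \<lambda>(a) \<rho>(j y) stands in the wrong order.\<close>

context category
begin

text \<open>With typing expressed by equations on \<open>Dom\<close> and \<open>Cod\<close>, the
  simplifier can discharge the side conditions of all later rules.\<close>

lemma hom_iff [simp]: "f \<in> hom C X Y \<longleftrightarrow> f \<in> Arr C \<and> Dom C f = X \<and> Cod C f = Y"
  by (auto simp: hom_def)

lemma Obj_simps [simp]:
  "f \<in> Arr C \<Longrightarrow> Dom C f \<in> Obj C"
  "f \<in> Arr C \<Longrightarrow> Cod C f \<in> Obj C"
  by (simp_all add: Dom_Obj Cod_Obj)

lemma Ident_simps [simp]:
  assumes "X \<in> Obj C"
  shows "\<one> X \<in> Arr C" "Dom C (\<one> X) = X" "Cod C (\<one> X) = X"
  using Ident_hom[OF assms] by simp_all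

lemma Comp_simps [simp]:
  assumes "f \<in> Arr C" "g \<in> Arr C" "Dom C g = Cod C f"
  shows "g \<cdot> f \<in> Arr C" "Dom C (g \<cdot> f) = Dom C f" "Cod C (g \<cdot> f) = Cod C g"
  using Comp_hom[of f "Dom C f" "Cod C f" g "Cod C g"] assms by simp_all

lemma Comp_Ident [simp]:
  "f \<in> Arr C \<Longrightarrow> Dom C f = X \<Longrightarrow> f \<cdot> \<one> X = f"
  "f \<in> Arr C \<Longrightarrow> Cod C f = X \<Longrightarrow> \<one> X \<cdot> f = f"
  using Comp_Ident_right[of f X "Cod C f"] Comp_Ident_left[of f "Dom C f" X] by simp_all

lemma assoc [simp]:
  assumes "f \<in> Arr C" "g \<in> Arr C" "h \<in> Arr C" "Dom C g = Cod C f" "Dom C h = Cod C g"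
  shows "(h \<cdot> g) \<cdot> f = h \<cdot> g \<cdot> f"
  using Comp_assoc[of f "Dom C f" "Cod C f" g "Cod C g" h "Cod C h"] assms by simp

text \<open>Composites are normalised to the right, so an equation for \<open>g \<cdot> f\<close>
  does not match inside a longer composite. This form carries the remaining factor \<open>r\<close>
  along; \<open>reassoc2\<close> does the same for commuting squares.\<close>

lemma reassoc:
  assumes "g \<cdot> f = h" "f \<in> Arr C" "g \<in> Arr C" "Dom C g = Cod C f" "r \<in> Arr C" "Cod C r = Dom C f"
  shows "g \<cdot> f \<cdot> r = h \<cdot> r"
  using assms by (metis assoc)

lemma reassoc2:
  assumes "g \<cdot> f = k \<cdot> h" "f \<in> Arr C" "g \<in> Arr C" "Dom C g = Cod C f"
    "h \<in> Arr C" "k \<in> Arr C" "Dom C k = Cod C h" "r \<in> Arr C" "Cod C r = Dom C f"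
  shows "g \<cdot> f \<cdot> r = k \<cdot> h \<cdot> r"
proof -
  have "Dom C h = Dom C f" using assms by (metis Comp_simps(2))
  then show ?thesis using assms by (metis assoc)
qed

lemma inverse_arrows_unique:
  assumes "inverse_arrows C f g" "inverse_arrows C f g'"
  shows "g = g'"
proof -
  have "g = g \<cdot> (f \<cdot> g')" using assms by (simp add: inverse_arrows_def)
  also have "\<dots> = (g \<cdot> f) \<cdot> g'" using assms unfolding inverse_arrows_def by (intro assoc[symmetric]) auto
  also have "\<dots> = g'" using assms by (simp add: inverse_arrows_def)
  finally show ?thesis .
qed

lemma Inv_eqI: "inverse_arrows C f g \<Longrightarrow> Inv C f = g"
  unfolding Inv_def using inverse_arrows_unique by blast

lemma inverse_arrows_Inv: "invertible C f \<Longrightarrow> inverse_arrows C f (Inv C f)"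
  unfolding invertible_def using Inv_eqI by metis

lemma Inv_simps [simp]:
  assumes "invertible C f"
  shows "Inv C f \<in> Arr C" "Dom C (Inv C f) = Cod C f" "Cod C (Inv C f) = Dom C f"
    "Inv C f \<cdot> f = \<one> (Dom C f)" "f \<cdot> Inv C f = \<one> (Cod C f)"
  using inverse_arrows_Inv[OF assms] by (simp_all add: inverse_arrows_def)

lemma invertible_Arr: "invertible C f \<Longrightarrow> f \<in> Arr C"
  by (auto simp: invertible_def inverse_arrows_def)

lemma Inv_cancel [simp]:
  assumes "invertible C f" "r \<in> Arr C"
  shows "Cod C r = Dom C f \<Longrightarrow> Inv C f \<cdot> f \<cdot> r = r" "Cod C r = Cod C f \<Longrightarrow> f \<cdot> Inv C f \<cdot> r = r"
  using assms invertible_Arr[OF assms(1)]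
    reassoc[OF Inv_simps(4)[OF assms(1)], of r] reassoc[OF Inv_simps(5)[OF assms(1)], of r] by simp_all

lemma invertibleI:
  assumes "f \<in> Arr C" "g \<in> Arr C" "Dom C g = Cod C f" "Cod C g = Dom C f"
    "g \<cdot> f = \<one> (Dom C f)" "f \<cdot> g = \<one> (Cod C f)"
  shows "invertible C f"
  using assms unfolding invertible_def inverse_arrows_def by blast

lemma Inv_eq:
  assumes "f \<in> Arr C" "g \<in> Arr C" "Dom C g = Cod C f" "Cod C g = Dom C f"
    "g \<cdot> f = \<one> (Dom C f)" "f \<cdot> g = \<one> (Cod C f)"
  shows "Inv C f = g"
  using assms by (intro Inv_eqI) (simp add: inverse_arrows_def)

lemma invertible_Ident: "X \<in> Obj C \<Longrightarrow> invertible C (\<one> X)"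
  by (rule invertibleI[where g = "\<one> X"]) simp_all

lemma invertible_Inv: "invertible C f \<Longrightarrow> invertible C (Inv C f)"
  by (rule invertibleI[where g = f]) (simp_all add: invertible_Arr)

lemma invertible_Comp:
  assumes "invertible C f" "invertible C g" "Dom C g = Cod C f"
  shows "invertible C (g \<cdot> f)"
  by (rule invertibleI[where g = "Inv C f \<cdot> Inv C g"]) (use assms in \<open>simp_all add: invertible_Arr\<close>)

lemma invertible_cancel_right:
  assumes "invertible C (g \<cdot> f)" "invertible C f" "g \<in> Arr C" "Dom C g = Cod C f"
  shows "invertible C g"
proof -
  have "g = (g \<cdot> f) \<cdot> Inv C f" using assms by (simp add: invertible_Arr)
  then show ?thesis
    using invertible_Comp[of "Inv C f" "g \<cdot> f"] assms by (simp add: invertible_Inv invertible_Arr)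
qed

lemma invertible_cancel_left:
  assumes "invertible C (g \<cdot> f)" "invertible C g" "f \<in> Arr C" "Dom C g = Cod C f"
  shows "invertible C f"
proof -
  have "f = Inv C g \<cdot> (g \<cdot> f)" using assms by (simp add: invertible_Arr)
  then show ?thesis
    using invertible_Comp[of "g \<cdot> f" "Inv C g"] assms by (simp add: invertible_Inv invertible_Arr)
qed

lemma cancel_epi:
  assumes "g \<cdot> f = h \<cdot> f" "invertible C f" "g \<in> Arr C" "h \<in> Arr C" "Dom C g = Cod C f" "Dom C h = Cod C f"
  shows "g = h"
proof -
  have "(g \<cdot> f) \<cdot> Inv C f = (h \<cdot> f) \<cdot> Inv C f" using assms(1) by (rule arg_cong)
  then show ?thesis using assms(2-) invertible_Arr[of f] by simp
qed

lemma cancel_mono: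
  assumes "f \<cdot> g = f \<cdot> h" "invertible C f" "g \<in> Arr C" "h \<in> Arr C" "Cod C g = Dom C f" "Cod C h = Dom C f"
  shows "g = h"
proof -
  have "Inv C f \<cdot> f \<cdot> g = Inv C f \<cdot> f \<cdot> h" using assms(1) by (rule arg_cong)
  then show ?thesis using assms(2-) by simp
qed

end

section \<open>Monoidal categories\<close>

context monoidal_category
begin

lemma Tensor_Obj_simps [simp]: "X \<in> Obj C \<Longrightarrow> Y \<in> Obj C \<Longrightarrow> X \<odot> Y \<in> Obj C" "\<I> \<in> Obj C"
  by (simp_all add: Tensor_Obj Unit_Obj)

lemma Tensor_simps [simp]:
  assumes "f \<in> Arr C" "g \<in> Arr C"
  shows "f \<otimes> g \<in> Arr C" "Dom C (f \<otimes> g) = Dom C f \<odot> Dom C g" "Cod C (f \<otimes> g) = Cod C f \<odot> Cod C g"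
  using Tensor_hom[of f "Dom C f" "Cod C f" g "Dom C g" "Cod C g"] assms by simp_all

lemma Tensor_Ident_simp [simp]: "X \<in> Obj C \<Longrightarrow> Y \<in> Obj C \<Longrightarrow> \<one> X \<otimes> \<one> Y = \<one> (X \<odot> Y)"
  by (rule Tensor_Ident)

lemma interchange:
  assumes "f \<in> Arr C" "g \<in> Arr C" "f' \<in> Arr C" "g' \<in> Arr C" "Dom C g = Cod C f" "Dom C g' = Cod C f'"
  shows "(g \<otimes> g') \<cdot> (f \<otimes> f') = (g \<cdot> f) \<otimes> (g' \<cdot> f')"
  using Tensor_Comp[of f "Dom C f" "Cod C f" g "Cod C g" f' "Dom C f'" "Cod C f'" g' "Cod C g'"] assms
  by simp

lemma interchange_r:
  assumes "f \<in> Arr C" "g \<in> Arr C" "f' \<in> Arr C" "g' \<in> Arr C" "Dom C g = Cod C f" "Dom C g' = Cod C f'"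
    "r \<in> Arr C" "Cod C r = Dom C f \<odot> Dom C f'"
  shows "(g \<otimes> g') \<cdot> (f \<otimes> f') \<cdot> r = ((g \<cdot> f) \<otimes> (g' \<cdot> f')) \<cdot> r"
  using assms by (intro reassoc interchange) simp_all

text \<open>The normal form merges composable tensors into one. Steps that delete these rules need
  the factors kept apart, so that naturality or the pentagon can match.\<close>

lemmas [simp] = interchange interchange_r

section \<open>Coherence isomorphisms: naturality and derived identities\<close>

lemma invertible_coherence [simp]:
  "X \<in> Obj C \<Longrightarrow> Y \<in> Obj C \<Longrightarrow> Z \<in> Obj C \<Longrightarrow> invertible C (\<alpha> X Y Z)"
  "X \<in> Obj C \<Longrightarrow> invertible C (\<ell> X)" "X \<in> Obj C \<Longrightarrow> invertible C (\<rho> X)"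
  by (simp_all add: Assoc_iso Lunit_iso Runit_iso)

lemma coherence_simps [simp]:
  "X \<in> Obj C \<Longrightarrow> Y \<in> Obj C \<Longrightarrow> Z \<in> Obj C \<Longrightarrow> \<alpha> X Y Z \<in> Arr C"
  "X \<in> Obj C \<Longrightarrow> Y \<in> Obj C \<Longrightarrow> Z \<in> Obj C \<Longrightarrow> Dom C (\<alpha> X Y Z) = (X \<odot> Y) \<odot> Z"
  "X \<in> Obj C \<Longrightarrow> Y \<in> Obj C \<Longrightarrow> Z \<in> Obj C \<Longrightarrow> Cod C (\<alpha> X Y Z) = X \<odot> (Y \<odot> Z)"
  "X \<in> Obj C \<Longrightarrow> \<ell> X \<in> Arr C" "X \<in> Obj C \<Longrightarrow> Dom C (\<ell> X) = \<I> \<odot> X" "X \<in> Obj C \<Longrightarrow> Cod C (\<ell> X) = X"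
  "X \<in> Obj C \<Longrightarrow> \<rho> X \<in> Arr C" "X \<in> Obj C \<Longrightarrow> Dom C (\<rho> X) = X \<odot> \<I>" "X \<in> Obj C \<Longrightarrow> Cod C (\<rho> X) = X"
  using Assoc_hom Lunit_hom Runit_hom by simp_all

lemma invertible_Tensor:
  assumes "invertible C f" "invertible C g"
  shows "invertible C (f \<otimes> g)" "Inv C (f \<otimes> g) = Inv C f \<otimes> Inv C g"
   apply (rule invertibleI[where g = "Inv C f \<otimes> Inv C g"])
  using assms apply (simp_all add: invertible_Arr)
  apply (rule Inv_eq)
  using assms apply (simp_all add: invertible_Arr)
  done

lemma assoc_nat:
  assumes "f \<in> Arr C" "g \<in> Arr C" "h \<in> Arr C" "Cod C f = X" "Cod C g = Y" "Cod C h = Z"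
  shows "\<alpha> X Y Z \<cdot> ((f \<otimes> g) \<otimes> h) = (f \<otimes> g \<otimes> h) \<cdot> \<alpha> (Dom C f) (Dom C g) (Dom C h)"
  using Assoc_natural[of f "Dom C f" X g "Dom C g" Y h "Dom C h" Z] assms by simp

lemma assoc_nat_r:
  assumes "f \<in> Arr C" "g \<in> Arr C" "h \<in> Arr C" "Cod C f = X" "Cod C g = Y" "Cod C h = Z"
    "r \<in> Arr C" "Cod C r = (Dom C f \<odot> Dom C g) \<odot> Dom C h"
  shows "\<alpha> X Y Z \<cdot> ((f \<otimes> g) \<otimes> h) \<cdot> r = (f \<otimes> g \<otimes> h) \<cdot> \<alpha> (Dom C f) (Dom C g) (Dom C h) \<cdot> r"
  using assms by (intro reassoc2 assoc_nat) auto

lemma assoc_inv_nat: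
  assumes "f \<in> Arr C" "g \<in> Arr C" "h \<in> Arr C" "Cod C f = X" "Cod C g = Y" "Cod C h = Z"
  shows "Inv C (\<alpha> X Y Z) \<cdot> (f \<otimes> g \<otimes> h) = ((f \<otimes> g) \<otimes> h) \<cdot> Inv C (\<alpha> (Dom C f) (Dom C g) (Dom C h))"
  apply (rule cancel_epi[where f = "\<alpha> (Dom C f) (Dom C g) (Dom C h)"])
  apply (rule cancel_mono[where f = "\<alpha> X Y Z"])
  using assms by (auto simp: assoc_nat)

lemma assoc_inv_nat_r:
  assumes "f \<in> Arr C" "g \<in> Arr C" "h \<in> Arr C" "Cod C f = X" "Cod C g = Y" "Cod C h = Z"
    "r \<in> Arr C" "Cod C r = Dom C f \<odot> (Dom C g \<odot> Dom C h)"
  shows "Inv C (\<alpha> X Y Z) \<cdot> (f \<otimes> g \<otimes> h) \<cdot> r = ((f \<otimes> g) \<otimes> h) \<cdot> Inv C (\<alpha> (Dom C f) (Dom C g) (Dom C h)) \<cdot> r"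
  using assms by (intro reassoc2 assoc_inv_nat) auto

lemma lunit_nat:
  assumes "f \<in> Arr C" "Cod C f = Y"
  shows "\<ell> Y \<cdot> (\<one> \<I> \<otimes> f) = f \<cdot> \<ell> (Dom C f)"
  using Lunit_natural[of f "Dom C f" Y] assms by simp

lemma runit_nat:
  assumes "f \<in> Arr C" "Cod C f = Y"
  shows "\<rho> Y \<cdot> (f \<otimes> \<one> \<I>) = f \<cdot> \<rho> (Dom C f)"
  using Runit_natural[of f "Dom C f" Y] assms by simp

lemma lunit_inv_nat:
  assumes "f \<in> Arr C" "Cod C f = Y"
  shows "(\<one> \<I> \<otimes> f) \<cdot> Inv C (\<ell> (Dom C f)) = Inv C (\<ell> Y) \<cdot> f"
  apply (rule cancel_epi[where f = "\<ell> (Dom C f)"])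
  apply (rule cancel_mono[where f = "\<ell> Y"])
  using assms by (auto simp: lunit_nat)

lemma runit_inv_nat:
  assumes "f \<in> Arr C" "Cod C f = Y"
  shows "(f \<otimes> \<one> \<I>) \<cdot> Inv C (\<rho> (Dom C f)) = Inv C (\<rho> Y) \<cdot> f"
  apply (rule cancel_epi[where f = "\<rho> (Dom C f)"])
  apply (rule cancel_mono[where f = "\<rho> Y"])
  using assms by (auto simp: runit_nat)

text \<open>Tensoring with the unit object is naturally isomorphic to the identity functor, hence
  faithful.\<close>

lemma lunit_faithful:
  assumes "\<one> \<I> \<otimes> f = \<one> \<I> \<otimes> g" "f \<in> Arr C" "g \<in> Arr C" "Dom C f = Dom C g" "Cod C f = Cod C g"
  shows "f = g"
proof -
  have "f \<cdot> \<ell> (Dom C f) = g \<cdot> \<ell> (Dom C f)"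
    using assms lunit_nat[of f "Cod C f"] lunit_nat[of g "Cod C f"] by simp
  then show ?thesis by (rule cancel_epi) (use assms in simp_all)
qed

lemma runit_faithful:
  assumes "f \<otimes> \<one> \<I> = g \<otimes> \<one> \<I>" "f \<in> Arr C" "g \<in> Arr C" "Dom C f = Dom C g" "Cod C f = Cod C g"
  shows "f = g"
proof -
  have "f \<cdot> \<rho> (Dom C f) = g \<cdot> \<rho> (Dom C f)"
    using assms runit_nat[of f "Cod C f"] runit_nat[of g "Cod C f"] by simp
  then show ?thesis by (rule cancel_epi) (use assms in simp_all)
qed

text \<open>A classical consequence of the axioms: after tensoring with the unit object, the claim
  follows from the pentagon for \<I>, \<I>, X, Y and two triangles. The isomorphism
  \<open>?v\<close> is composed on the right to expose the pentagon and is cancelled at the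
  end.\<close>

lemma lunit_tensor:
  assumes "X \<in> Obj C" "Y \<in> Obj C"
  shows "\<ell> (X \<odot> Y) \<cdot> \<alpha> \<I> X Y = \<ell> X \<otimes> \<one> Y"
proof (rule lunit_faithful)
  let ?v = "\<alpha> \<I> (\<I> \<odot> X) Y \<cdot> (\<alpha> \<I> \<I> X \<otimes> \<one> Y)"
  have v: "invertible C ?v"
    using assms by (intro invertible_Comp) (simp_all add: invertible_Tensor invertible_Ident)
  have "(\<one> \<I> \<otimes> (\<ell> (X \<odot> Y) \<cdot> \<alpha> \<I> X Y)) \<cdot> ?v = (\<one> \<I> \<otimes> \<ell> (X \<odot> Y)) \<cdot> (\<one> \<I> \<otimes> \<alpha> \<I> X Y) \<cdot> ?v"
    using assms by simp
  also have "\<dots> = (\<one> \<I> \<otimes> \<ell> (X \<odot> Y)) \<cdot> \<alpha> \<I> \<I> (X \<odot> Y) \<cdot> \<alpha> (\<I> \<odot> \<I>) X Y"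
    using assms pentagon[of \<I> \<I> X Y] by simp
  also have "\<dots> = (\<rho> \<I> \<otimes> \<one> (X \<odot> Y)) \<cdot> \<alpha> (\<I> \<odot> \<I>) X Y"
    by (rule reassoc[OF triangle]) (use assms in simp_all)
  also have "\<dots> = \<alpha> \<I> X Y \<cdot> ((\<rho> \<I> \<otimes> \<one> X) \<otimes> \<one> Y)"
    using assms by (simp add: assoc_nat)
  also have "\<dots> = \<alpha> \<I> X Y \<cdot> ((\<one> \<I> \<otimes> \<ell> X) \<otimes> \<one> Y) \<cdot> (\<alpha> \<I> \<I> X \<otimes> \<one> Y)"
    using assms by (simp add: triangle)
  also have "\<dots> = (\<one> \<I> \<otimes> (\<ell> X \<otimes> \<one> Y)) \<cdot> ?v"
    using assms by (simp add: assoc_nat_r del: interchange)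
  finally show "\<one> \<I> \<otimes> (\<ell> (X \<odot> Y) \<cdot> \<alpha> \<I> X Y) = \<one> \<I> \<otimes> \<ell> X \<otimes> \<one> Y"
    by (rule cancel_epi[OF _ v]) (use assms v in simp_all)
qed (use assms in simp_all)

text \<open>The mirror image of \<open>lunit_tensor\<close>, by the pentagon for X, Y, \<I>,
  \<I>.\<close>

lemma runit_tensor:
  assumes "X \<in> Obj C" "Y \<in> Obj C"
  shows "(\<one> X \<otimes> \<rho> Y) \<cdot> \<alpha> X Y \<I> = \<rho> (X \<odot> Y)"
proof (rule runit_faithful)
  have "\<alpha> X Y \<I> \<cdot> (((\<one> X \<otimes> \<rho> Y) \<cdot> \<alpha> X Y \<I>) \<otimes> \<one> \<I>) = \<alpha> X Y \<I> \<cdot> ((\<one> X \<otimes> \<rho> Y) \<otimes> \<one> \<I>) \<cdot> (\<alpha> X Y \<I> \<otimes> \<one> \<I>)"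
    using assms by simp
  also have "\<dots> = (\<one> X \<otimes> (\<rho> Y \<otimes> \<one> \<I>)) \<cdot> \<alpha> X (Y \<odot> \<I>) \<I> \<cdot> (\<alpha> X Y \<I> \<otimes> \<one> \<I>)"
    using assms by (simp add: assoc_nat_r del: interchange)
  also have "\<dots> = (\<one> X \<otimes> (\<one> Y \<otimes> \<ell> \<I>)) \<cdot> (\<one> X \<otimes> \<alpha> Y \<I> \<I>) \<cdot> \<alpha> X (Y \<odot> \<I>) \<I> \<cdot> (\<alpha> X Y \<I> \<otimes> \<one> \<I>)"
    using assms by (simp add: triangle)
  also have "\<dots> = (\<one> X \<otimes> (\<one> Y \<otimes> \<ell> \<I>)) \<cdot> \<alpha> X Y (\<I> \<odot> \<I>) \<cdot> \<alpha> (X \<odot> Y) \<I> \<I>"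
    using assms pentagon[of X Y \<I> \<I>] by simp
  also have "\<dots> = \<alpha> X Y \<I> \<cdot> (\<one> (X \<odot> Y) \<otimes> \<ell> \<I>) \<cdot> \<alpha> (X \<odot> Y) \<I> \<I>"
    using assms assoc_nat_r[of "\<one> X" "\<one> Y" "\<ell> \<I>" X Y \<I> "\<alpha> (X \<odot> Y) \<I> \<I>"] by simp
  also have "\<dots> = \<alpha> X Y \<I> \<cdot> (\<rho> (X \<odot> Y) \<otimes> \<one> \<I>)"
    using assms by (simp add: triangle)
  finally show "((\<one> X \<otimes> \<rho> Y) \<cdot> \<alpha> X Y \<I>) \<otimes> \<one> \<I> = \<rho> (X \<odot> Y) \<otimes> \<one> \<I>"
    by (rule cancel_mono[where f = "\<alpha> X Y \<I>"]) (use assms in simp_all)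
qed (use assms in simp_all)

text \<open>Naturality of \<ell> at \<ell> \<I> identifies \<ell> (\<I> \<odot> \<I>) with
  \<open>\<one> \<I> \<otimes> \<ell> \<I>\<close>; then \<open>lunit_tensor\<close> and the
  triangle have the same left hand side.\<close>

lemma lunit_runit_unit: "\<ell> \<I> = \<rho> \<I>"
proof (rule runit_faithful)
  have "\<ell> (\<I> \<odot> \<I>) = \<one> \<I> \<otimes> \<ell> \<I>"
    by (rule cancel_mono[where f = "\<ell> \<I>"]) (simp_all add: lunit_nat)
  then show "\<ell> \<I> \<otimes> \<one> \<I> = \<rho> \<I> \<otimes> \<one> \<I>"
    using lunit_tensor[of \<I> \<I>] triangle[of \<I> \<I>] by simp
qed simp_all

lemma triangle_inv:
  assumes "X \<in> Obj C" "Y \<in> Obj C"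
  shows "(\<rho> X \<otimes> \<one> Y) \<cdot> Inv C (\<alpha> X \<I> Y) = \<one> X \<otimes> \<ell> Y"
    "\<alpha> X \<I> Y \<cdot> (Inv C (\<rho> X) \<otimes> \<one> Y) = \<one> X \<otimes> Inv C (\<ell> Y)"
proof -
  show "(\<rho> X \<otimes> \<one> Y) \<cdot> Inv C (\<alpha> X \<I> Y) = \<one> X \<otimes> \<ell> Y"
    by (rule cancel_epi[where f = "\<alpha> X \<I> Y"]) (use assms in \<open>simp_all add: triangle\<close>)
  show "\<alpha> X \<I> Y \<cdot> (Inv C (\<rho> X) \<otimes> \<one> Y) = \<one> X \<otimes> Inv C (\<ell> Y)"
    by (rule cancel_mono[where f = "\<one> X \<otimes> \<ell> Y"])
      (use assms reassoc[OF triangle[OF assms], of "Inv C (\<rho> X) \<otimes> \<one> Y"] in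
        \<open>simp_all add: invertible_Tensor invertible_Ident\<close>)
qed

lemma lunit_tensor_inv:
  assumes "X \<in> Obj C" "Y \<in> Obj C"
  shows "(\<ell> X \<otimes> \<one> Y) \<cdot> Inv C (\<alpha> \<I> X Y) = \<ell> (X \<odot> Y)"
    "\<alpha> \<I> X Y \<cdot> (Inv C (\<ell> X) \<otimes> \<one> Y) = Inv C (\<ell> (X \<odot> Y))"
proof -
  show "(\<ell> X \<otimes> \<one> Y) \<cdot> Inv C (\<alpha> \<I> X Y) = \<ell> (X \<odot> Y)"
    by (rule cancel_epi[where f = "\<alpha> \<I> X Y"]) (use assms in \<open>simp_all add: lunit_tensor\<close>)
  show "\<alpha> \<I> X Y \<cdot> (Inv C (\<ell> X) \<otimes> \<one> Y) = Inv C (\<ell> (X \<odot> Y))"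
    by (rule cancel_mono[where f = "\<ell> (X \<odot> Y)"])
      (use assms reassoc[OF lunit_tensor[OF assms], of "Inv C (\<ell> X) \<otimes> \<one> Y"] in simp_all)
qed

lemma runit_tensor_inv:
  assumes "X \<in> Obj C" "Y \<in> Obj C"
  shows "Inv C (\<alpha> X Y \<I>) \<cdot> (\<one> X \<otimes> Inv C (\<rho> Y)) = Inv C (\<rho> (X \<odot> Y))"
proof -
  have "(\<one> X \<otimes> \<rho> Y) \<cdot> \<alpha> X Y \<I> \<cdot> Inv C (\<alpha> X Y \<I>) \<cdot> (\<one> X \<otimes> Inv C (\<rho> Y)) = \<one> (X \<odot> Y)"
    using assms by simp
  then have "\<rho> (X \<odot> Y) \<cdot> Inv C (\<alpha> X Y \<I>) \<cdot> (\<one> X \<otimes> Inv C (\<rho> Y)) = \<one> (X \<odot> Y)"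
    using assms reassoc[OF runit_tensor[OF assms], of "Inv C (\<alpha> X Y \<I>) \<cdot> (\<one> X \<otimes> Inv C (\<rho> Y))"] by simp
  then have "\<rho> (X \<odot> Y) \<cdot> (Inv C (\<alpha> X Y \<I>) \<cdot> (\<one> X \<otimes> Inv C (\<rho> Y))) = \<rho> (X \<odot> Y) \<cdot> Inv C (\<rho> (X \<odot> Y))"
    using assms by simp
  then show ?thesis by (rule cancel_mono) (use assms in simp_all)
qed

lemma pentagon_inv:
  assumes "W \<in> Obj C" "X \<in> Obj C" "Y \<in> Obj C" "Z \<in> Obj C"
  shows "\<alpha> (W \<odot> X) Y Z \<cdot> (Inv C (\<alpha> W X Y) \<otimes> \<one> Z)
    = Inv C (\<alpha> W X (Y \<odot> Z)) \<cdot> (\<one> W \<otimes> \<alpha> X Y Z) \<cdot> \<alpha> W (X \<odot> Y) Z"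
proof (rule cancel_epi[where f = "\<alpha> W X Y \<otimes> \<one> Z"])
  show "(\<alpha> (W \<odot> X) Y Z \<cdot> (Inv C (\<alpha> W X Y) \<otimes> \<one> Z)) \<cdot> (\<alpha> W X Y \<otimes> \<one> Z) =
    (Inv C (\<alpha> W X (Y \<odot> Z)) \<cdot> (\<one> W \<otimes> \<alpha> X Y Z) \<cdot> \<alpha> W (X \<odot> Y) Z) \<cdot> (\<alpha> W X Y \<otimes> \<one> Z)"
    using assms by (simp add: pentagon)
qed (use assms in \<open>simp_all add: invertible_Tensor invertible_Ident\<close>)

end

section \<open>Monoids\<close>

context monoidal_category
begin

text \<open>The whiskering rules run against \<open>interchange\<close>; used with that rule
  deleted, they spread a composite over several tensors.\<close>

lemma whisker_left:
  "f \<in> Arr C \<Longrightarrow> g \<in> Arr C \<Longrightarrow> Dom C g = Cod C f \<Longrightarrow> X \<in> Obj C \<Longrightarrow> \<one> X \<otimes> (g \<cdot> f) = (\<one> X \<otimes> g) \<cdot> (\<one> X \<otimes> f)"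
  by simp

lemma whisker_right:
  "f \<in> Arr C \<Longrightarrow> g \<in> Arr C \<Longrightarrow> Dom C g = Cod C f \<Longrightarrow> X \<in> Obj C \<Longrightarrow> (g \<cdot> f) \<otimes> \<one> X = (g \<otimes> \<one> X) \<cdot> (f \<otimes> \<one> X)"
  by simp

section \<open>Pentagon identities with inverted associators\<close>

lemma pentagon_inv1:
  assumes "W \<in> Obj C" "X \<in> Obj C" "Y \<in> Obj C" "Z \<in> Obj C"
  shows "(\<alpha> W X Y \<otimes> \<one> Z) \<cdot> Inv C (\<alpha> (W \<odot> X) Y Z)
    = Inv C (\<alpha> W (X \<odot> Y) Z) \<cdot> (\<one> W \<otimes> Inv C (\<alpha> X Y Z)) \<cdot> \<alpha> W X (Y \<odot> Z)"
proof -
  let ?q = "(\<one> W \<otimes> \<alpha> X Y Z) \<cdot> \<alpha> W (X \<odot> Y) Z" and ?l = "(\<alpha> W X Y \<otimes> \<one> Z) \<cdot> Inv C (\<alpha> (W \<odot> X) Y Z)"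
  have "((\<one> W \<otimes> \<alpha> X Y Z) \<cdot> \<alpha> W (X \<odot> Y) Z \<cdot> (\<alpha> W X Y \<otimes> \<one> Z)) \<cdot> Inv C (\<alpha> (W \<odot> X) Y Z) = \<alpha> W X (Y \<odot> Z)"
    unfolding pentagon[OF assms] using assms by simp
  then have "?q \<cdot> ?l = ?q \<cdot> (Inv C (\<alpha> W (X \<odot> Y) Z) \<cdot> (\<one> W \<otimes> Inv C (\<alpha> X Y Z)) \<cdot> \<alpha> W X (Y \<odot> Z))"
    using assms by simp
  then show ?thesis
    by (rule cancel_mono)
      (use assms in \<open>simp_all add: invertible_Comp invertible_Tensor invertible_Ident\<close>)
qed

lemma pentagon_inv2:
  assumes "W \<in> Obj C" "X \<in> Obj C" "Y \<in> Obj C" "Z \<in> Obj C"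
  shows "(Inv C (\<alpha> W X Y) \<otimes> \<one> Z) \<cdot> Inv C (\<alpha> W (X \<odot> Y) Z)
    = Inv C (\<alpha> (W \<odot> X) Y Z) \<cdot> Inv C (\<alpha> W X (Y \<odot> Z)) \<cdot> (\<one> W \<otimes> \<alpha> X Y Z)"
proof -
  have "((\<alpha> W X Y \<otimes> \<one> Z) \<cdot> Inv C (\<alpha> (W \<odot> X) Y Z)) \<cdot> Inv C (\<alpha> W X (Y \<odot> Z)) \<cdot> (\<one> W \<otimes> \<alpha> X Y Z)
    = Inv C (\<alpha> W (X \<odot> Y) Z)"
    unfolding pentagon_inv1[OF assms] using assms by simp
  then have "(\<alpha> W X Y \<otimes> \<one> Z) \<cdot> ((Inv C (\<alpha> W X Y) \<otimes> \<one> Z) \<cdot> Inv C (\<alpha> W (X \<odot> Y) Z))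
    = (\<alpha> W X Y \<otimes> \<one> Z) \<cdot> (Inv C (\<alpha> (W \<odot> X) Y Z) \<cdot> Inv C (\<alpha> W X (Y \<odot> Z)) \<cdot> (\<one> W \<otimes> \<alpha> X Y Z))"
    using assms by simp
  then show ?thesis
    by (rule cancel_mono)
      (use assms in \<open>simp_all add: invertible_Comp invertible_Tensor invertible_Ident\<close>)
qed

lemma pentagon_inv1_r:
  assumes "W \<in> Obj C" "X \<in> Obj C" "Y \<in> Obj C" "Z \<in> Obj C" "r \<in> Arr C" "Cod C r = (W \<odot> X) \<odot> Y \<odot> Z"
  shows "(\<alpha> W X Y \<otimes> \<one> Z) \<cdot> Inv C (\<alpha> (W \<odot> X) Y Z) \<cdot> r
    = Inv C (\<alpha> W (X \<odot> Y) Z) \<cdot> (\<one> W \<otimes> Inv C (\<alpha> X Y Z)) \<cdot> \<alpha> W X (Y \<odot> Z) \<cdot> r"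
  using arg_cong[OF pentagon_inv1[OF assms(1-4)], of "\<lambda>h. h \<cdot> r"] assms by simp

lemma pentagon_inv2_r:
  assumes "W \<in> Obj C" "X \<in> Obj C" "Y \<in> Obj C" "Z \<in> Obj C" "r \<in> Arr C" "Cod C r = W \<odot> (X \<odot> Y) \<odot> Z"
  shows "(Inv C (\<alpha> W X Y) \<otimes> \<one> Z) \<cdot> Inv C (\<alpha> W (X \<odot> Y) Z) \<cdot> r
    = Inv C (\<alpha> (W \<odot> X) Y Z) \<cdot> Inv C (\<alpha> W X (Y \<odot> Z)) \<cdot> (\<one> W \<otimes> \<alpha> X Y Z) \<cdot> r"
  using arg_cong[OF pentagon_inv2[OF assms(1-4)], of "\<lambda>h. h \<cdot> r"] assms by simp

lemma pentagon_inv_r: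
  assumes "W \<in> Obj C" "X \<in> Obj C" "Y \<in> Obj C" "Z \<in> Obj C" "r \<in> Arr C" "Cod C r = (W \<odot> X \<odot> Y) \<odot> Z"
  shows "\<alpha> (W \<odot> X) Y Z \<cdot> (Inv C (\<alpha> W X Y) \<otimes> \<one> Z) \<cdot> r
    = Inv C (\<alpha> W X (Y \<odot> Z)) \<cdot> (\<one> W \<otimes> \<alpha> X Y Z) \<cdot> \<alpha> W (X \<odot> Y) Z \<cdot> r"
  using arg_cong[OF pentagon_inv[OF assms(1-4)], of "\<lambda>h. h \<cdot> r"] assms by simp

lemma assoc_inv_nat_left:
  assumes "f \<in> Arr C" "g \<in> Arr C" "h \<in> Arr C" "Dom C f = X" "Dom C g = Y" "Dom C h = Z"
  shows "((f \<otimes> g) \<otimes> h) \<cdot> Inv C (\<alpha> X Y Z) = Inv C (\<alpha> (Cod C f) (Cod C g) (Cod C h)) \<cdot> (f \<otimes> g \<otimes> h)"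
  using assms assoc_inv_nat[of f g h "Cod C f" "Cod C g" "Cod C h"] by simp

lemma assoc_inv_nat_left_r:
  assumes "f \<in> Arr C" "g \<in> Arr C" "h \<in> Arr C" "Dom C f = X" "Dom C g = Y" "Dom C h = Z"
    "r \<in> Arr C" "Cod C r = X \<odot> Y \<odot> Z"
  shows "((f \<otimes> g) \<otimes> h) \<cdot> Inv C (\<alpha> X Y Z) \<cdot> r = Inv C (\<alpha> (Cod C f) (Cod C g) (Cod C h)) \<cdot> (f \<otimes> g \<otimes> h) \<cdot> r"
  by (rule reassoc2[OF assoc_inv_nat_left[OF assms(1-6)]]) (use assms in auto)

lemma monoid_simps [simp]:
  assumes "monoid_in C M"
  shows "Car M \<in> Obj C" "Mul M \<in> Arr C" "Dom C (Mul M) = Car M \<odot> Car M" "Cod C (Mul M) = Car M"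
    "Unt M \<in> Arr C" "Dom C (Unt M) = \<I>" "Cod C (Unt M) = Car M"
  using assms unfolding monoid_in_def hom_iff by blast+

lemma monoid_axioms:
  assumes "monoid_in C M"
  shows "Mul M \<cdot> (Mul M \<otimes> \<one> (Car M)) = Mul M \<cdot> (\<one> (Car M) \<otimes> Mul M) \<cdot> \<alpha> (Car M) (Car M) (Car M)"
    "Mul M \<cdot> (Unt M \<otimes> \<one> (Car M)) = \<ell> (Car M)"
    "Mul M \<cdot> (\<one> (Car M) \<otimes> Unt M) = \<rho> (Car M)"
  using assms unfolding monoid_in_def by blast+

lemma monoid_homD:
  assumes "monoid_hom C M N f"
  shows "f \<in> Arr C" "Dom C f = Car M" "Cod C f = Car N"
    "f \<cdot> Mul M = Mul N \<cdot> (f \<otimes> f)" "f \<cdot> Unt M = Unt N"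
  using assms unfolding monoid_hom_def hom_iff by blast+

text \<open>
  Reasoning with products \<open>f \<star> g\<close> of generalised elements of a monoid confines the coherence
  isomorphisms to the associativity and unit rules below.
\<close>

definition conv :: "'a \<Rightarrow> ('o, 'a) mon \<Rightarrow> 'a \<Rightarrow> 'a"  ("_ \<star>\<^bsub>_\<^esub> _" [71, 0, 70] 70) where
  "f \<star>\<^bsub>M\<^esub> g = Mul M \<cdot> (f \<otimes> g)"

lemma conv_simps [simp]:
  assumes "monoid_in C M" "f \<in> Arr C" "g \<in> Arr C" "Cod C f = Car M" "Cod C g = Car M"
  shows "f \<star>\<^bsub>M\<^esub> g \<in> Arr C" "Dom C (f \<star>\<^bsub>M\<^esub> g) = Dom C f \<odot> Dom C g" "Cod C (f \<star>\<^bsub>M\<^esub> g) = Car M"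
  using assms by (simp_all add: conv_def)

lemma conv_Comp [simp]:
  assumes "monoid_in C M" "f \<in> Arr C" "g \<in> Arr C" "Cod C f = Car M" "Cod C g = Car M"
    "h \<in> Arr C" "k \<in> Arr C" "Dom C f = Cod C h" "Dom C g = Cod C k"
  shows "(f \<star>\<^bsub>M\<^esub> g) \<cdot> (h \<otimes> k) = (f \<cdot> h) \<star>\<^bsub>M\<^esub> (g \<cdot> k)"
  using assms by (simp add: conv_def)

lemma conv_Comp_r [simp]:
  assumes "monoid_in C M" "f \<in> Arr C" "g \<in> Arr C" "Cod C f = Car M" "Cod C g = Car M"
    "h \<in> Arr C" "k \<in> Arr C" "Dom C f = Cod C h" "Dom C g = Cod C k" "r \<in> Arr C" "Cod C r = Dom C h \<odot> Dom C k"
  shows "(f \<star>\<^bsub>M\<^esub> g) \<cdot> (h \<otimes> k) \<cdot> r = ((f \<cdot> h) \<star>\<^bsub>M\<^esub> (g \<cdot> k)) \<cdot> r"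
  using assms by (simp add: conv_def)

lemma hom_conv:
  assumes "monoid_hom C M N h" "monoid_in C M" "monoid_in C N"
    "f \<in> Arr C" "g \<in> Arr C" "Cod C f = Car M" "Cod C g = Car M"
  shows "h \<cdot> (f \<star>\<^bsub>M\<^esub> g) = (h \<cdot> f) \<star>\<^bsub>N\<^esub> (h \<cdot> g)"
proof -
  have "(h \<cdot> Mul M) \<cdot> (f \<otimes> g) = (Mul N \<cdot> (h \<otimes> h)) \<cdot> (f \<otimes> g)"
    using monoid_homD(4)[OF assms(1)] by simp
  then show ?thesis using assms(2-) monoid_homD(1-3)[OF assms(1)] by (simp add: conv_def)
qed

lemma conv_assoc:
  assumes "monoid_in C M" "f \<in> Arr C" "g \<in> Arr C" "h \<in> Arr C" "Cod C f = Car M" "Cod C g = Car M" "Cod C h = Car M"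
  shows "(f \<star>\<^bsub>M\<^esub> g) \<star>\<^bsub>M\<^esub> h = (f \<star>\<^bsub>M\<^esub> (g \<star>\<^bsub>M\<^esub> h)) \<cdot> \<alpha> (Dom C f) (Dom C g) (Dom C h)"
proof -
  have "(f \<star>\<^bsub>M\<^esub> g) \<star>\<^bsub>M\<^esub> h = (Mul M \<cdot> (Mul M \<otimes> \<one> (Car M))) \<cdot> ((f \<otimes> g) \<otimes> h)"
    using assms by (simp add: conv_def)
  also have "\<dots> = (f \<star>\<^bsub>M\<^esub> (g \<star>\<^bsub>M\<^esub> h)) \<cdot> \<alpha> (Dom C f) (Dom C g) (Dom C h)"
    unfolding monoid_axioms(1)[OF assms(1)] using assms by (simp add: assoc_nat conv_def)
  finally show ?thesis .
qed

lemma conv_assoc':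
  assumes "monoid_in C M" "f \<in> Arr C" "g \<in> Arr C" "h \<in> Arr C" "Cod C f = Car M" "Cod C g = Car M" "Cod C h = Car M"
  shows "f \<star>\<^bsub>M\<^esub> (g \<star>\<^bsub>M\<^esub> h) = ((f \<star>\<^bsub>M\<^esub> g) \<star>\<^bsub>M\<^esub> h) \<cdot> Inv C (\<alpha> (Dom C f) (Dom C g) (Dom C h))"
  using assms by (simp add: conv_assoc)

lemma Mul_conv: "monoid_in C M \<Longrightarrow> Mul M = \<one> (Car M) \<star>\<^bsub>M\<^esub> \<one> (Car M)"
  by (simp add: conv_def)

lemma conv_unit_left:
  assumes "monoid_in C M" "g \<in> Arr C" "Cod C g = Car M"
  shows "Unt M \<star>\<^bsub>M\<^esub> g = g \<cdot> \<ell> (Dom C g)"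
proof -
  have "Unt M \<star>\<^bsub>M\<^esub> g = (Mul M \<cdot> (Unt M \<otimes> \<one> (Car M))) \<cdot> (\<one> \<I> \<otimes> g)"
    using assms by (simp add: conv_def)
  then show ?thesis unfolding monoid_axioms(2)[OF assms(1)] using assms by (simp add: lunit_nat)
qed

lemma conv_unit_right:
  assumes "monoid_in C M" "g \<in> Arr C" "Cod C g = Car M"
  shows "g \<star>\<^bsub>M\<^esub> Unt M = g \<cdot> \<rho> (Dom C g)"
proof -
  have "g \<star>\<^bsub>M\<^esub> Unt M = (Mul M \<cdot> (\<one> (Car M) \<otimes> Unt M)) \<cdot> (g \<otimes> \<one> \<I>)"
    using assms by (simp add: conv_def)
  then show ?thesis unfolding monoid_axioms(3)[OF assms(1)] using assms by (simp add: runit_nat)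
qed

text \<open>Multiplying by the trivial morphism u \<circ> e just discards that factor through e.
  This is how e \<otimes> 1 arises from a source map with s \<circ> j = u \<circ> e.\<close>

lemma conv_counit_left:
  assumes "monoid_in C M" "g \<in> Arr C" "Cod C g = Car M" "e \<in> Arr C" "Cod C e = \<I>"
  shows "(Unt M \<cdot> e) \<star>\<^bsub>M\<^esub> g = g \<cdot> \<ell> (Dom C g) \<cdot> (e \<otimes> \<one> (Dom C g))"
proof -
  have "(Unt M \<cdot> e) \<star>\<^bsub>M\<^esub> g = (Unt M \<star>\<^bsub>M\<^esub> g) \<cdot> (e \<otimes> \<one> (Dom C g))" using assms by simp
  then show ?thesis using assms by (simp add: conv_unit_left)
qed

lemma conv_counit_right:
  assumes "monoid_in C M" "g \<in> Arr C" "Cod C g = Car M" "e \<in> Arr C" "Cod C e = \<I>"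
  shows "g \<star>\<^bsub>M\<^esub> (Unt M \<cdot> e) = g \<cdot> \<rho> (Dom C g) \<cdot> (\<one> (Dom C g) \<otimes> e)"
proof -
  have "g \<star>\<^bsub>M\<^esub> (Unt M \<cdot> e) = (g \<star>\<^bsub>M\<^esub> Unt M) \<cdot> (\<one> (Dom C g) \<otimes> e)" using assms by simp
  then show ?thesis using assms by (simp add: conv_unit_right)
qed

lemma monoid_hom_conv:
  assumes "monoid_in C M"
  shows "monoid_hom C M N f \<longleftrightarrow> f \<in> Arr C \<and> Dom C f = Car M \<and> Cod C f = Car N \<and>
    f \<cdot> Mul M = f \<star>\<^bsub>N\<^esub> f \<and> f \<cdot> Unt M = Unt N"
  by (auto simp: monoid_hom_def conv_def)

lemma monoid_hom_Ident: "monoid_in C M \<Longrightarrow> monoid_hom C M M (\<one> (Car M))"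
  by (simp add: monoid_hom_def)

lemma monoid_hom_Comp:
  assumes "monoid_in C L" "monoid_in C M" "monoid_in C N" "monoid_hom C L M f" "monoid_hom C M N g"
  shows "monoid_hom C L N (g \<cdot> f)"
proof -
  note [simp] = assms(1-3) monoid_homD(1-3,5)[OF assms(4)] monoid_homD(1-3,5)[OF assms(5)]
  have "g \<cdot> (f \<star>\<^bsub>M\<^esub> f) = (g \<cdot> f) \<star>\<^bsub>N\<^esub> (g \<cdot> f)" using assms by (simp add: hom_conv)
  then show ?thesis using assms by (simp add: monoid_hom_conv)
qed

lemma monoid_hom_Inv:
  assumes "monoid_in C M" "monoid_in C N" "monoid_hom C M N f" "invertible C f"
  shows "monoid_hom C N M (Inv C f)"
proof -
  note [simp] = assms(1,2,4) monoid_homD(1-3)[OF assms(3)]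
  have "f \<cdot> (Inv C f \<cdot> Mul N) = f \<cdot> (Inv C f \<star>\<^bsub>M\<^esub> Inv C f)"
    using assms(3) by (simp add: hom_conv Mul_conv)
  then have "Inv C f \<cdot> Mul N = Inv C f \<star>\<^bsub>M\<^esub> Inv C f"
    by (rule cancel_mono) simp_all
  moreover have "Inv C f \<cdot> f \<cdot> Unt M = Inv C f \<cdot> Unt N"
    using monoid_homD(5)[OF assms(3)] by simp
  ultimately show ?thesis by (simp add: monoid_hom_conv)
qed

lemma monoid_in_trivial: "monoid_in C (trivial_monoid C)"
  using triangle[of \<I> \<I>] by (simp add: monoid_in_def trivial_monoid_def lunit_runit_unit)

lemma trivial_monoid_simps [simp]:
  "Car (trivial_monoid C) = \<I>" "Mul (trivial_monoid C) = \<ell> \<I>" "Unt (trivial_monoid C) = \<one> \<I>"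
  by (simp_all add: trivial_monoid_def)

lemma monoid_hom_Unt: "monoid_in C M \<Longrightarrow> monoid_hom C (trivial_monoid C) M (Unt M)"
  by (simp add: monoid_hom_conv monoid_in_trivial conv_unit_left)

end

section \<open>Distributive laws\<close>

locale distributive = monoidal_category C for C :: "('o, 'a) moncat" (structure) +
  fixes MB MY x
  assumes monoid_MB [simp]: "monoid_in C MB" and monoid_MY [simp]: "monoid_in C MY"
    and dlaw: "distributive_law C MB MY x"
begin

abbreviation "B \<equiv> Car MB"
abbreviation "Y \<equiv> Car MY"
abbreviation "YB \<equiv> distributive_monoid C MB MY x"

lemma x_simps [simp]: "x \<in> Arr C" "Dom C x = B \<odot> Y" "Cod C x = Y \<odot> B"
  using dlaw unfolding distributive_law_def Let_def hom_iff by blast+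

lemma x_axioms:
  "x \<cdot> (Unt MB \<otimes> \<one> Y) = (\<one> Y \<otimes> Unt MB) \<cdot> Inv C (\<rho> Y) \<cdot> \<ell> Y"
  "x \<cdot> (\<one> B \<otimes> Unt MY) = (Unt MY \<otimes> \<one> B) \<cdot> Inv C (\<ell> B) \<cdot> \<rho> B"
  "x \<cdot> (Mul MB \<otimes> \<one> Y) =
     (\<one> Y \<otimes> Mul MB) \<cdot> \<alpha> Y B B \<cdot> (x \<otimes> \<one> B) \<cdot> Inv C (\<alpha> B Y B) \<cdot> (\<one> B \<otimes> x) \<cdot> \<alpha> B B Y"
  "x \<cdot> (\<one> B \<otimes> Mul MY) =
     (Mul MY \<otimes> \<one> B) \<cdot> Inv C (\<alpha> Y Y B) \<cdot> (\<one> Y \<otimes> x) \<cdot> \<alpha> Y B Y \<cdot> (x \<otimes> \<one> Y) \<cdot> Inv C (\<alpha> B Y Y)"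
  using dlaw unfolding distributive_law_def Let_def by blast+

text \<open>
  The multiplications and the distributive law acting on the first two factors of a product bracketed to
  the right; their identities contain no associativity isomorphisms.
\<close>

definition "mY Z = (Mul MY \<otimes> \<one> Z) \<cdot> Inv C (\<alpha> Y Y Z)"
definition "mB Z = (Mul MB \<otimes> \<one> Z) \<cdot> Inv C (\<alpha> B B Z)"
definition "xx Z = \<alpha> Y B Z \<cdot> (x \<otimes> \<one> Z) \<cdot> Inv C (\<alpha> B Y Z)"

lemma shifted_simps [simp]:
  assumes "Z \<in> Obj C"
  shows "mY Z \<in> Arr C" "Dom C (mY Z) = Y \<odot> Y \<odot> Z" "Cod C (mY Z) = Y \<odot> Z"
    "mB Z \<in> Arr C" "Dom C (mB Z) = B \<odot> B \<odot> Z" "Cod C (mB Z) = B \<odot> Z"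
    "xx Z \<in> Arr C" "Dom C (xx Z) = B \<odot> Y \<odot> Z" "Cod C (xx Z) = Y \<odot> B \<odot> Z"
  using assms by (simp_all add: mY_def mB_def xx_def)

lemma shifted_nat:
  assumes "f \<in> Arr C" "Cod C f = Z"
  shows "mY Z \<cdot> (\<one> Y \<otimes> \<one> Y \<otimes> f) = (\<one> Y \<otimes> f) \<cdot> mY (Dom C f)"
    "mB Z \<cdot> (\<one> B \<otimes> \<one> B \<otimes> f) = (\<one> B \<otimes> f) \<cdot> mB (Dom C f)"
    "xx Z \<cdot> (\<one> B \<otimes> \<one> Y \<otimes> f) = (\<one> Y \<otimes> \<one> B \<otimes> f) \<cdot> xx (Dom C f)"
  using assms assoc_nat_r[of "\<one> Y" "\<one> B" f Y B Z "(x \<otimes> \<one> (Dom C f)) \<cdot> Inv C (\<alpha> B Y (Dom C f))"]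
  by (auto simp: mY_def mB_def xx_def assoc_inv_nat)

text \<open>Each pentagon rule in this collection removes an associator, or its inverse, that is
  tensored on the right with an identity.\<close>

lemmas expand = whisker_left whisker_right assoc_nat assoc_nat_r assoc_inv_nat_left assoc_inv_nat_left_r
  pentagon pentagon_inv pentagon_inv_r pentagon_inv1 pentagon_inv1_r pentagon_inv2 pentagon_inv2_r

section \<open>Associativity of the product on Y \<otimes> B\<close>

lemma mY_assoc:
  assumes Z [simp]: "Z \<in> Obj C"
  shows "mY Z \<cdot> (\<one> Y \<otimes> mY Z) = mY Z \<cdot> mY (Y \<odot> Z)"
proof -
  have "mY Z \<cdot> mY (Y \<odot> Z) = ((Mul MY \<cdot> (Mul MY \<otimes> \<one> Y)) \<otimes> \<one> Z) \<cdot> Inv C (\<alpha> (Y \<odot> Y) Y Z) \<cdot> Inv C (\<alpha> Y Y (Y \<odot> Z))"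
    using assoc_inv_nat_r[of "Mul MY" "\<one> Y" "\<one> Z" Y Y Z] by (simp add: mY_def)
  also have "\<dots> = mY Z \<cdot> (\<one> Y \<otimes> mY Z)"
    unfolding monoid_axioms[OF monoid_MY] by (simp del: interchange interchange_r add: expand mY_def)
  finally show ?thesis by simp
qed

lemma xx_mB:
  assumes Z [simp]: "Z \<in> Obj C"
  shows "xx Z \<cdot> mB (Y \<odot> Z) = (\<one> Y \<otimes> mB Z) \<cdot> xx (B \<odot> Z) \<cdot> (\<one> B \<otimes> xx Z)"
proof -
  have "xx Z \<cdot> mB (Y \<odot> Z) = \<alpha> Y B Z \<cdot> ((x \<cdot> (Mul MB \<otimes> \<one> Y)) \<otimes> \<one> Z) \<cdot> Inv C (\<alpha> (B \<odot> B) Y Z) \<cdot> Inv C (\<alpha> B B (Y \<odot> Z))"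
    using assoc_inv_nat_r[of "Mul MB" "\<one> Y" "\<one> Z" B Y Z] by (simp add: xx_def mB_def)
  also have "\<dots> = (\<one> Y \<otimes> mB Z) \<cdot> xx (B \<odot> Z) \<cdot> (\<one> B \<otimes> xx Z)"
    unfolding x_axioms by (simp del: interchange interchange_r add: expand mB_def xx_def)
  finally show ?thesis .
qed

lemma xx_mY:
  assumes Z [simp]: "Z \<in> Obj C"
  shows "xx Z \<cdot> (\<one> B \<otimes> mY Z) = mY (B \<odot> Z) \<cdot> (\<one> Y \<otimes> xx Z) \<cdot> xx (Y \<odot> Z)"
proof -
  have "xx Z \<cdot> (\<one> B \<otimes> mY Z) = \<alpha> Y B Z \<cdot> ((x \<cdot> (\<one> B \<otimes> Mul MY)) \<otimes> \<one> Z) \<cdot> Inv C (\<alpha> B (Y \<odot> Y) Z) \<cdot> (\<one> B \<otimes> Inv C (\<alpha> Y Y Z))"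
    using assoc_inv_nat_r[of "\<one> B" "Mul MY" "\<one> Z" B Y Z] by (simp add: xx_def mY_def whisker_left del: interchange)
  also have "\<dots> = mY (B \<odot> Z) \<cdot> (\<one> Y \<otimes> xx Z) \<cdot> xx (Y \<odot> Z)"
    unfolding x_axioms by (simp del: interchange interchange_r add: expand mY_def xx_def) simp
  finally show ?thesis .
qed

text \<open>In the associativity law the left factor is itself a bracketed product; these equations
  take a shifted operation out of such a bracket.\<close>

lemma shifted_Tensor:
  assumes [simp]: "Z \<in> Obj C" "W \<in> Obj C"
  shows "\<alpha> Y Z W \<cdot> (mY Z \<otimes> \<one> W) = mY (Z \<odot> W) \<cdot> (\<one> Y \<otimes> \<alpha> Y Z W) \<cdot> \<alpha> Y (Y \<odot> Z) W"
    "(\<one> Y \<otimes> \<alpha> B Z W) \<cdot> \<alpha> Y (B \<odot> Z) W \<cdot> (xx Z \<otimes> \<one> W) = xx (Z \<odot> W) \<cdot> (\<one> B \<otimes> \<alpha> Y Z W) \<cdot> \<alpha> B (Y \<odot> Z) W"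
proof -
  show "\<alpha> Y Z W \<cdot> (mY Z \<otimes> \<one> W) = mY (Z \<odot> W) \<cdot> (\<one> Y \<otimes> \<alpha> Y Z W) \<cdot> \<alpha> Y (Y \<odot> Z) W"
    by (simp del: interchange interchange_r add: expand mY_def)
  have "(\<one> Y \<otimes> \<alpha> B Z W) \<cdot> \<alpha> Y (B \<odot> Z) W \<cdot> (xx Z \<otimes> \<one> W)
    = ((\<one> Y \<otimes> \<alpha> B Z W) \<cdot> \<alpha> Y (B \<odot> Z) W \<cdot> (\<alpha> Y B Z \<otimes> \<one> W)) \<cdot> (((x \<otimes> \<one> Z) \<cdot> Inv C (\<alpha> B Y Z)) \<otimes> \<one> W)"
    by (simp add: xx_def)
  also have "\<dots> = xx (Z \<odot> W) \<cdot> (\<one> B \<otimes> \<alpha> Y Z W) \<cdot> \<alpha> B (Y \<odot> Z) W"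
    unfolding pentagon[OF monoid_simps(1)[OF monoid_MY] monoid_simps(1)[OF monoid_MB] assms]
    by (simp del: interchange interchange_r add: expand xx_def)
  finally show "(\<one> Y \<otimes> \<alpha> B Z W) \<cdot> \<alpha> Y (B \<odot> Z) W \<cdot> (xx Z \<otimes> \<one> W)
    = xx (Z \<odot> W) \<cdot> (\<one> B \<otimes> \<alpha> Y Z W) \<cdot> \<alpha> B (Y \<odot> Z) W" .
qed

text \<open>The left action of B on Y \<otimes> B: pass b across y with x, then multiply in B.
  Together with \<open>mY B\<close>, the left action of Y, it makes up the multiplication of
  \<open>YB\<close> (\<open>Mul_YB\<close>), which reduces associativity to properties of two
  one-sided actions.\<close>

definition "actB = (\<one> Y \<otimes> Mul MB) \<cdot> xx B"

lemma actB_simps [simp]: "actB \<in> Arr C" "Dom C actB = B \<odot> Y \<odot> B" "Cod C actB = Y \<odot> B"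
  by (simp_all add: actB_def)

lemma YB_simps [simp]: "Car YB = Y \<odot> B" "Unt YB = (Unt MY \<otimes> Unt MB) \<cdot> Inv C (\<ell> \<I>)"
  by (simp_all add: distributive_monoid_def Let_def)

lemma Mul_YB: "Mul YB = mY B \<cdot> (\<one> Y \<otimes> actB) \<cdot> \<alpha> Y B (Y \<odot> B)"
proof -
  have m: "Mul MY \<otimes> Mul MB = (Mul MY \<otimes> \<one> B) \<cdot> (\<one> (Y \<odot> Y) \<otimes> Mul MB)" by simp
  have "mY B \<cdot> (\<one> Y \<otimes> actB) \<cdot> \<alpha> Y B (Y \<odot> B) = (mY B \<cdot> (\<one> Y \<otimes> \<one> Y \<otimes> Mul MB)) \<cdot> (\<one> Y \<otimes> xx B) \<cdot> \<alpha> Y B (Y \<odot> B)"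
    by (simp add: actB_def)
  also have "\<dots> = Mul YB"
    using assoc_inv_nat_r[of "\<one> Y" "\<one> Y" "Mul MB" Y Y B]
    by (simp add: distributive_monoid_def Let_def mY_def xx_def whisker_left m del: interchange interchange_r)
  finally show ?thesis ..
qed

lemma Mul_YB_simps [simp]: "Mul YB \<in> Arr C" "Dom C (Mul YB) = (Y \<odot> B) \<odot> (Y \<odot> B)" "Cod C (Mul YB) = Y \<odot> B"
  by (simp_all add: Mul_YB)

lemma actB_actB: "actB \<cdot> (\<one> B \<otimes> actB) = actB \<cdot> mB (Y \<odot> B)"
proof -
  have m: "Mul MB \<cdot> (\<one> B \<otimes> Mul MB) = Mul MB \<cdot> mB B"
    by (simp add: mB_def reassoc2[OF monoid_axioms(1)[OF monoid_MB]])
  have "actB \<cdot> (\<one> B \<otimes> actB) = (\<one> Y \<otimes> Mul MB) \<cdot> (xx B \<cdot> (\<one> B \<otimes> \<one> Y \<otimes> Mul MB)) \<cdot> (\<one> B \<otimes> xx B)"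
    by (simp add: actB_def)
  also have "\<dots> = (\<one> Y \<otimes> (Mul MB \<cdot> (\<one> B \<otimes> Mul MB))) \<cdot> xx (B \<odot> B) \<cdot> (\<one> B \<otimes> xx B)"
    by (simp add: shifted_nat)
  also have "\<dots> = (\<one> Y \<otimes> Mul MB) \<cdot> (\<one> Y \<otimes> mB B) \<cdot> xx (B \<odot> B) \<cdot> (\<one> B \<otimes> xx B)"
    by (simp add: m)
  also have "\<dots> = actB \<cdot> mB (Y \<odot> B)"
    by (simp add: actB_def xx_mB del: interchange interchange_r)
  finally show ?thesis .
qed

text \<open>If x sends (b, y) to (y', b'), this says b (y w) = y' (b' w) for w in Y \<otimes>
  B.\<close>

lemma actB_mY: "actB \<cdot> (\<one> B \<otimes> mY B) = mY B \<cdot> (\<one> Y \<otimes> actB) \<cdot> xx (Y \<odot> B)"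
proof -
  have "actB \<cdot> (\<one> B \<otimes> mY B) = ((\<one> Y \<otimes> Mul MB) \<cdot> mY (B \<odot> B)) \<cdot> (\<one> Y \<otimes> xx B) \<cdot> xx (Y \<odot> B)"
    by (simp add: actB_def xx_mY)
  also have "(\<one> Y \<otimes> Mul MB) \<cdot> mY (B \<odot> B) = mY B \<cdot> (\<one> Y \<otimes> \<one> Y \<otimes> Mul MB)"
    by (simp add: shifted_nat)
  finally show ?thesis by (simp add: actB_def)
qed

text \<open>The left actions of Y and, by \<open>Mul_YB_actB\<close>, of B commute with right
  multiplication in \<open>YB\<close>.\<close>

lemma Mul_YB_mY: "Mul YB \<cdot> (mY B \<otimes> \<one> (Y \<odot> B)) = mY B \<cdot> (\<one> Y \<otimes> Mul YB) \<cdot> \<alpha> Y (Y \<odot> B) (Y \<odot> B)"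
proof -
  have "Mul YB \<cdot> (mY B \<otimes> \<one> (Y \<odot> B))
    = mY B \<cdot> ((\<one> Y \<otimes> actB) \<cdot> mY (B \<odot> Y \<odot> B)) \<cdot> (\<one> Y \<otimes> \<alpha> Y B (Y \<odot> B)) \<cdot> \<alpha> Y (Y \<odot> B) (Y \<odot> B)"
    by (simp add: Mul_YB shifted_Tensor)
  also have "(\<one> Y \<otimes> actB) \<cdot> mY (B \<odot> Y \<odot> B) = mY (Y \<odot> B) \<cdot> (\<one> Y \<otimes> \<one> Y \<otimes> actB)"
    by (simp add: shifted_nat)
  also have "mY B \<cdot> (mY (Y \<odot> B) \<cdot> (\<one> Y \<otimes> \<one> Y \<otimes> actB)) \<cdot> (\<one> Y \<otimes> \<alpha> Y B (Y \<odot> B)) \<cdot> \<alpha> Y (Y \<odot> B) (Y \<odot> B)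
    = (mY B \<cdot> mY (Y \<odot> B)) \<cdot> (\<one> Y \<otimes> \<one> Y \<otimes> actB) \<cdot> (\<one> Y \<otimes> \<alpha> Y B (Y \<odot> B)) \<cdot> \<alpha> Y (Y \<odot> B) (Y \<odot> B)"
    by simp
  also have "\<dots> = mY B \<cdot> (\<one> Y \<otimes> Mul YB) \<cdot> \<alpha> Y (Y \<odot> B) (Y \<odot> B)"
    unfolding mY_assoc[OF monoid_simps(1)[OF monoid_MB], symmetric] by (simp add: Mul_YB)
  finally show ?thesis .
qed

lemma Mul_YB_actB: "Mul YB \<cdot> (actB \<otimes> \<one> (Y \<odot> B)) = actB \<cdot> (\<one> B \<otimes> Mul YB) \<cdot> \<alpha> B (Y \<odot> B) (Y \<odot> B)"
proof -
  let ?A = "Y \<odot> B"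
  have n: "Mul MB \<otimes> \<one> ?A = mB ?A \<cdot> \<alpha> B B ?A" by (simp add: mB_def)
  have "Mul YB \<cdot> (actB \<otimes> \<one> ?A)
    = mY B \<cdot> (\<one> Y \<otimes> actB) \<cdot> (\<alpha> Y B ?A \<cdot> ((\<one> Y \<otimes> Mul MB) \<otimes> \<one> ?A)) \<cdot> (xx B \<otimes> \<one> ?A)"
    by (simp add: Mul_YB actB_def)
  also have "\<alpha> Y B ?A \<cdot> ((\<one> Y \<otimes> Mul MB) \<otimes> \<one> ?A) = (\<one> Y \<otimes> mB ?A) \<cdot> (\<one> Y \<otimes> \<alpha> B B ?A) \<cdot> \<alpha> Y (B \<odot> B) ?A"
    by (simp add: assoc_nat n)
  also have "mY B \<cdot> (\<one> Y \<otimes> actB) \<cdot> ((\<one> Y \<otimes> mB ?A) \<cdot> (\<one> Y \<otimes> \<alpha> B B ?A) \<cdot> \<alpha> Y (B \<odot> B) ?A) \<cdot> (xx B \<otimes> \<one> ?A)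
    = mY B \<cdot> (\<one> Y \<otimes> (actB \<cdot> mB ?A)) \<cdot> ((\<one> Y \<otimes> \<alpha> B B ?A) \<cdot> \<alpha> Y (B \<odot> B) ?A \<cdot> (xx B \<otimes> \<one> ?A))"
    by simp
  also have "\<dots> = mY B \<cdot> (\<one> Y \<otimes> actB) \<cdot> ((\<one> Y \<otimes> \<one> B \<otimes> actB) \<cdot> xx (B \<odot> ?A)) \<cdot> (\<one> B \<otimes> \<alpha> Y B ?A) \<cdot> \<alpha> B (Y \<odot> B) ?A"
    unfolding shifted_Tensor(2)[OF monoid_simps(1)[OF monoid_MB] Tensor_Obj[OF monoid_simps(1)[OF monoid_MY] monoid_simps(1)[OF monoid_MB]]]
      actB_actB[symmetric] by simp
  also have "(\<one> Y \<otimes> \<one> B \<otimes> actB) \<cdot> xx (B \<odot> ?A) = xx ?A \<cdot> (\<one> B \<otimes> \<one> Y \<otimes> actB)"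
    by (simp add: shifted_nat)
  also have "mY B \<cdot> (\<one> Y \<otimes> actB) \<cdot> (xx ?A \<cdot> (\<one> B \<otimes> \<one> Y \<otimes> actB)) \<cdot> (\<one> B \<otimes> \<alpha> Y B ?A) \<cdot> \<alpha> B (Y \<odot> B) ?A
    = (mY B \<cdot> (\<one> Y \<otimes> actB) \<cdot> xx ?A) \<cdot> (\<one> B \<otimes> \<one> Y \<otimes> actB) \<cdot> (\<one> B \<otimes> \<alpha> Y B ?A) \<cdot> \<alpha> B (Y \<odot> B) ?A"
    by simp
  also have "\<dots> = actB \<cdot> (\<one> B \<otimes> Mul YB) \<cdot> \<alpha> B (Y \<odot> B) (Y \<odot> B)"
    unfolding actB_mY[symmetric] by (simp add: Mul_YB)
  finally show ?thesis .
qed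

text \<open>The left factor of a product acts by \<open>actB\<close> and then by \<open>mY\<close>,
  and both of these commute with right multiplication.\<close>

lemma Mul_YB_assoc: "Mul YB \<cdot> (Mul YB \<otimes> \<one> (Y \<odot> B)) = Mul YB \<cdot> (\<one> (Y \<odot> B) \<otimes> Mul YB) \<cdot> \<alpha> (Y \<odot> B) (Y \<odot> B) (Y \<odot> B)"
proof -
  let ?A = "Y \<odot> B"
  have "Mul YB \<cdot> (Mul YB \<otimes> \<one> ?A) = (Mul YB \<cdot> (mY B \<otimes> \<one> ?A)) \<cdot> (((\<one> Y \<otimes> actB) \<cdot> \<alpha> Y B ?A) \<otimes> \<one> ?A)"
    by (simp add: Mul_YB)
  also have "\<dots> = mY B \<cdot> (\<one> Y \<otimes> Mul YB) \<cdot> (\<alpha> Y ?A ?A \<cdot> ((\<one> Y \<otimes> actB) \<otimes> \<one> ?A)) \<cdot> (\<alpha> Y B ?A \<otimes> \<one> ?A)"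
    unfolding Mul_YB_mY by simp
  also have "\<dots> = mY B \<cdot> (\<one> Y \<otimes> (Mul YB \<cdot> (actB \<otimes> \<one> ?A))) \<cdot> \<alpha> Y (B \<odot> ?A) ?A \<cdot> (\<alpha> Y B ?A \<otimes> \<one> ?A)"
    by (simp add: assoc_nat)
  also have "\<dots> = mY B \<cdot> (\<one> Y \<otimes> actB) \<cdot> (\<one> Y \<otimes> \<one> B \<otimes> Mul YB) \<cdot> ((\<one> Y \<otimes> \<alpha> B ?A ?A) \<cdot> \<alpha> Y (B \<odot> ?A) ?A \<cdot> (\<alpha> Y B ?A \<otimes> \<one> ?A))"
    unfolding Mul_YB_actB by simp
  also have "\<dots> = mY B \<cdot> (\<one> Y \<otimes> actB) \<cdot> (\<alpha> Y B ?A \<cdot> (\<one> (Y \<odot> B) \<otimes> Mul YB)) \<cdot> \<alpha> ?A ?A ?A"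
    using assoc_nat[of "\<one> Y" "\<one> B" "Mul YB" Y B ?A] by (simp add: pentagon)
  also have "\<dots> = Mul YB \<cdot> (\<one> ?A \<otimes> Mul YB) \<cdot> \<alpha> ?A ?A ?A"
    by (simp add: Mul_YB)
  finally show ?thesis .
qed

section \<open>The two inclusions into Y \<otimes> B and its universal property\<close>

definition "inB = (Unt MY \<otimes> \<one> B) \<cdot> Inv C (\<ell> B)"
definition "inY = (\<one> Y \<otimes> Unt MB) \<cdot> Inv C (\<rho> Y)"

lemma in_simps [simp]:
  "inB \<in> Arr C" "Dom C inB = B" "Cod C inB = Y \<odot> B"
  "inY \<in> Arr C" "Dom C inY = Y" "Cod C inY = Y \<odot> B"
  by (simp_all add: inB_def inY_def)

lemma mY_Unt: "Z \<in> Obj C \<Longrightarrow> mY Z \<cdot> (Unt MY \<otimes> \<one> (Y \<odot> Z)) = \<ell> (Y \<odot> Z)"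
  using assoc_inv_nat[of "Unt MY" "\<one> Y" "\<one> Z" Y Y Z]
  by (simp add: mY_def monoid_axioms lunit_tensor_inv)

lemma actB_Unt: "actB \<cdot> (Unt MB \<otimes> \<one> (Y \<odot> B)) = \<ell> (Y \<odot> B)"
proof -
  have "actB \<cdot> (Unt MB \<otimes> \<one> (Y \<odot> B))
    = (\<one> Y \<otimes> Mul MB) \<cdot> \<alpha> Y B B \<cdot> ((x \<cdot> (Unt MB \<otimes> \<one> Y)) \<otimes> \<one> B) \<cdot> Inv C (\<alpha> \<I> Y B)"
    using assoc_inv_nat[of "Unt MB" "\<one> Y" "\<one> B" B Y B] by (simp add: actB_def xx_def)
  also have "\<dots> = (\<one> Y \<otimes> Mul MB) \<cdot> (\<alpha> Y B B \<cdot> ((\<one> Y \<otimes> Unt MB) \<otimes> \<one> B)) \<cdot> (Inv C (\<rho> Y) \<otimes> \<one> B)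
    \<cdot> (\<ell> Y \<otimes> \<one> B) \<cdot> Inv C (\<alpha> \<I> Y B)"
    unfolding x_axioms by simp
  also have "\<dots> = (\<one> Y \<otimes> (Mul MB \<cdot> (Unt MB \<otimes> \<one> B))) \<cdot> (\<alpha> Y \<I> B \<cdot> (Inv C (\<rho> Y) \<otimes> \<one> B))
    \<cdot> ((\<ell> Y \<otimes> \<one> B) \<cdot> Inv C (\<alpha> \<I> Y B))"
    by (simp add: assoc_nat)
  also have "\<dots> = \<ell> (Y \<odot> B)"
    unfolding monoid_axioms[OF monoid_MB] by (simp add: triangle_inv lunit_tensor_inv del: assoc)
  finally show ?thesis .
qed

lemma Mul_YB_inY: "Mul YB \<cdot> (inY \<otimes> \<one> (Y \<odot> B)) = mY B"
proof -
  have "Mul YB \<cdot> (inY \<otimes> \<one> (Y \<odot> B))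
    = mY B \<cdot> (\<one> Y \<otimes> actB) \<cdot> (\<alpha> Y B (Y \<odot> B) \<cdot> ((\<one> Y \<otimes> Unt MB) \<otimes> \<one> (Y \<odot> B))) \<cdot> (Inv C (\<rho> Y) \<otimes> \<one> (Y \<odot> B))"
    by (simp add: Mul_YB inY_def)
  also have "\<dots> = mY B \<cdot> (\<one> Y \<otimes> (actB \<cdot> (Unt MB \<otimes> \<one> (Y \<odot> B)))) \<cdot> (\<alpha> Y \<I> (Y \<odot> B) \<cdot> (Inv C (\<rho> Y) \<otimes> \<one> (Y \<odot> B)))"
    by (simp add: assoc_nat)
  also have "\<dots> = mY B"
    unfolding actB_Unt by (simp add: triangle_inv)
  finally show ?thesis .
qed

lemma Mul_YB_inB: "Mul YB \<cdot> (inB \<otimes> \<one> (Y \<odot> B)) = actB"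
proof -
  have "Mul YB \<cdot> (inB \<otimes> \<one> (Y \<odot> B))
    = mY B \<cdot> (\<one> Y \<otimes> actB) \<cdot> (\<alpha> Y B (Y \<odot> B) \<cdot> ((Unt MY \<otimes> \<one> B) \<otimes> \<one> (Y \<odot> B))) \<cdot> (Inv C (\<ell> B) \<otimes> \<one> (Y \<odot> B))"
    by (simp add: Mul_YB inB_def)
  also have "\<dots> = (mY B \<cdot> (Unt MY \<otimes> \<one> (Y \<odot> B))) \<cdot> (\<one> \<I> \<otimes> actB) \<cdot> (\<alpha> \<I> B (Y \<odot> B) \<cdot> (Inv C (\<ell> B) \<otimes> \<one> (Y \<odot> B)))"
    by (simp add: assoc_nat)
  also have "\<dots> = actB"
    using lunit_inv_nat[of actB] by (simp add: mY_Unt lunit_tensor_inv)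
  finally show ?thesis .
qed

lemma Unt_YB: "(Unt MY \<otimes> Unt MB) \<cdot> Inv C (\<ell> \<I>) = inB \<cdot> Unt MB" "(Unt MY \<otimes> Unt MB) \<cdot> Inv C (\<ell> \<I>) = inY \<cdot> Unt MY"
proof -
  show "(Unt MY \<otimes> Unt MB) \<cdot> Inv C (\<ell> \<I>) = inB \<cdot> Unt MB"
    using lunit_inv_nat[of "Unt MB" B, symmetric] by (simp add: inB_def)
  show "(Unt MY \<otimes> Unt MB) \<cdot> Inv C (\<ell> \<I>) = inY \<cdot> Unt MY"
    using runit_inv_nat[of "Unt MY" Y, symmetric] by (simp add: inY_def lunit_runit_unit)
qed

text \<open>Thus \<open>YB\<close> is a factorized monoid whose morphism q is the identity; by
  \<open>inB_inY\<close> the product in the other order gives back x.\<close>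

lemma inY_inB: "Mul YB \<cdot> (inY \<otimes> inB) = \<one> (Y \<odot> B)"
proof -
  have "Mul YB \<cdot> (inY \<otimes> inB) = (Mul YB \<cdot> (inY \<otimes> \<one> (Y \<odot> B))) \<cdot> (\<one> Y \<otimes> inB)" by simp
  also have "\<dots> = (Mul MY \<otimes> \<one> B) \<cdot> (Inv C (\<alpha> Y Y B) \<cdot> (\<one> Y \<otimes> Unt MY \<otimes> \<one> B)) \<cdot> (\<one> Y \<otimes> Inv C (\<ell> B))"
    unfolding Mul_YB_inY by (simp add: mY_def inB_def)
  also have "\<dots> = ((Mul MY \<cdot> (\<one> Y \<otimes> Unt MY)) \<otimes> \<one> B) \<cdot> Inv C (\<alpha> Y \<I> B) \<cdot> (\<one> Y \<otimes> Inv C (\<ell> B))"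
    by (simp add: assoc_inv_nat)
  also have "\<dots> = ((\<rho> Y \<otimes> \<one> B) \<cdot> Inv C (\<alpha> Y \<I> B)) \<cdot> (\<one> Y \<otimes> Inv C (\<ell> B))"
    unfolding monoid_axioms[OF monoid_MY] by simp
  also have "\<dots> = \<one> (Y \<odot> B)"
    by (simp add: triangle_inv del: assoc)
  finally show ?thesis .
qed

lemma inB_inY: "Mul YB \<cdot> (inB \<otimes> inY) = x"
proof -
  have "Mul YB \<cdot> (inB \<otimes> inY) = (Mul YB \<cdot> (inB \<otimes> \<one> (Y \<odot> B))) \<cdot> (\<one> B \<otimes> inY)" by simp
  also have "\<dots> = (\<one> Y \<otimes> Mul MB) \<cdot> (xx B \<cdot> (\<one> B \<otimes> \<one> Y \<otimes> Unt MB)) \<cdot> (\<one> B \<otimes> Inv C (\<rho> Y))"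
    unfolding Mul_YB_inB by (simp add: actB_def inY_def)
  also have "\<dots> = (\<one> Y \<otimes> (Mul MB \<cdot> (\<one> B \<otimes> Unt MB))) \<cdot> xx \<I> \<cdot> (\<one> B \<otimes> Inv C (\<rho> Y))"
    by (simp add: shifted_nat)
  also have "\<dots> = ((\<one> Y \<otimes> \<rho> B) \<cdot> \<alpha> Y B \<I>) \<cdot> (x \<otimes> \<one> \<I>) \<cdot> (Inv C (\<alpha> B Y \<I>) \<cdot> (\<one> B \<otimes> Inv C (\<rho> Y)))"
    unfolding monoid_axioms[OF monoid_MB] by (simp add: xx_def)
  also have "\<dots> = \<rho> (Y \<odot> B) \<cdot> (x \<otimes> \<one> \<I>) \<cdot> Inv C (\<rho> (B \<odot> Y))"
    by (simp add: runit_tensor runit_tensor_inv del: assoc)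
  also have "\<dots> = x"
    using runit_inv_nat[of x "Y \<odot> B"] by simp
  finally show ?thesis .
qed

lemma inY_Mul: "Mul YB \<cdot> (inY \<otimes> inY) = inY \<cdot> Mul MY"
proof -
  have "Mul YB \<cdot> (inY \<otimes> inY) = (Mul YB \<cdot> (inY \<otimes> \<one> (Y \<odot> B))) \<cdot> (\<one> Y \<otimes> inY)" by simp
  also have "\<dots> = (Mul MY \<otimes> \<one> B) \<cdot> (Inv C (\<alpha> Y Y B) \<cdot> (\<one> Y \<otimes> \<one> Y \<otimes> Unt MB)) \<cdot> (\<one> Y \<otimes> Inv C (\<rho> Y))"
    unfolding Mul_YB_inY by (simp add: mY_def inY_def)
  also have "\<dots> = (\<one> Y \<otimes> Unt MB) \<cdot> (Mul MY \<otimes> \<one> \<I>) \<cdot> (Inv C (\<alpha> Y Y \<I>) \<cdot> (\<one> Y \<otimes> Inv C (\<rho> Y)))"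
    by (simp add: assoc_inv_nat)
  also have "\<dots> = inY \<cdot> Mul MY"
    using runit_inv_nat[of "Mul MY" Y] by (simp add: inY_def runit_tensor_inv del: interchange_r)
  finally show ?thesis .
qed

lemma inB_Mul: "Mul YB \<cdot> (inB \<otimes> inB) = inB \<cdot> Mul MB"
proof -
  have "Mul YB \<cdot> (inB \<otimes> inB) = (Mul YB \<cdot> (inB \<otimes> \<one> (Y \<odot> B))) \<cdot> (\<one> B \<otimes> inB)" by simp
  also have "\<dots> = (\<one> Y \<otimes> Mul MB) \<cdot> \<alpha> Y B B \<cdot> (x \<otimes> \<one> B) \<cdot> (Inv C (\<alpha> B Y B) \<cdot> (\<one> B \<otimes> Unt MY \<otimes> \<one> B)) \<cdot> (\<one> B \<otimes> Inv C (\<ell> B))"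
    unfolding Mul_YB_inB by (simp add: actB_def inB_def xx_def)
  also have "\<dots> = (\<one> Y \<otimes> Mul MB) \<cdot> \<alpha> Y B B \<cdot> ((x \<cdot> (\<one> B \<otimes> Unt MY)) \<otimes> \<one> B) \<cdot> Inv C (\<alpha> B \<I> B) \<cdot> (\<one> B \<otimes> Inv C (\<ell> B))"
    by (simp add: assoc_inv_nat)
  also have "\<dots> = (\<one> Y \<otimes> Mul MB) \<cdot> (\<alpha> Y B B \<cdot> ((Unt MY \<otimes> \<one> B) \<otimes> \<one> B)) \<cdot> (Inv C (\<ell> B) \<otimes> \<one> B) \<cdot> ((\<rho> B \<otimes> \<one> B) \<cdot> Inv C (\<alpha> B \<I> B)) \<cdot> (\<one> B \<otimes> Inv C (\<ell> B))"
    unfolding x_axioms by simp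
  also have "\<dots> = (Unt MY \<otimes> Mul MB) \<cdot> (\<alpha> \<I> B B \<cdot> (Inv C (\<ell> B) \<otimes> \<one> B))"
    by (simp add: assoc_nat triangle_inv)
  also have "\<dots> = inB \<cdot> Mul MB"
    using lunit_inv_nat[of "Mul MB" B, symmetric] by (simp add: inB_def lunit_tensor_inv)
  finally show ?thesis .
qed

lemma monoid_in_YB: "monoid_in C YB"
proof -
  let ?A = "Y \<odot> B"
  have "Mul YB \<cdot> ((inB \<cdot> Unt MB) \<otimes> \<one> ?A) = (Mul YB \<cdot> (inB \<otimes> \<one> ?A)) \<cdot> (Unt MB \<otimes> \<one> ?A)"
    by simp
  then have left: "Mul YB \<cdot> ((inB \<cdot> Unt MB) \<otimes> \<one> ?A) = \<ell> ?A"
    unfolding Mul_YB_inB by (simp add: actB_Unt)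
  \<comment> \<open>The identity is written as the product of \<open>inY\<close> and
    \<open>inB\<close>; associativity then brings the unit next to the factor from B, where it is
    absorbed.\<close>
  have "Mul YB \<cdot> (\<one> ?A \<otimes> (inB \<cdot> Unt MB)) = Mul YB \<cdot> ((Mul YB \<cdot> (inY \<otimes> inB)) \<otimes> (inB \<cdot> Unt MB))"
    by (simp add: inY_inB)
  also have "\<dots> = (Mul YB \<cdot> (Mul YB \<otimes> \<one> ?A)) \<cdot> ((inY \<otimes> inB) \<otimes> (inB \<cdot> Unt MB))"
    by simp
  also have "\<dots> = Mul YB \<cdot> (inY \<otimes> ((Mul YB \<cdot> (inB \<otimes> inB)) \<cdot> (\<one> B \<otimes> Unt MB))) \<cdot> \<alpha> Y B \<I>"
    unfolding Mul_YB_assoc by (simp add: assoc_nat)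
  also have "\<dots> = Mul YB \<cdot> (inY \<otimes> (inB \<cdot> \<rho> B)) \<cdot> \<alpha> Y B \<I>"
    unfolding inB_Mul using monoid_axioms(3)[OF monoid_MB] by simp
  also have "\<dots> = (Mul YB \<cdot> (inY \<otimes> inB)) \<cdot> (\<one> Y \<otimes> \<rho> B) \<cdot> \<alpha> Y B \<I>"
    by simp
  also have "\<dots> = \<rho> ?A"
    unfolding inY_inB by (simp add: runit_tensor)
  finally have right: "Mul YB \<cdot> (\<one> ?A \<otimes> (inB \<cdot> Unt MB)) = \<rho> ?A" .
  show ?thesis
    unfolding monoid_in_def YB_simps Unt_YB(1)
    by (intro conjI Mul_YB_assoc left right) simp_all
qed

lemma monoid_hom_inB: "monoid_hom C MB YB inB"
  by (simp add: monoid_hom_def inB_Mul Unt_YB(1))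

lemma monoid_hom_inY: "monoid_hom C MY YB inY"
  by (simp add: monoid_hom_def inY_Mul Unt_YB(2))

lemma in_conv: "inY \<star>\<^bsub>YB\<^esub> inB = \<one> (Y \<odot> B)" "inB \<star>\<^bsub>YB\<^esub> inY = x" "inY \<star>\<^bsub>YB\<^esub> \<one> (Y \<odot> B) = (Mul MY \<otimes> \<one> B) \<cdot> Inv C (\<alpha> Y Y B)"
  by (simp_all add: conv_def inY_inB inB_inY Mul_YB_inY mY_def)

lemma conv_in:
  assumes "monoid_in C N" "monoid_hom C MY N j" "monoid_hom C MB N i"
  shows "(j \<star>\<^bsub>N\<^esub> i) \<cdot> inY = j" "(j \<star>\<^bsub>N\<^esub> i) \<cdot> inB = i"
proof -
  note [simp] = assms(1) monoid_homD(1,2,3,5)[OF assms(2)] monoid_homD(1,2,3,5)[OF assms(3)]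
  show "(j \<star>\<^bsub>N\<^esub> i) \<cdot> inY = j" "(j \<star>\<^bsub>N\<^esub> i) \<cdot> inB = i"
    by (simp_all add: inY_def inB_def conv_unit_left conv_unit_right)
qed

text \<open>The universal property of \<open>YB\<close>. Since left multiplication in
  \<open>YB\<close> is composed of the actions of Y and B, it is enough that j \<star> i respects
  each of them (\<open>hY\<close>, \<open>hB\<close>); the compatibility with x enters through
  B.\<close>

lemma monoid_hom_from_YB:
  assumes "monoid_in C N" "monoid_hom C MY N j" "monoid_hom C MB N i" "(j \<star>\<^bsub>N\<^esub> i) \<cdot> x = i \<star>\<^bsub>N\<^esub> j"
  shows "monoid_hom C YB N (j \<star>\<^bsub>N\<^esub> i)"
proof -
  note [simp] = assms(1) monoid_homD(1,2,3,5)[OF assms(2)] monoid_homD(1,2,3,5)[OF assms(3)]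
  let ?h = "j \<star>\<^bsub>N\<^esub> i"
  have hY: "j \<star>\<^bsub>N\<^esub> ?h = ?h \<cdot> mY B"
  proof -
    have "j \<star>\<^bsub>N\<^esub> ?h = ((j \<star>\<^bsub>N\<^esub> j) \<star>\<^bsub>N\<^esub> i) \<cdot> Inv C (\<alpha> Y Y B)" by (simp add: conv_assoc')
    also have "j \<star>\<^bsub>N\<^esub> j = j \<cdot> Mul MY" using monoid_homD(4)[OF assms(2)] by (simp add: conv_def)
    finally show ?thesis by (simp add: mY_def)
  qed
  have hB: "i \<star>\<^bsub>N\<^esub> ?h = ?h \<cdot> actB"
  proof -
    have "i \<star>\<^bsub>N\<^esub> ?h = ((i \<star>\<^bsub>N\<^esub> j) \<star>\<^bsub>N\<^esub> i) \<cdot> Inv C (\<alpha> B Y B)" by (simp add: conv_assoc')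
    also have "\<dots> = (?h \<star>\<^bsub>N\<^esub> i) \<cdot> (x \<otimes> \<one> B) \<cdot> Inv C (\<alpha> B Y B)" by (simp add: assms(4))
    also have "\<dots> = (j \<star>\<^bsub>N\<^esub> (i \<star>\<^bsub>N\<^esub> i)) \<cdot> xx B" by (simp add: conv_assoc xx_def)
    also have "i \<star>\<^bsub>N\<^esub> i = i \<cdot> Mul MB" using monoid_homD(4)[OF assms(3)] by (simp add: conv_def)
    finally show ?thesis by (simp add: actB_def)
  qed
  have "?h \<cdot> Mul YB = (j \<star>\<^bsub>N\<^esub> ?h) \<cdot> (\<one> Y \<otimes> actB) \<cdot> \<alpha> Y B (Y \<odot> B)"
    unfolding hY by (simp add: Mul_YB)
  also have "\<dots> = ?h \<star>\<^bsub>N\<^esub> ?h" by (simp add: conv_assoc hB)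
  finally show ?thesis
    using conv_in(2)[OF assms(1-3)] by (simp add: monoid_hom_conv[OF monoid_in_YB] Unt_YB(1) reassoc del: YB_simps)
       (simp add: Unt_YB(1) reassoc)
qed

end

section \<open>Distributive laws from factorizations of a monoid\<close>

context monoidal_category
begin

text \<open>Composed with the isomorphism q, every axiom becomes a unit law or repeated
  associativity in \<open>MA\<close>, because q \<circ> x = i \<star> j allows the two factors to be
  exchanged.\<close>

lemma distributive_law_factorization:
  assumes [simp]: "monoid_in C MA" "monoid_in C MB" "monoid_in C MY"
    and i: "monoid_hom C MB MA i" and j: "monoid_hom C MY MA j"
    and q [simp]: "invertible C (j \<star>\<^bsub>MA\<^esub> i)"
  shows "distributive_law C MB MY (Inv C (j \<star>\<^bsub>MA\<^esub> i) \<cdot> (i \<star>\<^bsub>MA\<^esub> j))"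
proof -
  let ?q = "j \<star>\<^bsub>MA\<^esub> i" and ?B = "Car MB" and ?Y = "Car MY"
  define x where "x = Inv C ?q \<cdot> (i \<star>\<^bsub>MA\<^esub> j)"
  note [simp] = monoid_homD(1,2,3,5)[OF i] monoid_homD(1,2,3,5)[OF j]
  have im: "i \<cdot> Mul MB = i \<star>\<^bsub>MA\<^esub> i" and jm: "j \<cdot> Mul MY = j \<star>\<^bsub>MA\<^esub> j"
    using monoid_homD(4)[OF i] monoid_homD(4)[OF j] by (simp_all add: conv_def)
  have [simp]: "x \<in> Arr C" "Dom C x = ?B \<odot> ?Y" "Cod C x = ?Y \<odot> ?B"
    by (simp_all add: x_def)
  have qx: "?q \<cdot> x = i \<star>\<^bsub>MA\<^esub> j" by (simp add: x_def)
  have qx_r: "?q \<cdot> x \<cdot> r = (i \<star>\<^bsub>MA\<^esub> j) \<cdot> r" if "r \<in> Arr C" "Cod C r = ?B \<odot> ?Y" for r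
    by (rule reassoc[OF qx]) (use that in simp_all)
  have unit1: "?q \<cdot> (x \<cdot> (Unt MB \<otimes> \<one> ?Y)) = ?q \<cdot> ((\<one> ?Y \<otimes> Unt MB) \<cdot> Inv C (\<rho> ?Y) \<cdot> \<ell> ?Y)"
    by (simp add: qx_r conv_unit_left conv_unit_right)
  have unit2: "?q \<cdot> (x \<cdot> (\<one> ?B \<otimes> Unt MY)) = ?q \<cdot> ((Unt MY \<otimes> \<one> ?B) \<cdot> Inv C (\<ell> ?B) \<cdot> \<rho> ?B)"
    by (simp add: qx_r conv_unit_left conv_unit_right)
  have left: "?q \<cdot> (x \<cdot> (Mul MB \<otimes> \<one> ?Y)) = ?q \<cdot> ((\<one> ?Y \<otimes> Mul MB) \<cdot> \<alpha> ?Y ?B ?B \<cdot> (x \<otimes> \<one> ?B) \<cdot> Inv C (\<alpha> ?B ?Y ?B) \<cdot> (\<one> ?B \<otimes> x) \<cdot> \<alpha> ?B ?B ?Y)"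
  proof -
    have "?q \<cdot> (x \<cdot> (Mul MB \<otimes> \<one> ?Y)) = (i \<star>\<^bsub>MA\<^esub> (i \<star>\<^bsub>MA\<^esub> j)) \<cdot> \<alpha> ?B ?B ?Y"
      by (simp add: qx_r im conv_assoc)
    also have "\<dots> = (i \<star>\<^bsub>MA\<^esub> ?q) \<cdot> (\<one> ?B \<otimes> x) \<cdot> \<alpha> ?B ?B ?Y"
      by (simp add: qx)
    also have "\<dots> = ((i \<star>\<^bsub>MA\<^esub> j) \<star>\<^bsub>MA\<^esub> i) \<cdot> Inv C (\<alpha> ?B ?Y ?B) \<cdot> (\<one> ?B \<otimes> x) \<cdot> \<alpha> ?B ?B ?Y"
      by (simp add: conv_assoc' del: conv_Comp conv_Comp_r)
    also have "\<dots> = (?q \<star>\<^bsub>MA\<^esub> i) \<cdot> (x \<otimes> \<one> ?B) \<cdot> Inv C (\<alpha> ?B ?Y ?B) \<cdot> (\<one> ?B \<otimes> x) \<cdot> \<alpha> ?B ?B ?Y"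
      by (simp add: qx)
    also have "\<dots> = (j \<star>\<^bsub>MA\<^esub> (i \<star>\<^bsub>MA\<^esub> i)) \<cdot> \<alpha> ?Y ?B ?B \<cdot> (x \<otimes> \<one> ?B) \<cdot> Inv C (\<alpha> ?B ?Y ?B) \<cdot> (\<one> ?B \<otimes> x) \<cdot> \<alpha> ?B ?B ?Y"
      by (simp add: conv_assoc del: conv_Comp conv_Comp_r)
    finally show ?thesis by (simp add: im)
  qed
  have right: "?q \<cdot> (x \<cdot> (\<one> ?B \<otimes> Mul MY)) = ?q \<cdot> ((Mul MY \<otimes> \<one> ?B) \<cdot> Inv C (\<alpha> ?Y ?Y ?B) \<cdot> (\<one> ?Y \<otimes> x) \<cdot> \<alpha> ?Y ?B ?Y \<cdot> (x \<otimes> \<one> ?Y) \<cdot> Inv C (\<alpha> ?B ?Y ?Y))"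
  proof -
    have "?q \<cdot> (x \<cdot> (\<one> ?B \<otimes> Mul MY)) = ((i \<star>\<^bsub>MA\<^esub> j) \<star>\<^bsub>MA\<^esub> j) \<cdot> Inv C (\<alpha> ?B ?Y ?Y)"
      by (simp add: qx_r jm conv_assoc')
    also have "\<dots> = (?q \<star>\<^bsub>MA\<^esub> j) \<cdot> (x \<otimes> \<one> ?Y) \<cdot> Inv C (\<alpha> ?B ?Y ?Y)"
      by (simp add: qx)
    also have "\<dots> = (j \<star>\<^bsub>MA\<^esub> (i \<star>\<^bsub>MA\<^esub> j)) \<cdot> \<alpha> ?Y ?B ?Y \<cdot> (x \<otimes> \<one> ?Y) \<cdot> Inv C (\<alpha> ?B ?Y ?Y)"
      by (simp add: conv_assoc del: conv_Comp conv_Comp_r)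
    also have "\<dots> = (j \<star>\<^bsub>MA\<^esub> ?q) \<cdot> (\<one> ?Y \<otimes> x) \<cdot> \<alpha> ?Y ?B ?Y \<cdot> (x \<otimes> \<one> ?Y) \<cdot> Inv C (\<alpha> ?B ?Y ?Y)"
      by (simp add: qx)
    also have "\<dots> = ((j \<star>\<^bsub>MA\<^esub> j) \<star>\<^bsub>MA\<^esub> i) \<cdot> Inv C (\<alpha> ?Y ?Y ?B) \<cdot> (\<one> ?Y \<otimes> x) \<cdot> \<alpha> ?Y ?B ?Y \<cdot> (x \<otimes> \<one> ?Y) \<cdot> Inv C (\<alpha> ?B ?Y ?Y)"
      by (simp add: conv_assoc' del: conv_Comp conv_Comp_r)
    finally show ?thesis by (simp add: jm)
  qed
  have "distributive_law C MB MY x"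
    unfolding distributive_law_def Let_def
    by (intro conjI cancel_mono[OF unit1 q] cancel_mono[OF unit2 q] cancel_mono[OF left q] cancel_mono[OF right q]) simp_all
  then show ?thesis by (simp add: x_def)
qed

end

section \<open>Relative pullbacks\<close>

locale relative_setting = monoidal_category C for C :: "('o, 'a) moncat" (structure) +
  fixes S :: "'a \<Rightarrow> 'a \<Rightarrow> bool"
  assumes admissible: "admissible C S"
    and monoidal_class: "monoidal_class C S"
    and pullbacks: "has_relative_pullbacks C S"
begin

lemma S_Arr: "S f g \<Longrightarrow> f \<in> Arr C" "S f g \<Longrightarrow> g \<in> Arr C" "S f g \<Longrightarrow> Dom C f = Dom C g"
  using admissible by (auto simp: admissible_def span_class_def)

lemma S_post:
  "S f g \<Longrightarrow> f' \<in> Arr C \<Longrightarrow> Dom C f' = Cod C f \<Longrightarrow> g' \<in> Arr C \<Longrightarrow> Dom C g' = Cod C g \<Longrightarrow> S (f' \<cdot> f) (g' \<cdot> g)"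
  using admissible unfolding admissible_def by blast

lemma S_post_left: "S f g \<Longrightarrow> f' \<in> Arr C \<Longrightarrow> Dom C f' = Cod C f \<Longrightarrow> S (f' \<cdot> f) g"
  using S_post[of f g f' "\<one> (Cod C g)"] S_Arr[of f g] by simp

lemma S_post_right: "S f g \<Longrightarrow> g' \<in> Arr C \<Longrightarrow> Dom C g' = Cod C g \<Longrightarrow> S f (g' \<cdot> g)"
  using S_post[of f g "\<one> (Cod C f)" g'] S_Arr[of f g] by simp

lemma S_pre: "S f g \<Longrightarrow> h \<in> Arr C \<Longrightarrow> Cod C h = Dom C f \<Longrightarrow> S (f \<cdot> h) (g \<cdot> h)"
  using admissible unfolding admissible_def by blast

lemma S_Tensor: "S f g \<Longrightarrow> S f' g' \<Longrightarrow> S (f \<otimes> f') (g \<otimes> g')"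
  and S_Unit: "S (\<one> \<I>) (\<one> \<I>)"
  using monoidal_class unfolding monoidal_class_def by blast+

definition cospan :: "'a \<Rightarrow> 'a \<Rightarrow> bool" where
  "cospan f g \<longleftrightarrow> f \<in> Arr C \<and> g \<in> Arr C \<and> Cod C f = Cod C g \<and> S (\<one> (Dom C f)) f \<and> S g (\<one> (Dom C g))"

abbreviation "p1 \<equiv> pr1 C S"
abbreviation "p2 \<equiv> pr2 C S"
abbreviation "PB \<equiv> rpb_obj C S"

lemma relative_pullback_pr:
  assumes "cospan f g"
  shows "relative_pullback C S f g (p1 f g) (p2 f g)"
proof -
  have "\<exists>pq. case pq of (p, q) \<Rightarrow> relative_pullback C S f g p q"
    using assms pullbacks unfolding cospan_def has_relative_pullbacks_def cospan_legs_in_def by auto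
  from someI_ex[OF this] show ?thesis
    unfolding pr1_def pr2_def rpb_def by (simp add: case_prod_unfold)
qed

lemma cospan_simps:
  assumes "cospan f g"
  shows "f \<in> Arr C" "g \<in> Arr C" "Cod C g = Cod C f"
  using assms by (simp_all add: cospan_def)

lemma pr_S: "cospan f g \<Longrightarrow> S (p1 f g) (p2 f g)"
  using relative_pullback_pr unfolding relative_pullback_def by blast

lemma pr_simps [simp]:
  assumes "cospan f g"
  shows "p1 f g \<in> Arr C" "Dom C (p1 f g) = PB f g" "Cod C (p1 f g) = Dom C f"
    "p2 f g \<in> Arr C" "Dom C (p2 f g) = PB f g" "Cod C (p2 f g) = Dom C g" "PB f g \<in> Obj C"
  using relative_pullback_pr[OF assms] S_Arr[OF pr_S[OF assms]]
  unfolding relative_pullback_def rpb_obj_def by simp_all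

lemma pr_commute: "cospan f g \<Longrightarrow> f \<cdot> p1 f g = g \<cdot> p2 f g"
  using relative_pullback_pr unfolding relative_pullback_def by blast

lemma pr_universal:
  assumes "cospan f g" "S a c" "Cod C a = Dom C f" "Cod C c = Dom C g" "f \<cdot> a = g \<cdot> c"
  shows "\<exists>!h. h \<in> hom C (Dom C a) (PB f g) \<and> p1 f g \<cdot> h = a \<and> p2 f g \<cdot> h = c"
  using relative_pullback_pr[OF assms(1)] assms unfolding relative_pullback_def rpb_obj_def by blast

lemma pairing:
  assumes "cospan f g" "S a c" "Cod C a = Dom C f" "Cod C c = Dom C g" "f \<cdot> a = g \<cdot> c"
  shows "pairing C S f g a c \<in> Arr C" "Dom C (pairing C S f g a c) = Dom C a"
    "Cod C (pairing C S f g a c) = PB f g"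
    "p1 f g \<cdot> pairing C S f g a c = a" "p2 f g \<cdot> pairing C S f g a c = c"
  using theI'[OF pr_universal[OF assms]] unfolding pairing_def[symmetric] by simp_all

text \<open>Uniqueness is only postulated for spans in \<open>S\<close>, but precomposing the
  pullback span with \<open>h\<close> stays in \<open>S\<close>.\<close>

lemma pr_joint_mono:
  assumes "cospan f g" "p1 f g \<cdot> h = p1 f g \<cdot> h'" "p2 f g \<cdot> h = p2 f g \<cdot> h'"
    "h \<in> Arr C" "h' \<in> Arr C" "Cod C h = PB f g" "Cod C h' = PB f g"
  shows "h = h'"
proof -
  have "f \<cdot> p1 f g \<cdot> h = g \<cdot> p2 f g \<cdot> h"
    by (rule reassoc2[OF pr_commute]) (use assms in \<open>simp_all add: cospan_simps\<close>)
  moreover have "Dom C h' = Dom C h" using assms by (metis Comp_simps(2) pr_simps(1,2))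
  ultimately show ?thesis
    using pr_universal[of f g "p1 f g \<cdot> h" "p2 f g \<cdot> h"] assms S_pre[OF pr_S[OF assms(1)], of h]
    by (auto simp: hom_iff)
qed

lemma pr_reflect_left:
  assumes "cospan f g" "S (p1 f g \<cdot> d) e" "S (p2 f g \<cdot> d) e" "d \<in> Arr C" "Cod C d = PB f g" "e \<in> Arr C" "Dom C d = Dom C e"
  shows "S d e"
  using relative_pullback_pr[OF assms(1)] assms unfolding relative_pullback_def rpb_obj_def by blast

lemma pr_reflect_right:
  assumes "cospan f g" "S e (p1 f g \<cdot> d)" "S e (p2 f g \<cdot> d)" "d \<in> Arr C" "Cod C d = PB f g" "e \<in> Arr C" "Dom C d = Dom C e"
  shows "S e d"
  using relative_pullback_pr[OF assms(1)] assms unfolding relative_pullback_def rpb_obj_def by blast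

text \<open>The arrow \<open>b\<close> between the bases witnesses that the square to be factored
  commutes; its span lies in \<open>S\<close> by postcomposition.\<close>

lemma box:
  assumes "cospan f g" "cospan f' g'" "a \<in> Arr C" "c \<in> Arr C" "Dom C a = Dom C f" "Dom C c = Dom C g"
    "Cod C a = Dom C f'" "Cod C c = Dom C g'" "f' \<cdot> a = b \<cdot> f" "g' \<cdot> c = b \<cdot> g" "b \<in> Arr C" "Dom C b = Cod C f"
  shows "box C S f g f' g' a c \<in> Arr C" "Dom C (box C S f g f' g' a c) = PB f g"
    "Cod C (box C S f g f' g' a c) = PB f' g'"
    "p1 f' g' \<cdot> box C S f g f' g' a c = a \<cdot> p1 f g" "p2 f' g' \<cdot> box C S f g f' g' a c = c \<cdot> p2 f g"
proof -
  note [simp] = assms(1-8,11-12) cospan_simps[OF assms(1)] cospan_simps[OF assms(2)]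
  have "f' \<cdot> a \<cdot> p1 f g = b \<cdot> f \<cdot> p1 f g" "g' \<cdot> c \<cdot> p2 f g = b \<cdot> g \<cdot> p2 f g"
    using assms(9,10) by (intro reassoc2; simp)+
  then have e: "f' \<cdot> a \<cdot> p1 f g = g' \<cdot> c \<cdot> p2 f g" by (simp add: pr_commute)
  have "S (a \<cdot> p1 f g) (c \<cdot> p2 f g)" by (rule S_post[OF pr_S]) simp_all
  then show "box C S f g f' g' a c \<in> Arr C" "Dom C (box C S f g f' g' a c) = PB f g"
    "Cod C (box C S f g f' g' a c) = PB f' g'"
    "p1 f' g' \<cdot> box C S f g f' g' a c = a \<cdot> p1 f g" "p2 f' g' \<cdot> box C S f g f' g' a c = c \<cdot> p2 f g"
    unfolding box_def using e by (simp_all add: pairing)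
qed

lemma box_invertible:
  assumes "cospan f g" "cospan f' g'" "invertible C a" "invertible C c" "Dom C a = Dom C f" "Dom C c = Dom C g"
    "Cod C a = Dom C f'" "Cod C c = Dom C g'" "f' \<cdot> a = f" "g' \<cdot> c = g"
  shows "invertible C (box C S f g f' g' a c)"
    "Inv C (box C S f g f' g' a c) = box C S f' g' f g (Inv C a) (Inv C c)"
proof -
  note [simp] = assms(1-8) cospan_simps[OF assms(1)] cospan_simps[OF assms(2)] invertible_Arr[OF assms(3)] invertible_Arr[OF assms(4)]
  have cod: "Cod C f' = Cod C f" using assms(9) by (metis Comp_simps(3) assms(1-3,7) cospan_simps(1) invertible_Arr)
  have "f \<cdot> Inv C a = (f' \<cdot> a) \<cdot> Inv C a" "g \<cdot> Inv C c = (g' \<cdot> c) \<cdot> Inv C c" using assms(9,10) by simp_all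
  then have e: "f \<cdot> Inv C a = f'" "g \<cdot> Inv C c = g'" by simp_all
  note b = box[of f g f' g' a c "\<one> (Cod C f)"] and b' = box[of f' g' f g "Inv C a" "Inv C c" "\<one> (Cod C f)"]
  let ?b = "box C S f g f' g' a c" and ?b' = "box C S f' g' f g (Inv C a) (Inv C c)"
  have [simp]: "?b \<in> Arr C" "Dom C ?b = PB f g" "Cod C ?b = PB f' g'"
    "?b' \<in> Arr C" "Dom C ?b' = PB f' g'" "Cod C ?b' = PB f g"
    using assms(9,10) by (simp_all add: b b' e cod)
  have pb: "p1 f' g' \<cdot> ?b = a \<cdot> p1 f g" "p2 f' g' \<cdot> ?b = c \<cdot> p2 f g"
    "p1 f g \<cdot> ?b' = Inv C a \<cdot> p1 f' g'" "p2 f g \<cdot> ?b' = Inv C c \<cdot> p2 f' g'"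
    using assms(9,10) by (simp_all add: b b' e cod)
  have "?b' \<cdot> ?b = \<one> (PB f g)"
    by (rule pr_joint_mono[of f g]) (simp_all add: reassoc2[OF pb(3)] reassoc2[OF pb(4)] pb)
  moreover have "?b \<cdot> ?b' = \<one> (PB f' g')"
    by (rule pr_joint_mono[of f' g']) (simp_all add: reassoc2[OF pb(1)] reassoc2[OF pb(2)] pb)
  ultimately show "invertible C ?b" "Inv C ?b = ?b'"
    by (auto intro!: invertibleI[of _ ?b'] Inv_eq)
qed

section \<open>Relative pullbacks of monoids\<close>

lemma rpb_mon:
  assumes "cospan f g" "monoid_in C MA" "monoid_in C MC" "monoid_in C MB"
    "monoid_hom C MA MB f" "monoid_hom C MC MB g"
  shows "Car (rpb_mon C S MA MC f g) = PB f g" "monoid_in C (rpb_mon C S MA MC f g)"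
    "monoid_hom C (rpb_mon C S MA MC f g) MA (p1 f g)" "monoid_hom C (rpb_mon C S MA MC f g) MC (p2 f g)"
proof -
  note f = monoid_homD[OF assms(5)] and g = monoid_homD[OF assms(6)]
  note [simp] = assms(1-4) f(1,2,3,5) g(1,2,3,5)
  let ?P = "PB f g" and ?p = "p1 f g" and ?q = "p2 f g"
  let ?R = "\<lambda>M. Car M = ?P \<and> monoid_in C M \<and> monoid_hom C M MA ?p \<and> monoid_hom C M MC ?q"
  define m where "m = pairing C S f g (?p \<star>\<^bsub>MA\<^esub> ?p) (?q \<star>\<^bsub>MC\<^esub> ?q)"
  define u where "u = pairing C S f g (Unt MA) (Unt MC)"
  \<comment> \<open>The multiplication is taken componentwise. Its pairing exists because
    \<open>S\<close> is closed under \<otimes>, and joint monicity of the projections then yields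
    the axioms and uniqueness, which the description operator in \<open>rpb_mon\<close>
    requires.\<close>
  have Sm: "S (?p \<star>\<^bsub>MA\<^esub> ?p) (?q \<star>\<^bsub>MC\<^esub> ?q)"
    unfolding conv_def by (rule S_post[OF S_Tensor]) (simp_all add: pr_S)
  have em: "f \<cdot> (?p \<star>\<^bsub>MA\<^esub> ?p) = g \<cdot> (?q \<star>\<^bsub>MC\<^esub> ?q)"
    by (simp add: hom_conv[OF assms(5)] hom_conv[OF assms(6)] pr_commute)
  have Su: "S (Unt MA) (Unt MC)"
    using S_post[OF S_Unit, of "Unt MA" "Unt MC"] by simp
  have m [simp]: "m \<in> Arr C" "Dom C m = ?P \<odot> ?P" "Cod C m = ?P"
    and pm: "?p \<cdot> m = ?p \<star>\<^bsub>MA\<^esub> ?p" "?q \<cdot> m = ?q \<star>\<^bsub>MC\<^esub> ?q"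
    using pairing[OF assms(1) Sm _ _ em] unfolding m_def by simp_all
  have u [simp]: "u \<in> Arr C" "Dom C u = \<I>" "Cod C u = ?P"
    and pu: "?p \<cdot> u = Unt MA" "?q \<cdot> u = Unt MC"
    using pairing[OF assms(1) Su] unfolding u_def by simp_all
  have pm_r: "?p \<cdot> m \<cdot> r = (?p \<star>\<^bsub>MA\<^esub> ?p) \<cdot> r" "?q \<cdot> m \<cdot> r = (?q \<star>\<^bsub>MC\<^esub> ?q) \<cdot> r"
    if "r \<in> Arr C" "Cod C r = ?P \<odot> ?P" for r
    using that by (intro reassoc pm; simp)+
  define M where "M = \<lparr>Car = ?P, Mul = m, Unt = u\<rparr>"
  have "m \<cdot> (m \<otimes> \<one> ?P) = m \<cdot> (\<one> ?P \<otimes> m) \<cdot> \<alpha> ?P ?P ?P"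
    by (rule pr_joint_mono[of f g]) (simp_all add: pm_r pm conv_assoc)
  moreover have "m \<cdot> (u \<otimes> \<one> ?P) = \<ell> ?P" "m \<cdot> (\<one> ?P \<otimes> u) = \<rho> ?P"
    by (rule pr_joint_mono[of f g]; simp add: pm_r pu conv_unit_left conv_unit_right)+
  ultimately have RM: "?R M"
    unfolding M_def monoid_in_def monoid_hom_def using pm pu by (simp add: conv_def)
  have "M' = M" if "?R M'" for M'
  proof -
    have c: "Car M' = ?P" and h: "monoid_hom C M' MA ?p" "monoid_hom C M' MC ?q" and [simp]: "monoid_in C M'"
      using that by auto
    have "Mul M' = m"
      by (rule pr_joint_mono[of f g])
        (use monoid_homD(4)[OF h(1)] monoid_homD(4)[OF h(2)] c in \<open>simp_all add: pm conv_def\<close>)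
    moreover have "Unt M' = u"
      by (rule pr_joint_mono[of f g])
        (use monoid_homD(5)[OF h(1)] monoid_homD(5)[OF h(2)] c in \<open>simp_all add: pu\<close>)
    ultimately show ?thesis using c by (simp add: M_def)
  qed
  then have "?R (rpb_mon C S MA MC f g)"
    unfolding rpb_mon_def using RM by (rule_tac theI[where P = ?R]) auto
  then show "Car (rpb_mon C S MA MC f g) = PB f g" "monoid_in C (rpb_mon C S MA MC f g)"
    "monoid_hom C (rpb_mon C S MA MC f g) MA (p1 f g)" "monoid_hom C (rpb_mon C S MA MC f g) MC (p2 f g)"
    by auto
qed

text \<open>The projections are jointly monic monoid morphisms, so they detect
  multiplicativity.\<close>

lemma monoid_hom_rpb:
  assumes "cospan f g" "monoid_in C MA" "monoid_in C MC" "monoid_in C MB"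
    "monoid_hom C MA MB f" "monoid_hom C MC MB g" "monoid_in C N"
    "h \<in> Arr C" "Dom C h = Car N" "Cod C h = PB f g"
    "monoid_hom C N MA (p1 f g \<cdot> h)" "monoid_hom C N MC (p2 f g \<cdot> h)"
  shows "monoid_hom C N (rpb_mon C S MA MC f g) h"
proof -
  note r = rpb_mon[OF assms(1-6)]
  note [simp] = assms(1-4,7-10) r(1,2)
  note h = hom_conv[OF r(3)] hom_conv[OF r(4)]
  have "h \<cdot> Mul N = h \<star>\<^bsub>rpb_mon C S MA MC f g\<^esub> h"
    by (rule pr_joint_mono[of f g])
      (use monoid_homD(4)[OF assms(11)] monoid_homD(4)[OF assms(12)] in \<open>simp_all add: h\<close>, simp_all add: conv_def)
  moreover have "h \<cdot> Unt N = Unt (rpb_mon C S MA MC f g)"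
    by (rule pr_joint_mono[of f g])
      (use monoid_homD(5)[OF assms(11)] monoid_homD(5)[OF assms(12)] monoid_homD(5)[OF r(3)] monoid_homD(5)[OF r(4)] in simp_all)
  ultimately show ?thesis by (simp add: monoid_hom_conv)
qed

end

section \<open>Reflexive graphs of monoids\<close>

text \<open>A relative category in monoids without its composition, which is added only in
  \<open>composition\<close>.\<close>

locale reflexive_graph = relative_setting C S for C :: "('o, 'a) moncat" (structure) and S +
  fixes MB MA i s t
  assumes MB [simp]: "monoid_in C MB" and MA [simp]: "monoid_in C MA"
    and i: "monoid_hom C MB MA i" and s: "monoid_hom C MA MB s" and t: "monoid_hom C MA MB t"
    and si [simp]: "s \<cdot> i = \<one> (Car MB)" and ti [simp]: "t \<cdot> i = \<one> (Car MB)"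
    and S_B: "S (\<one> (Car MB)) (\<one> (Car MB))"
    and S_t: "S t (\<one> (Car MA))" and S_s: "S (\<one> (Car MA)) s"
begin

lemmas i_simps [simp] = monoid_homD(1,2,3,5)[OF i]
lemmas s_simps [simp] = monoid_homD(1,2,3,5)[OF s]
lemmas t_simps [simp] = monoid_homD(1,2,3,5)[OF t]

lemma section_r [simp]:
  assumes "r \<in> Arr C" "Cod C r = Car MB"
  shows "s \<cdot> i \<cdot> r = r" "t \<cdot> i \<cdot> r = r"
  using reassoc[OF si, of r] reassoc[OF ti, of r] assms by simp_all

text \<open>
  \<open>over N \<tau> \<upsilon>\<close> captures what the powers \<open>N = A\<^sup>\<box>\<^sup>n\<close> have in common: the left leg \<open>\<tau>\<close> and its section \<open>\<upsilon>\<close>,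
  the iterated \<open>i\<close>. Then \<open>nxt\<close> is \<open>A \<box> N\<close>, and \<open>rho\<close>, \<open>lam\<close> are the morphisms \<open>1 \<box> \<upsilon>\<close> from \<open>A\<close> and
  \<open>i \<box> 1\<close> from \<open>N\<close> to it.
\<close>

definition over :: "('o, 'a) mon \<Rightarrow> 'a \<Rightarrow> 'a \<Rightarrow> bool" where
  "over N \<tau> \<upsilon> \<longleftrightarrow> monoid_in C N \<and> monoid_hom C N MB \<tau> \<and> monoid_hom C MB N \<upsilon> \<and>
     \<tau> \<cdot> \<upsilon> = \<one> (Car MB) \<and> S \<tau> (\<one> (Car N))"

definition "nxt N \<tau> = rpb_mon C S MA N s \<tau>"
definition "nxt_leg \<tau> = t \<cdot> p1 s \<tau>"
definition "nxt_unit \<tau> \<upsilon> = pairing C S s \<tau> i \<upsilon>"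
definition "rho \<tau> \<upsilon> = pairing C S s \<tau> (\<one> (Car MA)) (\<upsilon> \<cdot> s)"
definition "lam N \<tau> = pairing C S s \<tau> (i \<cdot> \<tau>) (\<one> (Car N))"

lemma over_simps:
  assumes "over N \<tau> \<upsilon>"
  shows "monoid_in C N" "\<tau> \<in> Arr C" "Dom C \<tau> = Car N" "Cod C \<tau> = Car MB"
    "\<upsilon> \<in> Arr C" "Dom C \<upsilon> = Car MB" "Cod C \<upsilon> = Car N" "\<upsilon> \<cdot> Unt MB = Unt N" "\<tau> \<cdot> Unt N = Unt MB"
    "\<tau> \<cdot> \<upsilon> = \<one> (Car MB)" "cospan s \<tau>"
  using assms monoid_homD[of N MB \<tau>] monoid_homD[of MB N \<upsilon>] S_s by (auto simp: over_def cospan_def)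

lemma over_section_r:
  assumes "over N \<tau> \<upsilon>" "r \<in> Arr C" "Cod C r = Car MB"
  shows "\<tau> \<cdot> \<upsilon> \<cdot> r = r"
  using reassoc[of \<tau> \<upsilon> "\<one> (Car MB)" r] over_simps[OF assms(1)] assms by simp

lemma nxt_unit:
  assumes "over N \<tau> \<upsilon>"
  shows "nxt_unit \<tau> \<upsilon> \<in> Arr C" "Dom C (nxt_unit \<tau> \<upsilon>) = Car MB" "Cod C (nxt_unit \<tau> \<upsilon>) = PB s \<tau>"
    "p1 s \<tau> \<cdot> nxt_unit \<tau> \<upsilon> = i" "p2 s \<tau> \<cdot> nxt_unit \<tau> \<upsilon> = \<upsilon>"
proof -
  have "S i \<upsilon>" using S_post[OF S_B, of i \<upsilon>] over_simps[OF assms] by simp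
  then show "nxt_unit \<tau> \<upsilon> \<in> Arr C" "Dom C (nxt_unit \<tau> \<upsilon>) = Car MB" "Cod C (nxt_unit \<tau> \<upsilon>) = PB s \<tau>"
    "p1 s \<tau> \<cdot> nxt_unit \<tau> \<upsilon> = i" "p2 s \<tau> \<cdot> nxt_unit \<tau> \<upsilon> = \<upsilon>"
    unfolding nxt_unit_def using over_simps[OF assms] pairing[of s \<tau> i \<upsilon>] by simp_all
qed

lemma rho:
  assumes "over N \<tau> \<upsilon>"
  shows "rho \<tau> \<upsilon> \<in> Arr C" "Dom C (rho \<tau> \<upsilon>) = Car MA" "Cod C (rho \<tau> \<upsilon>) = PB s \<tau>"
    "p1 s \<tau> \<cdot> rho \<tau> \<upsilon> = \<one> (Car MA)" "p2 s \<tau> \<cdot> rho \<tau> \<upsilon> = \<upsilon> \<cdot> s"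
proof -
  have "S (\<one> (Car MA)) (\<upsilon> \<cdot> s)" using S_post_right[OF S_s, of \<upsilon>] over_simps[OF assms] by simp
  then show "rho \<tau> \<upsilon> \<in> Arr C" "Dom C (rho \<tau> \<upsilon>) = Car MA" "Cod C (rho \<tau> \<upsilon>) = PB s \<tau>"
    "p1 s \<tau> \<cdot> rho \<tau> \<upsilon> = \<one> (Car MA)" "p2 s \<tau> \<cdot> rho \<tau> \<upsilon> = \<upsilon> \<cdot> s"
    unfolding rho_def using over_simps[OF assms] over_section_r[OF assms] pairing[of s \<tau> "\<one> (Car MA)" "\<upsilon> \<cdot> s"] by simp_all
qed

lemma lam:
  assumes "over N \<tau> \<upsilon>"
  shows "lam N \<tau> \<in> Arr C" "Dom C (lam N \<tau>) = Car N" "Cod C (lam N \<tau>) = PB s \<tau>"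
    "p1 s \<tau> \<cdot> lam N \<tau> = i \<cdot> \<tau>" "p2 s \<tau> \<cdot> lam N \<tau> = \<one> (Car N)"
proof -
  have "S \<tau> (\<one> (Car N))" using assms by (simp add: over_def)
  then have "S (i \<cdot> \<tau>) (\<one> (Car N))" using over_simps[OF assms] by (intro S_post_left) simp_all
  then show "lam N \<tau> \<in> Arr C" "Dom C (lam N \<tau>) = Car N" "Cod C (lam N \<tau>) = PB s \<tau>"
    "p1 s \<tau> \<cdot> lam N \<tau> = i \<cdot> \<tau>" "p2 s \<tau> \<cdot> lam N \<tau> = \<one> (Car N)"
    unfolding lam_def using over_simps[OF assms] pairing[of s \<tau> "i \<cdot> \<tau>" "\<one> (Car N)"] by simp_all
qed

lemma nxt:
  assumes "over N \<tau> \<upsilon>"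
  shows "Car (nxt N \<tau>) = PB s \<tau>" "monoid_in C (nxt N \<tau>)"
    "monoid_hom C (nxt N \<tau>) MA (p1 s \<tau>)" "monoid_hom C (nxt N \<tau>) N (p2 s \<tau>)"
  unfolding nxt_def using rpb_mon[of s \<tau> MA N MB] over_simps[OF assms] assms s by (auto simp: over_def)

lemma hom_nxt:
  assumes "over N \<tau> \<upsilon>" "monoid_in C L" "h \<in> Arr C" "Dom C h = Car L" "Cod C h = PB s \<tau>"
    "monoid_hom C L MA (p1 s \<tau> \<cdot> h)" "monoid_hom C L N (p2 s \<tau> \<cdot> h)"
  shows "monoid_hom C L (nxt N \<tau>) h"
  unfolding nxt_def using assms over_simps[OF assms(1)] s by (intro monoid_hom_rpb[of s \<tau> MA N MB]) (auto simp: over_def)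

lemma over_hom:
  assumes "over N \<tau> \<upsilon>"
  shows "monoid_hom C N MB \<tau>" "monoid_hom C MB N \<upsilon>" "S \<tau> (\<one> (Car N))"
  using assms by (simp_all add: over_def)

lemma rho_hom:
  assumes "over N \<tau> \<upsilon>"
  shows "monoid_hom C MA (nxt N \<tau>) (rho \<tau> \<upsilon>)"
  by (rule hom_nxt[OF assms])
    (simp_all add: rho[OF assms] monoid_hom_Ident monoid_hom_Comp[OF MA MB over_simps(1)[OF assms] s over_hom(2)[OF assms]])

lemma lam_hom:
  assumes "over N \<tau> \<upsilon>"
  shows "monoid_hom C N (nxt N \<tau>) (lam N \<tau>)"
  by (rule hom_nxt[OF assms])
    (simp_all add: lam[OF assms] over_simps(1)[OF assms] monoid_hom_Ident monoid_hom_Comp[OF over_simps(1)[OF assms] MB MA over_hom(1)[OF assms] i])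

lemma nxt_unit_hom:
  assumes "over N \<tau> \<upsilon>"
  shows "monoid_hom C MB (nxt N \<tau>) (nxt_unit \<tau> \<upsilon>)"
  by (rule hom_nxt[OF assms]) (simp_all add: nxt_unit[OF assms] i over_hom[OF assms])

text \<open>This makes the construction iterable. The new left leg together with either projection
  is a span in \<open>S\<close>; reflection then gives the span with the identity.\<close>

lemma over_nxt:
  assumes "over N \<tau> \<upsilon>"
  shows "over (nxt N \<tau>) (nxt_leg \<tau>) (nxt_unit \<tau> \<upsilon>)"
proof -
  note [simp] = over_simps[OF assms] nxt[OF assms] nxt_unit[OF assms]
  have 1: "S (t \<cdot> p1 s \<tau>) (p1 s \<tau>)" using S_pre[OF S_t, of "p1 s \<tau>"] by simp
  have 2: "S (t \<cdot> p1 s \<tau>) (p2 s \<tau>)" using S_post_left[OF pr_S, of s \<tau> t] by simp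
  have "S (t \<cdot> p1 s \<tau>) (\<one> (PB s \<tau>))"
    by (rule pr_reflect_right[of s \<tau>]) (use 1 2 in simp_all)
  then show ?thesis
    using monoid_hom_Comp[OF nxt(2)[OF assms] MA MB nxt(3)[OF assms] t] nxt_unit_hom[OF assms]
    by (simp add: over_def nxt_leg_def)
qed

text \<open>One of two starting points of the iteration: from \<open>MB\<close> arise the powers
  ending in B, used to define q_n; from \<open>MA\<close> (\<open>over_MA\<close>) arise A \<box> A
  and A \<box> (A \<box> A), used for the composition.\<close>

lemma over_base: "over MB (\<one> (Car MB)) (\<one> (Car MB))"
  by (simp add: over_def monoid_hom_Ident S_B)

lemma over_MA: "over MA t i"
  using i t S_t by (simp add: over_def)

lemma cospan_id: "cospan s (\<one> (Car MB))" "over N \<tau> \<upsilon> \<Longrightarrow> cospan (\<one> (Car MB)) \<tau>"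
proof -
  show "cospan s (\<one> (Car MB))" using S_s S_B by (simp add: cospan_def)
  assume o: "over N \<tau> \<upsilon>"
  then have "S \<tau> (\<one> (Car N))" by (simp add: over_def)
  then show "cospan (\<one> (Car MB)) \<tau>" using S_B over_simps(2-4)[OF o] by (simp add: cospan_def)
qed

section \<open>Agreement with the composites through the unit isomorphisms\<close>

lemma rho_eq:
  assumes "over N \<tau> \<upsilon>"
  shows "box C S s (\<one> (Car MB)) s \<tau> (\<one> (Car MA)) \<upsilon> \<cdot> to_box_right C S (Car MB) s = rho \<tau> \<upsilon>"
proof -
  note [simp] = over_simps[OF assms] cospan_id(1)
  note p = pairing[of s "\<one> (Car MB)" "\<one> (Car MA)" s]
  have [simp]: "to_box_right C S (Car MB) s \<in> Arr C" "Dom C (to_box_right C S (Car MB) s) = Car MA"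
    "Cod C (to_box_right C S (Car MB) s) = PB s (\<one> (Car MB))"
    "p1 s (\<one> (Car MB)) \<cdot> to_box_right C S (Car MB) s = \<one> (Car MA)" "p2 s (\<one> (Car MB)) \<cdot> to_box_right C S (Car MB) s = s"
    unfolding to_box_right_def by (simp_all add: p S_s)
  note b = box[of s "\<one> (Car MB)" s \<tau> "\<one> (Car MA)" \<upsilon> "\<one> (Car MB)"]
  show ?thesis
    by (rule pr_joint_mono[of s \<tau>]) (simp_all add: b rho[OF assms] reassoc2[OF b(4)] reassoc2[OF b(5)])
qed

lemma lam_eq:
  assumes "over N \<tau> \<upsilon>"
  shows "box C S (\<one> (Car MB)) \<tau> s \<tau> i (\<one> (Car N)) \<cdot> to_box_left C S (Car MB) \<tau> = lam N \<tau>"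
proof -
  note [simp] = over_simps[OF assms] cospan_id(2)[OF assms]
  have [simp]: "S \<tau> (\<one> (Car N))" using assms by (simp add: over_def)
  note p = pairing[of "\<one> (Car MB)" \<tau> \<tau> "\<one> (Car N)"]
  have [simp]: "to_box_left C S (Car MB) \<tau> \<in> Arr C" "Dom C (to_box_left C S (Car MB) \<tau>) = Car N"
    "Cod C (to_box_left C S (Car MB) \<tau>) = PB (\<one> (Car MB)) \<tau>"
    "p1 (\<one> (Car MB)) \<tau> \<cdot> to_box_left C S (Car MB) \<tau> = \<tau>" "p2 (\<one> (Car MB)) \<tau> \<cdot> to_box_left C S (Car MB) \<tau> = \<one> (Car N)"
    unfolding to_box_left_def by (simp_all add: p)
  note b = box[of "\<one> (Car MB)" \<tau> s \<tau> i "\<one> (Car N)" "\<one> (Car MB)"]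
  show ?thesis
    by (rule pr_joint_mono[of s \<tau>]) (simp_all add: b lam[OF assms] reassoc2[OF b(4)] reassoc2[OF b(5)])
qed

lemma nxt_unit_eq:
  assumes "over N \<tau> \<upsilon>"
  shows "box C S (\<one> (Car MB)) (\<one> (Car MB)) s \<tau> i \<upsilon> \<cdot> to_box_right C S (Car MB) (\<one> (Car MB)) = nxt_unit \<tau> \<upsilon>"
proof -
  let ?u = "\<one> (Car MB)"
  note [simp] = over_simps[OF assms] cospan_id(2)[OF over_base]
  note p = pairing[of ?u ?u ?u ?u]
  have [simp]: "to_box_right C S (Car MB) ?u \<in> Arr C" "Dom C (to_box_right C S (Car MB) ?u) = Car MB"
    "Cod C (to_box_right C S (Car MB) ?u) = PB ?u ?u"
    "p1 ?u ?u \<cdot> to_box_right C S (Car MB) ?u = ?u" "p2 ?u ?u \<cdot> to_box_right C S (Car MB) ?u = ?u"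
    unfolding to_box_right_def by (simp_all add: p S_B)
  note b = box[of ?u ?u s \<tau> i \<upsilon> ?u]
  show ?thesis
    by (rule pr_joint_mono[of s \<tau>]) (simp_all add: b nxt_unit[OF assms] reassoc2[OF b(4)] reassoc2[OF b(5)])
qed

abbreviation "pw \<equiv> box_pow_mon C S MB MA s t"
abbreviation "tn n \<equiv> fst (box_pow C S (Car MB) s t n)"
abbreviation "un \<equiv> box_pow_unit C S (Car MB) i s t"

lemma tn_Suc: "tn (Suc n) = nxt_leg (tn n)"
  by (simp add: span_prod_def nxt_leg_def case_prod_unfold)

lemma over_pow: "over (pw n) (tn n) (un n)"
proof (induction n)
  case 0
  show ?case by (simp add: over_base)
next
  case (Suc n)
  have "un (Suc n) = nxt_unit (tn n) (un n)" using nxt_unit_eq[OF Suc] by simp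
  moreover have "pw (Suc n) = nxt (pw n) (tn n)" by (simp add: nxt_def)
  ultimately show ?case using over_nxt[OF Suc] tn_Suc by simp
qed

end

section \<open>Split reflexive graphs\<close>

text \<open>The common ground of both directions. For a relative category, j is the projection from
  the chosen pullback of s along the unit; for a crossed module, it is the inclusion of Y into Y
  \<otimes> B. The assumptions make j land in the kernel of s; that Y is the whole kernel is a
  separate condition, invertibility of \<open>to_kernel\<close>.\<close>

locale split_graph = reflexive_graph C S MB MA i s t
  for C :: "('o, 'a) moncat" (structure) and S MB MA i s t +
  fixes MY j e k x
  assumes MY [simp]: "monoid_in C MY" and j: "monoid_hom C MY MA j"
    and e: "monoid_hom C MY (trivial_monoid C) e"
    and sj: "s \<cdot> j = Unt MB \<cdot> e" and tj: "t \<cdot> j = k"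
    and q_invertible [simp]: "invertible C (j \<star>\<^bsub>MA\<^esub> i)"
    and x: "x \<in> hom C (Car MB \<odot> Car MY) (Car MY \<odot> Car MB)"
    and qx: "(j \<star>\<^bsub>MA\<^esub> i) \<cdot> x = i \<star>\<^bsub>MA\<^esub> j"
    and S_k: "S k (\<one> (Car MY))" and S_e: "S (\<one> (Car MY)) e"
begin

abbreviation "q \<equiv> j \<star>\<^bsub>MA\<^esub> i"
abbreviation "X \<equiv> \<lparr>xmod_B = MB, xmod_Y = MY, xmod_e = e, xmod_k = k, xmod_x = x\<rparr>"
abbreviation "cl \<equiv> counit_left C X"
abbreviation "act \<equiv> xmod_act C X"
abbreviation "YY \<equiv> Car MY"
abbreviation "BB \<equiv> Car MB"
abbreviation "AA \<equiv> Car MA"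

lemmas j_simps [simp] = monoid_homD(1,2,3,5)[OF j]

lemma e_simps [simp]: "e \<in> Arr C" "Dom C e = YY" "Cod C e = \<I>" "e \<cdot> Unt MY = \<one> \<I>"
  using monoid_homD[OF e] by simp_all

lemma k_hom: "monoid_hom C MY MB k"
  using monoid_hom_Comp[OF MY MA MB j t] tj by simp

lemmas k_simps [simp] = monoid_homD(1,2,3,5)[OF k_hom]

lemma x_simps [simp]: "x \<in> Arr C" "Dom C x = BB \<odot> YY" "Cod C x = YY \<odot> BB"
  using x by simp_all

lemma x_eq: "x = Inv C q \<cdot> (i \<star>\<^bsub>MA\<^esub> j)"
  by (simp flip: qx)

text \<open>As q is invertible, \<open>qx\<close> determines x as the law of the factorization of A
  by j and i.\<close>

sublocale D: distributive C MB MY x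
  by unfold_locales (use distributive_law_factorization[OF MA MB MY i j] x_eq in simp_all)

section \<open>Comparison of the morphisms q_n and b_n\<close>

lemma cl_def: "cl Z = \<ell> Z \<cdot> (e \<otimes> \<one> Z)"
  by (simp add: counit_left_def)

lemma cl_simps [simp]:
  assumes "Z \<in> Obj C"
  shows "cl Z \<in> Arr C" "Dom C (cl Z) = YY \<odot> Z" "Cod C (cl Z) = Z"
  using assms by (simp_all add: cl_def)

lemma cl_nat:
  assumes "f \<in> Arr C" "Cod C f = Z"
  shows "cl Z \<cdot> (\<one> YY \<otimes> f) = f \<cdot> cl (Dom C f)"
proof -
  have "cl Z \<cdot> (\<one> YY \<otimes> f) = (\<ell> Z \<cdot> (\<one> \<I> \<otimes> f)) \<cdot> (e \<otimes> \<one> (Dom C f))"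
    using assms by (auto simp: cl_def)
  then show ?thesis using assms by (auto simp: cl_def lunit_nat)
qed

lemma conv_cl:
  assumes "monoid_in C N" "f \<in> Arr C" "Cod C f = Car N"
  shows "(Unt N \<cdot> e) \<star>\<^bsub>N\<^esub> f = f \<cdot> cl (Dom C f)"
  using assms by (simp add: conv_counit_left cl_def)

text \<open>Along q, the legs s and t become e \<otimes> 1 and m \<circ> (k \<otimes> 1)
  (\<open>tq\<close>), the morphisms whose pullbacks appear in the definition of b_n.\<close>

lemma sq: "s \<cdot> q = cl BB"
  by (simp add: hom_conv[OF s] sj conv_cl)

lemma tq: "t \<cdot> q = k \<star>\<^bsub>MB\<^esub> \<one> BB"
  by (simp add: hom_conv[OF t] tj)

text \<open>For \<open>N\<close> the n-th power this is the morphism q_(n+1) with the chosen kernel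
  A \<box> I replaced by Y; see \<open>q_Suc_invertible\<close>.\<close>

definition "qn N \<tau> \<upsilon> = (rho \<tau> \<upsilon> \<cdot> j) \<star>\<^bsub>nxt N \<tau>\<^esub> lam N \<tau>"

text \<open>On the second projection the first factor becomes trivial, since s \<circ> j = u \<circ>
  e, and only e \<otimes> 1 remains. The formula for the left leg is the recursion satisfied by
  \<open>act\<close>.\<close>

lemma qn:
  assumes o: "over N \<tau> \<upsilon>"
  shows "qn N \<tau> \<upsilon> \<in> Arr C" "Dom C (qn N \<tau> \<upsilon>) = YY \<odot> Car N" "Cod C (qn N \<tau> \<upsilon>) = PB s \<tau>"
    "p1 s \<tau> \<cdot> qn N \<tau> \<upsilon> = j \<star>\<^bsub>MA\<^esub> (i \<cdot> \<tau>)" "p2 s \<tau> \<cdot> qn N \<tau> \<upsilon> = cl (Car N)"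
    "nxt_leg \<tau> \<cdot> qn N \<tau> \<upsilon> = k \<star>\<^bsub>MB\<^esub> \<tau>"
proof -
  note [simp] = over_simps[OF o] nxt(1,2)[OF o] rho[OF o] lam[OF o]
  have [simp]: "p1 s \<tau> \<cdot> rho \<tau> \<upsilon> \<cdot> j = j" "p2 s \<tau> \<cdot> rho \<tau> \<upsilon> \<cdot> j = \<upsilon> \<cdot> s \<cdot> j"
    using reassoc[OF rho(4)[OF o], of j] reassoc2[OF rho(5)[OF o], of j] by simp_all
  have u: "\<upsilon> \<cdot> Unt MB \<cdot> e = Unt N \<cdot> e" by (rule reassoc) simp_all
  show 1: "qn N \<tau> \<upsilon> \<in> Arr C" "Dom C (qn N \<tau> \<upsilon>) = YY \<odot> Car N" "Cod C (qn N \<tau> \<upsilon>) = PB s \<tau>"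
    by (simp_all add: qn_def)
  show 2: "p1 s \<tau> \<cdot> qn N \<tau> \<upsilon> = j \<star>\<^bsub>MA\<^esub> (i \<cdot> \<tau>)" "p2 s \<tau> \<cdot> qn N \<tau> \<upsilon> = cl (Car N)"
    by (simp_all add: qn_def hom_conv[OF nxt(3)[OF o]] hom_conv[OF nxt(4)[OF o]] sj u conv_cl)
  have "nxt_leg \<tau> \<cdot> qn N \<tau> \<upsilon> = t \<cdot> p1 s \<tau> \<cdot> qn N \<tau> \<upsilon>" using 1 by (simp add: nxt_leg_def)
  then show "nxt_leg \<tau> \<cdot> qn N \<tau> \<upsilon> = k \<star>\<^bsub>MB\<^esub> \<tau>"
    by (simp add: 2 hom_conv[OF t] tj)
qed

text \<open>
  Both sides of the equation \<open>bx \<circ> b = q \<circ> (1 \<otimes> y)\<close> below have the same projections; this is what links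
  the morphisms \<open>b\<^sub>n\<close> to the morphisms \<open>q\<^sub>n\<close>.
\<close>

lemma compare:
  assumes o: "over N \<tau> \<upsilon>" and y: "invertible C y" "Cod C y = Car N" "Dom C y = Z" and a: "\<tau> \<cdot> y = a"
  defines "b \<equiv> pairing C S (cl BB) a (\<one> YY \<otimes> a) (cl Z)"
    and "bx \<equiv> box C S (cl BB) a s \<tau> q y"
  shows "cospan (cl BB) a" "b \<in> Arr C" "Dom C b = YY \<odot> Z" "Cod C b = PB (cl BB) a"
    "p1 (cl BB) a \<cdot> b = \<one> YY \<otimes> a" "p2 (cl BB) a \<cdot> b = cl Z"
    "invertible C bx" "Dom C bx = PB (cl BB) a" "Cod C bx = PB s \<tau>"
    "p1 s \<tau> \<cdot> bx = q \<cdot> p1 (cl BB) a" "p2 s \<tau> \<cdot> bx = y \<cdot> p2 (cl BB) a"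
    "bx \<cdot> b = qn N \<tau> \<upsilon> \<cdot> (\<one> YY \<otimes> y)"
    "invertible C b \<longleftrightarrow> invertible C (qn N \<tau> \<upsilon>)"
proof -
  note [simp] = over_simps[OF o] y invertible_Arr[OF y(1)] qn(1-3)[OF o]
  have Z [simp]: "Z \<in> Obj C" using y Obj_simps(1)[OF invertible_Arr[OF y(1)]] by simp
  have [simp]: "a \<in> Arr C" "Dom C a = Z" "Cod C a = BB" using a by auto
  \<comment> \<open>Precomposition with \<open>y\<close> turns the identity leg into
    \<open>y\<close>; postcomposing that leg with the inverse makes it an identity again.\<close>
  have "S (\<tau> \<cdot> y) (\<one> (Car N) \<cdot> y)" using S_pre[OF over_hom(3)[OF o], of y] by simp
  then have "S (\<tau> \<cdot> y) (Inv C y \<cdot> y)" using S_post_right[of "\<tau> \<cdot> y" y "Inv C y"] by simp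
  then have Sa: "S a (\<one> Z)" using a by simp
  have "S (\<one> YY \<otimes> \<one> BB) (e \<otimes> \<one> BB)" by (rule S_Tensor[OF S_e S_B])
  then have "S (\<one> (YY \<odot> BB)) (cl BB)" using S_post_right[of "\<one> (YY \<odot> BB)" "e \<otimes> \<one> BB" "\<ell> BB"] by (simp add: cl_def)
  then show c: "cospan (cl BB) a" using Sa by (simp add: cospan_def)
  note [simp] = c
  have "S (\<one> YY \<otimes> a) (e \<otimes> \<one> Z)" by (rule S_Tensor[OF S_e Sa])
  then have Sb: "S (\<one> YY \<otimes> a) (cl Z)" using S_post_right[of "\<one> YY \<otimes> a" "e \<otimes> \<one> Z" "\<ell> Z"] by (simp add: cl_def)
  note p = pairing[OF c Sb]
  show b: "b \<in> Arr C" "Dom C b = YY \<odot> Z" "Cod C b = PB (cl BB) a"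
    "p1 (cl BB) a \<cdot> b = \<one> YY \<otimes> a" "p2 (cl BB) a \<cdot> b = cl Z"
    unfolding b_def using p by (simp_all add: cl_nat)
  show inv: "invertible C bx"
    unfolding bx_def by (rule box_invertible(1)) (simp_all add: a sq)
  note bb = box[OF c over_simps(11)[OF o], of q y "\<one> BB"]
  have bx: "bx \<in> Arr C" "Dom C bx = PB (cl BB) a" "Cod C bx = PB s \<tau>"
    "p1 s \<tau> \<cdot> bx = q \<cdot> p1 (cl BB) a" "p2 s \<tau> \<cdot> bx = y \<cdot> p2 (cl BB) a"
    unfolding bx_def using bb by (simp_all add: a sq)
  then show "Dom C bx = PB (cl BB) a" "Cod C bx = PB s \<tau>"
    "p1 s \<tau> \<cdot> bx = q \<cdot> p1 (cl BB) a" "p2 s \<tau> \<cdot> bx = y \<cdot> p2 (cl BB) a" by simp_all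
  note [simp] = b(1-3) bx(1-3)
  have 1: "p1 s \<tau> \<cdot> bx \<cdot> b = p1 s \<tau> \<cdot> qn N \<tau> \<upsilon> \<cdot> (\<one> YY \<otimes> y)"
    by (simp add: reassoc2[OF bx(4)] b(4) reassoc[OF qn(4)[OF o]] a)
  have 2: "p2 s \<tau> \<cdot> bx \<cdot> b = p2 s \<tau> \<cdot> qn N \<tau> \<upsilon> \<cdot> (\<one> YY \<otimes> y)"
    by (simp add: reassoc2[OF bx(5)] b(5) reassoc[OF qn(5)[OF o]] cl_nat)
  show e: "bx \<cdot> b = qn N \<tau> \<upsilon> \<cdot> (\<one> YY \<otimes> y)"
    by (rule pr_joint_mono[OF over_simps(11)[OF o]]) (simp_all add: 1 2)
  have y': "invertible C (\<one> YY \<otimes> y)" by (simp add: invertible_Tensor invertible_Ident)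
  show "invertible C b \<longleftrightarrow> invertible C (qn N \<tau> \<upsilon>)"
  proof
    assume "invertible C b"
    then have "invertible C (qn N \<tau> \<upsilon> \<cdot> (\<one> YY \<otimes> y))" using invertible_Comp[of b bx] inv e by simp
    then show "invertible C (qn N \<tau> \<upsilon>)" by (rule invertible_cancel_right[OF _ y']) simp_all
  next
    assume "invertible C (qn N \<tau> \<upsilon>)"
    then have "invertible C (bx \<cdot> b)" unfolding e using y' by (intro invertible_Comp) simp_all
    then show "invertible C b" by (rule invertible_cancel_left[OF _ inv]) simp_all
  qed
qed

lemma tpow_Obj [simp]: "tpow C BB BB n \<in> Obj C"
  by (induction n) simp_all

lemma iter_mul_simps [simp]:
  "iter_mul C MB n \<in> Arr C" "Dom C (iter_mul C MB n) = tpow C BB BB n" "Cod C (iter_mul C MB n) = BB"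
  by (induction n) simp_all

lemma tpow_arr_simps [simp]:
  "tpow_arr C k (\<one> BB) n \<in> Arr C" "Dom C (tpow_arr C k (\<one> BB) n) = tpow C YY BB n"
  "Cod C (tpow_arr C k (\<one> BB) n) = tpow C BB BB n"
  by (induction n) simp_all

lemma act_eq: "act n = iter_mul C MB n \<cdot> tpow_arr C k (\<one> BB) n"
  by (simp add: xmod_act_def)

lemma act_simps [simp]: "act n \<in> Arr C" "Dom C (act n) = tpow C YY BB n" "Cod C (act n) = BB"
  by (simp_all add: act_eq)

lemma act_0: "act 0 = \<one> BB"
  by (simp add: act_eq)

lemma act_Suc: "act (Suc n) = k \<star>\<^bsub>MB\<^esub> act n"
  by (simp add: act_eq conv_def)

lemma b_Suc_eq: "b_Suc C S X n = pairing C S (cl BB) (act n) (\<one> YY \<otimes> act n) (cl (tpow C YY BB n))"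
  by (simp add: b_Suc_def Let_def act_eq)

primrec yn where
  "yn 0 = \<one> BB"
| "yn (Suc n) = qn (pw n) (tn n) (un n) \<cdot> (\<one> YY \<otimes> yn n)"

lemma yn_simps [simp]:
  "yn n \<in> Arr C" "Dom C (yn n) = tpow C YY BB n" "Cod C (yn n) = Car (pw n)"
proof (induction n)
  case (Suc n)
  note [simp] = Suc qn(1-3)[OF over_pow] nxt(1)[OF over_pow, unfolded nxt_def]
  case 1 show ?case by simp
  case 2 show ?case by simp
  case 3 show ?case by simp
qed simp_all

text \<open>This is the condition under which \<open>compare\<close> applies with
  \<open>y = yn n\<close>, relating b_(n+1) to q_(n+1).\<close>

lemma tn_yn: "tn n \<cdot> yn n = act n"
proof (induction n)
  case 0 show ?case by (simp add: act_0)
next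
  case (Suc n)
  note [simp] = qn(1-3)[OF over_pow] over_simps[OF over_pow]
  have [simp]: "nxt_leg (tn n) \<in> Arr C" "Dom C (nxt_leg (tn n)) = PB s (tn n)"
    by (simp_all add: nxt_leg_def)
  have "nxt_leg (tn n) \<cdot> yn (Suc n) = (nxt_leg (tn n) \<cdot> qn (pw n) (tn n) (un n)) \<cdot> (\<one> YY \<otimes> yn n)"
    by simp
  also have "\<dots> = act (Suc n)" unfolding qn(6)[OF over_pow] by (simp add: Suc act_Suc)
  finally show ?case by (simp only: tn_Suc)
qed

text \<open>At stage n, \<open>compare\<close> needs \<open>yn n\<close> to be invertible, and the
  condition at stage n makes \<open>yn (Suc n)\<close> invertible. Either sequence of conditions
  therefore yields all \<open>yn n\<close> by induction, and then the other sequence.\<close>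

lemma qn_b_invertible:
  "(\<forall>n. invertible C (qn (pw n) (tn n) (un n))) \<longleftrightarrow> (\<forall>n. invertible C (b_Suc C S X n))"
proof -
  have *: "invertible C (yn n) \<Longrightarrow> invertible C (b_Suc C S X n) \<longleftrightarrow> invertible C (qn (pw n) (tn n) (un n))" for n
    unfolding b_Suc_eq by (rule compare(13)[OF over_pow _ _ _ tn_yn]) simp_all
  have step: "invertible C (yn n) \<Longrightarrow> invertible C (qn (pw n) (tn n) (un n)) \<Longrightarrow> invertible C (yn (Suc n))" for n
    using qn(2)[OF over_pow] by (simp add: invertible_Comp invertible_Tensor invertible_Ident)
  show ?thesis
  proof
    assume q: "\<forall>n. invertible C (qn (pw n) (tn n) (un n))"
    have "invertible C (yn n)" for n
      by (induction n) (use q step in \<open>simp_all add: invertible_Ident del: yn.simps(2)\<close>)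
    then show "\<forall>n. invertible C (b_Suc C S X n)" using q * by blast
  next
    assume b: "\<forall>n. invertible C (b_Suc C S X n)"
    have "invertible C (yn n)" for n
      by (induction n) (use b * step in \<open>simp_all add: invertible_Ident del: yn.simps(2)\<close>)
    then show "\<forall>n. invertible C (qn (pw n) (tn n) (un n))" using b * by blast
  qed
qed

end

section \<open>The composition\<close>

context reflexive_graph
begin

text \<open>In terms of composable pairs, \<open>rA\<close> sends a to (a, i s a) and
  \<open>lA\<close> sends a to (i t a, a); \<open>r3\<close> and \<open>l3\<close> are their
  analogues for A \<box> (A \<box> A).\<close>

abbreviation "A2 \<equiv> nxt MA t"
abbreviation "rA \<equiv> rho t i"
abbreviation "lA \<equiv> lam MA t"
abbreviation "A3 \<equiv> nxt A2 (nxt_leg t)"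
abbreviation "r3 \<equiv> rho (nxt_leg t) (nxt_unit t i)"
abbreviation "l3 \<equiv> lam A2 (nxt_leg t)"

lemmas over_A2 = over_nxt[OF over_MA]
lemmas A2_simps [simp] = nxt(1,2)[OF over_MA] over_simps(11)[OF over_MA]
lemmas A3_simps [simp] = nxt(1,2)[OF over_A2] over_simps(11)[OF over_A2]
lemmas rA_simps [simp] = rho(1-4)[OF over_MA]
lemmas lA_simps [simp] = lam(1-3,5)[OF over_MA]
lemmas r3_simps [simp] = rho(1-4)[OF over_A2]
lemmas l3_simps [simp] = lam(1-3)[OF over_A2]
lemmas nxt_unit_t_simps [simp] = nxt_unit[OF over_MA]

lemma nxt_leg_simps [simp]:
  "nxt_leg t \<in> Arr C" "Dom C (nxt_leg t) = PB s t" "Cod C (nxt_leg t) = Car MB"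
  by (simp_all add: nxt_leg_def)

lemma nxt_leg_Comp: "r \<in> Arr C \<Longrightarrow> Cod C r = PB s t \<Longrightarrow> nxt_leg t \<cdot> r = t \<cdot> p1 s t \<cdot> r"
  by (simp add: nxt_leg_def)

lemma l3_p2 [simp]: "p2 s (nxt_leg t) \<cdot> l3 = \<one> (PB s t)"
  using lam(5)[OF over_A2] by simp

text \<open>On identities both embeddings of A give the pair of components (i, i); see also
  \<open>rA_i\<close>.\<close>

lemma nxt_unit_lA: "nxt_unit t i = lA \<cdot> i"
  by (rule pr_joint_mono[of s t]) (simp_all add: reassoc2[OF lam(4)[OF over_MA]] reassoc[OF lam(5)[OF over_MA]])

lemma rA_i: "rA \<cdot> i = lA \<cdot> i"
  by (rule pr_joint_mono[of s t]) (simp_all add: reassoc2[OF lam(4)[OF over_MA]] reassoc[OF lam(5)[OF over_MA]]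
    reassoc[OF rho(4)[OF over_MA]] reassoc2[OF rho(5)[OF over_MA]])

section \<open>The associativity isomorphism of A \<box> A \<box> A\<close>

lemma commute_r: "r \<in> Arr C \<Longrightarrow> Cod C r = PB s t \<Longrightarrow> s \<cdot> p1 s t \<cdot> r = t \<cdot> p2 s t \<cdot> r"
  by (rule reassoc2[OF pr_commute]) simp_all

text \<open>Needed for (A \<box> A) \<box> A to exist; the right leg of A \<box> A lies in
  \<open>S\<close> by reflection.\<close>

lemma cospan_left: "cospan (s \<cdot> p2 s t) t"
proof -
  have 1: "S (p1 s t) (s \<cdot> p2 s t)" by (rule S_post_right[OF pr_S]) simp_all
  have 2: "S (p2 s t) (s \<cdot> p2 s t)" using S_pre[OF S_s, of "p2 s t"] by simp
  have "S (\<one> (PB s t)) (s \<cdot> p2 s t)"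
    by (rule pr_reflect_left[of s t]) (use 1 2 in simp_all)
  then show ?thesis using S_t unfolding cospan_def by simp
qed

text \<open>On (a, (a', a'')), \<open>asc_in\<close> is the pair (a, a') and \<open>asc_inv\<close>
  is ((a, a'), a''), the inverse of \<open>asc\<close>.\<close>

definition "asc_in = pairing C S s t (p1 s (nxt_leg t)) (p1 s t \<cdot> p2 s (nxt_leg t))"
definition "asc_inv = pairing C S (s \<cdot> p2 s t) t asc_in (p2 s t \<cdot> p2 s (nxt_leg t))"
abbreviation "asc \<equiv> box_assoc C S (t, s) (t, s) (t, s)"

lemma asc_in:
  "asc_in \<in> Arr C" "Dom C asc_in = PB s (nxt_leg t)" "Cod C asc_in = PB s t"
  "p1 s t \<cdot> asc_in = p1 s (nxt_leg t)" "p2 s t \<cdot> asc_in = p1 s t \<cdot> p2 s (nxt_leg t)"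
proof -
  have "S (p1 s (nxt_leg t)) (p1 s t \<cdot> p2 s (nxt_leg t))" by (rule S_post_right[OF pr_S]) simp_all
  moreover have "s \<cdot> p1 s (nxt_leg t) = t \<cdot> p1 s t \<cdot> p2 s (nxt_leg t)"
    using pr_commute[OF over_simps(11)[OF over_A2]] by (simp add: nxt_leg_Comp)
  ultimately show "asc_in \<in> Arr C" "Dom C asc_in = PB s (nxt_leg t)" "Cod C asc_in = PB s t"
  "p1 s t \<cdot> asc_in = p1 s (nxt_leg t)" "p2 s t \<cdot> asc_in = p1 s t \<cdot> p2 s (nxt_leg t)"
    unfolding asc_in_def using pairing[of s t "p1 s (nxt_leg t)" "p1 s t \<cdot> p2 s (nxt_leg t)"] by simp_all
qed

lemmas asc_in_simps [simp] = asc_in(1-3)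

lemma asc_inv:
  "asc_inv \<in> Arr C" "Dom C asc_inv = PB s (nxt_leg t)" "Cod C asc_inv = PB (s \<cdot> p2 s t) t"
  "p1 (s \<cdot> p2 s t) t \<cdot> asc_inv = asc_in" "p2 (s \<cdot> p2 s t) t \<cdot> asc_inv = p2 s t \<cdot> p2 s (nxt_leg t)"
proof -
  have 1: "S (p1 s (nxt_leg t)) (p2 s t \<cdot> p2 s (nxt_leg t))" by (rule S_post_right[OF pr_S]) simp_all
  have 2: "S (p1 s t \<cdot> p2 s (nxt_leg t)) (p2 s t \<cdot> p2 s (nxt_leg t))" by (rule S_pre[OF pr_S]) simp_all
  have "S asc_in (p2 s t \<cdot> p2 s (nxt_leg t))"
    by (rule pr_reflect_left[of s t]) (use 1 2 in \<open>simp_all add: asc_in\<close>)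
  moreover have "(s \<cdot> p2 s t) \<cdot> asc_in = t \<cdot> p2 s t \<cdot> p2 s (nxt_leg t)"
    by (simp add: asc_in commute_r)
  ultimately show "asc_inv \<in> Arr C" "Dom C asc_inv = PB s (nxt_leg t)" "Cod C asc_inv = PB (s \<cdot> p2 s t) t"
    "p1 (s \<cdot> p2 s t) t \<cdot> asc_inv = asc_in" "p2 (s \<cdot> p2 s t) t \<cdot> asc_inv = p2 s t \<cdot> p2 s (nxt_leg t)"
    unfolding asc_inv_def using pairing[OF cospan_left, of asc_in "p2 s t \<cdot> p2 s (nxt_leg t)"] by simp_all
qed

lemmas asc_inv_simps [simp] = asc_inv(1-3)

lemma asc:
  "asc \<in> Arr C" "Dom C asc = PB (s \<cdot> p2 s t) t" "Cod C asc = PB s (nxt_leg t)"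
  "asc_inv \<cdot> asc = \<one> (PB (s \<cdot> p2 s t) t)" "asc \<cdot> asc_inv = \<one> (PB s (nxt_leg t))"
proof -
  let ?P = "p1 (s \<cdot> p2 s t) t" and ?Q = "p2 (s \<cdot> p2 s t) t"
  note [simp] = cospan_left
  \<comment> \<open>\<open>w\<close> is the second component (a', a'') of the image of ((a, a'),
    a'').\<close>
  define w where "w = pairing C S s t (p2 s t \<cdot> ?P) ?Q"
  have Sw: "S (p2 s t \<cdot> ?P) ?Q" by (rule S_post_left[OF pr_S]) simp_all
  have "s \<cdot> p2 s t \<cdot> ?P = t \<cdot> ?Q" using pr_commute[OF cospan_left] by simp
  then have w [simp]: "w \<in> Arr C" "Dom C w = PB (s \<cdot> p2 s t) t" "Cod C w = PB s t"
    and pw: "p1 s t \<cdot> w = p2 s t \<cdot> ?P" "p2 s t \<cdot> w = ?Q"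
    unfolding w_def using pairing[OF _ Sw, of s t] by simp_all
  have 1: "S (p1 s t \<cdot> ?P) (p2 s t \<cdot> ?P)" by (rule S_pre[OF pr_S]) simp_all
  have 2: "S (p1 s t \<cdot> ?P) ?Q" by (rule S_post_left[OF pr_S]) simp_all
  have Sa: "S (p1 s t \<cdot> ?P) w"
    by (rule pr_reflect_right[of s t]) (use 1 2 in \<open>simp_all add: pw\<close>)
  have asc_eq: "asc = pairing C S s (nxt_leg t) (p1 s t \<cdot> ?P) w"
    by (simp add: box_assoc_def Let_def w_def nxt_leg_def)
  have "s \<cdot> p1 s t \<cdot> ?P = nxt_leg t \<cdot> w"
    by (simp add: nxt_leg_Comp pw commute_r)
  then have a [simp]: "asc \<in> Arr C" "Dom C asc = PB (s \<cdot> p2 s t) t" "Cod C asc = PB s (nxt_leg t)"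
    and pa: "p1 s (nxt_leg t) \<cdot> asc = p1 s t \<cdot> ?P" "p2 s (nxt_leg t) \<cdot> asc = w"
    unfolding asc_eq using pairing[OF over_simps(11)[OF over_A2] Sa] by simp_all
  show "asc \<in> Arr C" "Dom C asc = PB (s \<cdot> p2 s t) t" "Cod C asc = PB s (nxt_leg t)" by simp_all
  have i1: "asc_in \<cdot> asc = ?P"
    by (rule pr_joint_mono[of s t]) (simp_all add: reassoc[OF asc_in(4)] reassoc2[OF asc_in(5)] pa pw)
  show "asc_inv \<cdot> asc = \<one> (PB (s \<cdot> p2 s t) t)"
    by (rule pr_joint_mono[OF cospan_left]) (simp_all add: reassoc[OF asc_inv(4)] reassoc2[OF asc_inv(5)] i1 pa pw)
  have i2: "w \<cdot> asc_inv = p2 s (nxt_leg t)"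
    by (rule pr_joint_mono[of s t]) (simp_all add: reassoc2[OF pw(1)] reassoc[OF pw(2)] asc_inv asc_in)
  show "asc \<cdot> asc_inv = \<one> (PB s (nxt_leg t))"
    by (rule pr_joint_mono[OF over_simps(11)[OF over_A2]]) (simp_all add: reassoc2[OF pa(1)] reassoc[OF pa(2)] asc_inv asc_in i2)
qed

section \<open>The definitions of q_n and of relative categories in terms of \<rho> and
  \<lambda>\<close>

abbreviation "K d \<equiv> \<lparr>cat_B = MB, cat_A = MA, cat_i = i, cat_s = s, cat_t = t, cat_d = d\<rparr>"

lemma cospan_unit: "cospan s (Unt MB)"
  using S_s S_post_left[OF S_Unit, of "Unt MB"] by (simp add: cospan_def)

lemma q_Suc_eq: "q_Suc C S (K d) n = (rho (tn n) (un n) \<cdot> p1 s (Unt MB)) \<star>\<^bsub>nxt (pw n) (tn n)\<^esub> lam (pw n) (tn n)"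
proof -
  note o = over_pow[of n]
  note [simp] = over_simps[OF o] rho(1-3)[OF o] lam(1-3)[OF o] cospan_unit nxt(1,2)[OF o]
  have "pw (Suc n) = nxt (pw n) (tn n)" by (simp add: nxt_def)
  then show ?thesis
    by (simp add: q_Suc_def Let_def rho_eq[OF o] lam_eq[OF o] conv_def del: box_pow_mon.simps)
qed

lemma relative_category_iff:
  "relative_category C S (Car MB) (Car MA) i s t d \<longleftrightarrow>
     d \<in> Arr C \<and> Dom C d = PB s t \<and> Cod C d = Car MA \<and> s \<cdot> d = s \<cdot> p2 s t \<and> t \<cdot> d = t \<cdot> p1 s t \<and>
     d \<cdot> rA = \<one> (Car MA) \<and> d \<cdot> lA = \<one> (Car MA) \<and>
     d \<cdot> box C S (s \<cdot> p2 s t) t s t d (\<one> (Car MA)) = d \<cdot> box C S s (nxt_leg t) s t (\<one> (Car MA)) d \<cdot> asc"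
  unfolding relative_category_def rho_eq[OF over_MA] lam_eq[OF over_MA] nxt_leg_def span_legs_in_def
  using S_B S_t S_s by auto

end

context split_graph
begin

abbreviation "qA \<equiv> qn MA t i"

lemmas qA_simps [simp] = qn(1-3)[OF over_MA]

end

text \<open>
  \<open>qn MA t i\<close> is a version of \<open>q\<^sub>2\<close> with values in \<open>A \<box> A\<close> rather than \<open>A \<box> (A \<box> B)\<close>; invertibility of it and
  of its analogue with values in \<open>A \<box> (A \<box> A)\<close> makes the images of \<open>\<rho> \<circ> j\<close> and \<open>\<lambda>\<close> jointly generate.
\<close>

locale composition = split_graph C S MB MA i s t MY j e k x
  for C :: "('o, 'a) moncat" (structure) and S MB MA i s t MY j e k x +
  fixes d
  assumes qA_invertible [simp]: "invertible C (qn MA t i)"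
    and q3_invertible [simp]: "invertible C (qn A2 (nxt_leg t) (nxt_unit t i))"
    and d_simps [simp]: "d \<in> Arr C" "Dom C d = PB s t" "Cod C d = Car MA"
    and d_qA: "d \<cdot> qn MA t i = j \<star>\<^bsub>MA\<^esub> \<one> (Car MA)"
    and d_exchange: "d \<cdot> (lA \<star>\<^bsub>A2\<^esub> (rA \<cdot> j)) = \<one> (Car MA) \<star>\<^bsub>MA\<^esub> j"
begin

lemma d_qA_r: "r \<in> Arr C \<Longrightarrow> Cod C r = YY \<odot> AA \<Longrightarrow> d \<cdot> qA \<cdot> r = (j \<star>\<^bsub>MA\<^esub> \<one> AA) \<cdot> r"
  by (rule reassoc[OF d_qA]) simp_all

lemma units [simp]: "lA \<cdot> Unt MA = Unt A2" "rA \<cdot> Unt MA = Unt A2"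
  using monoid_homD(5)[OF lam_hom[OF over_MA]] monoid_homD(5)[OF rho_hom[OF over_MA]] by simp_all

lemma jm: "j \<star>\<^bsub>MA\<^esub> j = j \<cdot> Mul MY" "(rA \<cdot> j) \<star>\<^bsub>A2\<^esub> (rA \<cdot> j) = rA \<cdot> j \<cdot> Mul MY"
proof -
  show 1: "j \<star>\<^bsub>MA\<^esub> j = j \<cdot> Mul MY" using monoid_homD(4)[OF j] by (simp add: conv_def)
  show "(rA \<cdot> j) \<star>\<^bsub>A2\<^esub> (rA \<cdot> j) = rA \<cdot> j \<cdot> Mul MY"
    by (simp add: hom_conv[OF rho_hom[OF over_MA]] flip: 1)
qed

lemma lm: "lA \<star>\<^bsub>A2\<^esub> lA = lA \<cdot> Mul MA"
  using monoid_homD(4)[OF lam_hom[OF over_MA]] by (simp add: conv_def)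

text \<open>Inserting the unit of Y into \<open>qA\<close> leaves \<open>lA\<close>, so
  \<open>d_qA\<close> gives the value; for \<open>d_rA_j\<close> the unit of A is inserted
  instead.\<close>

lemma d_lA: "d \<cdot> lA = \<one> AA"
proof -
  have "qA \<cdot> (Unt MY \<otimes> \<one> AA) = lA \<cdot> \<ell> AA" by (simp add: qn_def conv_unit_left)
  then have "d \<cdot> lA \<cdot> \<ell> AA = d \<cdot> qA \<cdot> (Unt MY \<otimes> \<one> AA)" by simp
  also have "\<dots> = \<ell> AA" by (simp add: d_qA_r conv_unit_left)
  finally have "(d \<cdot> lA) \<cdot> \<ell> AA = \<one> AA \<cdot> \<ell> AA" by simp
  then show ?thesis by (rule cancel_epi) simp_all
qed

lemma d_rA_j: "d \<cdot> rA \<cdot> j = j"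
proof -
  have "qA \<cdot> (\<one> YY \<otimes> Unt MA) = rA \<cdot> j \<cdot> \<rho> YY" by (simp add: qn_def conv_unit_right)
  then have "d \<cdot> rA \<cdot> j \<cdot> \<rho> YY = d \<cdot> qA \<cdot> (\<one> YY \<otimes> Unt MA)" by simp
  also have "\<dots> = j \<cdot> \<rho> YY" by (simp add: d_qA_r conv_unit_right)
  finally have "(d \<cdot> rA \<cdot> j) \<cdot> \<rho> YY = j \<cdot> \<rho> YY" by simp
  then show ?thesis by (rule cancel_epi) simp_all
qed

lemma factor:
  assumes "w \<in> Arr C" "Cod C w = PB s t"
  obtains v where "v \<in> Arr C" "Dom C v = Dom C w" "Cod C v = YY \<odot> AA" "w = qA \<cdot> v"
  using that[of "Inv C qA \<cdot> w"] assms by simp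

text \<open>Every \<open>w\<close> factors through the isomorphism \<open>qA\<close>, where the
  claim is associativity and multiplicativity of \<open>rA \<circ> j\<close>. In
  \<open>d_right\<close>, \<open>lA\<close> plays this role on the other side.\<close>

lemma d_left:
  assumes "w \<in> Arr C" "Cod C w = PB s t"
  shows "d \<cdot> ((rA \<cdot> j) \<star>\<^bsub>A2\<^esub> w) = j \<star>\<^bsub>MA\<^esub> (d \<cdot> w)"
proof -
  obtain v where [simp]: "v \<in> Arr C" "Cod C v = YY \<odot> AA" and v: "w = qA \<cdot> v" by (rule factor[OF assms])
  have "(rA \<cdot> j) \<star>\<^bsub>A2\<^esub> qA = (((rA \<cdot> j) \<star>\<^bsub>A2\<^esub> (rA \<cdot> j)) \<star>\<^bsub>A2\<^esub> lA) \<cdot> Inv C (\<alpha> YY YY AA)"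
    by (simp add: qn_def conv_assoc')
  also have "\<dots> = qA \<cdot> (Mul MY \<otimes> \<one> AA) \<cdot> Inv C (\<alpha> YY YY AA)"
    by (simp add: jm qn_def)
  finally have "d \<cdot> ((rA \<cdot> j) \<star>\<^bsub>A2\<^esub> qA) = ((j \<star>\<^bsub>MA\<^esub> j) \<star>\<^bsub>MA\<^esub> \<one> AA) \<cdot> Inv C (\<alpha> YY YY AA)"
    by (simp add: d_qA_r jm)
  also have "\<dots> = j \<star>\<^bsub>MA\<^esub> (d \<cdot> qA)"
    by (simp add: conv_assoc d_qA)
  finally have *: "d \<cdot> ((rA \<cdot> j) \<star>\<^bsub>A2\<^esub> qA) = j \<star>\<^bsub>MA\<^esub> (d \<cdot> qA)" .
  have "d \<cdot> ((rA \<cdot> j) \<star>\<^bsub>A2\<^esub> w) = (d \<cdot> ((rA \<cdot> j) \<star>\<^bsub>A2\<^esub> qA)) \<cdot> (\<one> YY \<otimes> v)"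
    by (simp add: v)
  also have "\<dots> = j \<star>\<^bsub>MA\<^esub> (d \<cdot> w)" unfolding * by (simp add: v)
  finally show ?thesis .
qed

lemma d_right:
  assumes "w \<in> Arr C" "Cod C w = PB s t" "a \<in> Arr C" "Cod C a = AA"
  shows "d \<cdot> (w \<star>\<^bsub>A2\<^esub> (lA \<cdot> a)) = (d \<cdot> w) \<star>\<^bsub>MA\<^esub> a"
proof -
  obtain v where [simp]: "v \<in> Arr C" "Cod C v = YY \<odot> AA" and v: "w = qA \<cdot> v" by (rule factor[OF assms(1,2)])
  note [simp] = assms(3,4)
  have "qA \<star>\<^bsub>A2\<^esub> lA = ((rA \<cdot> j) \<star>\<^bsub>A2\<^esub> (lA \<star>\<^bsub>A2\<^esub> lA)) \<cdot> \<alpha> YY AA AA"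
    by (simp add: qn_def conv_assoc)
  also have "\<dots> = qA \<cdot> (\<one> YY \<otimes> Mul MA) \<cdot> \<alpha> YY AA AA"
    by (simp add: lm qn_def)
  finally have "d \<cdot> (qA \<star>\<^bsub>A2\<^esub> lA) = (j \<star>\<^bsub>MA\<^esub> (\<one> AA \<star>\<^bsub>MA\<^esub> \<one> AA)) \<cdot> \<alpha> YY AA AA"
    by (simp add: d_qA_r Mul_conv)
  also have "\<dots> = (d \<cdot> qA) \<star>\<^bsub>MA\<^esub> \<one> AA"
    by (simp add: conv_assoc d_qA)
  finally have *: "d \<cdot> (qA \<star>\<^bsub>A2\<^esub> lA) = (d \<cdot> qA) \<star>\<^bsub>MA\<^esub> \<one> AA" .
  have "d \<cdot> (w \<star>\<^bsub>A2\<^esub> (lA \<cdot> a)) = (d \<cdot> (qA \<star>\<^bsub>A2\<^esub> lA)) \<cdot> (v \<otimes> a)"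
    by (simp add: v)
  also have "\<dots> = (d \<cdot> w) \<star>\<^bsub>MA\<^esub> a" unfolding * by (simp add: v)
  finally show ?thesis .
qed

text \<open>Expand a product of two copies of \<open>qA\<close> into four factors.
  \<open>d_left\<close> extracts the first and \<open>d_right\<close> the last; the two in the
  middle are \<open>lA\<close> and \<open>rA \<circ> j\<close>, to which \<open>d_exchange\<close>
  applies.\<close>

lemma d_hom: "monoid_hom C A2 MA d"
proof -
  have r: "d \<cdot> (lA \<star>\<^bsub>A2\<^esub> qA) = \<one> AA \<star>\<^bsub>MA\<^esub> (j \<star>\<^bsub>MA\<^esub> \<one> AA)"
  proof -
    have "d \<cdot> (lA \<star>\<^bsub>A2\<^esub> qA) = d \<cdot> ((lA \<star>\<^bsub>A2\<^esub> (rA \<cdot> j)) \<star>\<^bsub>A2\<^esub> (lA \<cdot> \<one> AA)) \<cdot> Inv C (\<alpha> AA YY AA)"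
      by (simp add: qn_def conv_assoc')
    also have "\<dots> = (d \<cdot> ((lA \<star>\<^bsub>A2\<^esub> (rA \<cdot> j)) \<star>\<^bsub>A2\<^esub> (lA \<cdot> \<one> AA))) \<cdot> Inv C (\<alpha> AA YY AA)"
      by simp
    also have "\<dots> = ((\<one> AA \<star>\<^bsub>MA\<^esub> j) \<star>\<^bsub>MA\<^esub> \<one> AA) \<cdot> Inv C (\<alpha> AA YY AA)"
      by (subst d_right) (simp_all add: d_exchange)
    also have "\<dots> = \<one> AA \<star>\<^bsub>MA\<^esub> (j \<star>\<^bsub>MA\<^esub> \<one> AA)"
      by (simp add: conv_assoc')
    finally show ?thesis .
  qed
  have "(d \<cdot> Mul A2) \<cdot> (qA \<otimes> qA) = d \<cdot> (qA \<star>\<^bsub>A2\<^esub> qA)"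
    by (simp add: Mul_conv)
  also have "\<dots> = d \<cdot> (((rA \<cdot> j) \<star>\<^bsub>A2\<^esub> lA) \<star>\<^bsub>A2\<^esub> qA)"
    by (simp add: qn_def)
  also have "\<dots> = (d \<cdot> ((rA \<cdot> j) \<star>\<^bsub>A2\<^esub> (lA \<star>\<^bsub>A2\<^esub> qA))) \<cdot> \<alpha> YY AA (YY \<odot> AA)"
    by (simp add: conv_assoc)
  also have "\<dots> = (j \<star>\<^bsub>MA\<^esub> (\<one> AA \<star>\<^bsub>MA\<^esub> (j \<star>\<^bsub>MA\<^esub> \<one> AA))) \<cdot> \<alpha> YY AA (YY \<odot> AA)"
    by (subst d_left) (simp_all add: r)
  also have "\<dots> = (j \<star>\<^bsub>MA\<^esub> \<one> AA) \<star>\<^bsub>MA\<^esub> (j \<star>\<^bsub>MA\<^esub> \<one> AA)"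
    by (simp add: conv_assoc)
  also have "\<dots> = (d \<star>\<^bsub>MA\<^esub> d) \<cdot> (qA \<otimes> qA)"
    by (simp add: d_qA)
  finally have "d \<cdot> Mul A2 = d \<star>\<^bsub>MA\<^esub> d"
    by (rule cancel_epi) (simp_all add: invertible_Tensor)
  moreover have "d \<cdot> Unt A2 = Unt MA"
    using reassoc[OF d_lA, of "Unt MA"] by simp
  ultimately show ?thesis by (simp add: monoid_hom_conv)
qed

lemma d_lA_r: "r \<in> Arr C \<Longrightarrow> Cod C r = AA \<Longrightarrow> d \<cdot> lA \<cdot> r = r"
  using reassoc[OF d_lA, of r] by simp

text \<open>The formula for d on \<open>qA\<close> reaches only \<open>rA \<circ> j\<close>. All of
  A is reached through q, by multiplicativity and the agreement of \<open>rA\<close> and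
  \<open>lA\<close> on the image of i.\<close>

lemma d_rA: "d \<cdot> rA = \<one> AA"
proof -
  have "(d \<cdot> rA) \<cdot> q = d \<cdot> ((rA \<cdot> j) \<star>\<^bsub>A2\<^esub> (lA \<cdot> i))"
    by (simp add: hom_conv[OF rho_hom[OF over_MA]] rA_i)
  also have "\<dots> = \<one> AA \<cdot> q"
    by (simp add: hom_conv[OF d_hom] d_rA_j d_lA_r)
  finally show ?thesis by (rule cancel_epi) simp_all
qed

lemma s_d: "s \<cdot> d = s \<cdot> p2 s t"
proof -
  have "(s \<cdot> d) \<cdot> qA = s \<cdot> (j \<star>\<^bsub>MA\<^esub> \<one> AA)" by (simp add: d_qA)
  also have "\<dots> = s \<cdot> cl AA" by (simp add: hom_conv[OF s] sj conv_cl)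
  also have "\<dots> = (s \<cdot> p2 s t) \<cdot> qA" by (simp add: qn(5)[OF over_MA])
  finally show ?thesis by (rule cancel_epi) simp_all
qed

lemma t_d: "t \<cdot> d = t \<cdot> p1 s t"
proof -
  have "(t \<cdot> d) \<cdot> qA = t \<cdot> (j \<star>\<^bsub>MA\<^esub> \<one> AA)" by (simp add: d_qA)
  also have "\<dots> = k \<star>\<^bsub>MB\<^esub> t" by (simp add: hom_conv[OF t] tj)
  also have "\<dots> = (t \<cdot> p1 s t) \<cdot> qA" using qn(6)[OF over_MA] by (simp add: nxt_leg_def)
  finally show ?thesis by (rule cancel_epi) simp_all
qed

lemma d_assoc: "d \<cdot> box C S (s \<cdot> p2 s t) t s t d (\<one> AA) = d \<cdot> box C S s (nxt_leg t) s t (\<one> AA) d \<cdot> asc"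
proof -
  let ?q3 = "qn A2 (nxt_leg t) (nxt_unit t i)"
  let ?L = "box C S (s \<cdot> p2 s t) t s t d (\<one> AA)" and ?R = "box C S s (nxt_leg t) s t (\<one> AA) d"
  note [simp] = cospan_left qn(1-3)[OF over_A2]
  note bL = box[of "s \<cdot> p2 s t" t s t d "\<one> AA" "\<one> BB"] and bR = box[of s "nxt_leg t" s t "\<one> AA" d "\<one> BB"]
  have tdn: "t \<cdot> d = nxt_leg t" by (simp add: t_d nxt_leg_def)
  have L [simp]: "?L \<in> Arr C" "Dom C ?L = PB (s \<cdot> p2 s t) t" "Cod C ?L = PB s t"
    and pL: "p1 s t \<cdot> ?L = d \<cdot> p1 (s \<cdot> p2 s t) t" "p2 s t \<cdot> ?L = p2 (s \<cdot> p2 s t) t"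
    using bL by (simp_all add: s_d)
  have R [simp]: "?R \<in> Arr C" "Dom C ?R = PB s (nxt_leg t)" "Cod C ?R = PB s t"
    and pR: "p1 s t \<cdot> ?R = p1 s (nxt_leg t)" "p2 s t \<cdot> ?R = d \<cdot> p2 s (nxt_leg t)"
    using bR by (simp_all add: tdn)
  \<comment> \<open>Precomposing with the inverse associativity isomorphism gives both sides the
    domain A \<box> (A \<box> A).\<close>
  define X1 where "X1 = ?L \<cdot> asc_inv"
  have X1 [simp]: "X1 \<in> Arr C" "Dom C X1 = PB s (nxt_leg t)" "Cod C X1 = PB s t" by (simp_all add: X1_def)
  have pX1: "p1 s t \<cdot> X1 = d \<cdot> asc_in" "p2 s t \<cdot> X1 = p2 s t \<cdot> p2 s (nxt_leg t)"
    by (simp_all add: X1_def reassoc2[OF pL(1)] reassoc[OF pL(2)] asc_inv)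
  have h1: "monoid_hom C A3 MA (p1 s (nxt_leg t))" and h2: "monoid_hom C A3 A2 (p2 s (nxt_leg t))"
    using nxt(3,4)[OF over_A2] by simp_all
  have ha: "monoid_hom C A3 A2 asc_in"
    by (rule hom_nxt[OF over_MA])
      (use h1 monoid_hom_Comp[OF _ _ _ h2 nxt(3)[OF over_MA]] in \<open>simp_all add: asc_in\<close>)
  have hX1: "monoid_hom C A3 A2 X1"
    by (rule hom_nxt[OF over_MA])
      (use monoid_hom_Comp[OF _ _ _ ha d_hom] monoid_hom_Comp[OF _ _ _ h2 nxt(4)[OF over_MA]] in \<open>simp_all add: pX1\<close>)
  have hR: "monoid_hom C A3 A2 ?R"
    by (rule hom_nxt[OF over_MA]) (use h1 monoid_hom_Comp[OF _ _ _ h2 d_hom] in \<open>simp_all add: pR\<close>)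
  have ar: "asc_in \<cdot> r3 = rA"
    by (rule pr_joint_mono[of s t])
      (simp_all add: reassoc[OF asc_in(4)] reassoc2[OF asc_in(5)] rho(5)[OF over_A2] rho(5)[OF over_MA]
        reassoc[OF nxt_unit_t_simps(4)])
  have al: "asc_in \<cdot> l3 = lA \<cdot> p1 s t"
    by (rule pr_joint_mono[of s t])
      (simp_all add: reassoc[OF asc_in(4)] reassoc2[OF asc_in(5)] lam(4)[OF over_A2]
        reassoc2[OF lam(4)[OF over_MA]] reassoc[OF lam(5)[OF over_MA]] flip: nxt_leg_def)
  have X1r: "X1 \<cdot> r3 = rA"
    by (rule pr_joint_mono[of s t])
      (simp_all add: reassoc2[OF pX1(1)] reassoc2[OF pX1(2)] ar d_rA rho(5)[OF over_A2] rho(5)[OF over_MA]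
        reassoc[OF nxt_unit_t_simps(5)])
  have du: "d \<cdot> nxt_unit t i = i"
    unfolding nxt_unit_lA by (simp add: d_lA_r)
  have Rr: "?R \<cdot> r3 = rA"
    by (rule pr_joint_mono[of s t])
      (simp_all add: reassoc[OF pR(1)] reassoc2[OF pR(2)] rho(5)[OF over_A2] rho(5)[OF over_MA] reassoc[OF du])
  have X1l: "X1 \<cdot> l3 = \<one> (PB s t)"
    by (rule pr_joint_mono[of s t])
      (simp_all add: reassoc2[OF pX1(1)] reassoc2[OF pX1(2)] al d_lA_r)
  have Rl: "?R \<cdot> l3 = lA \<cdot> d"
    by (rule pr_joint_mono[of s t])
      (simp_all add: reassoc[OF pR(1)] reassoc2[OF pR(2)] lam(4)[OF over_A2] tdn
        reassoc2[OF lam(4)[OF over_MA]] reassoc[OF lam(5)[OF over_MA]])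
  have r_j: "X1 \<cdot> r3 \<cdot> j = rA \<cdot> j" "?R \<cdot> r3 \<cdot> j = rA \<cdot> j"
    by (rule reassoc[OF X1r]; simp) (rule reassoc[OF Rr]; simp)
  \<comment> \<open>The two morphisms agree on \<open>r3 \<circ> j\<close>. On \<open>l3\<close>
    they are 1 and \<open>lA \<circ> d\<close>, which agree once d is applied, because d \<circ>
    \<open>lA\<close> = 1.\<close>
  have "(d \<cdot> X1) \<cdot> ?q3 = d \<cdot> ((rA \<cdot> j) \<star>\<^bsub>A2\<^esub> \<one> (PB s t))"
    by (simp add: qn_def hom_conv[OF hX1] r_j X1l)
  also have "\<dots> = d \<cdot> ((rA \<cdot> j) \<star>\<^bsub>A2\<^esub> (lA \<cdot> d))"
    by (simp add: hom_conv[OF d_hom] d_lA_r)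
  also have "\<dots> = (d \<cdot> ?R) \<cdot> ?q3"
    by (simp add: qn_def hom_conv[OF hR] r_j Rl)
  finally have "d \<cdot> X1 = d \<cdot> ?R" by (rule cancel_epi) simp_all
  then have "(d \<cdot> X1) \<cdot> asc = (d \<cdot> ?R) \<cdot> asc" by simp
  then show ?thesis by (simp add: X1_def asc)
qed

lemma relative_category: "relative_category C S BB AA i s t d"
  unfolding relative_category_iff using s_d t_d d_rA d_lA d_assoc by simp

lemma relative_category_in_monoids: "relative_category_in_monoids C S (K d)"
  unfolding relative_category_in_monoids_def Let_def
  using relative_category d_hom i s t by (simp add: nxt_def)

end

section \<open>Relative categories versus crossed modules\<close>

context split_graph
begin

abbreviation "b2 \<equiv> b_Suc C S X (Suc 0)"
abbreviation "q_box \<equiv> box C S (cl BB) (act (Suc 0)) s t q q"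
abbreviation "comp_Y \<equiv> (Mul MY \<otimes> \<one> BB) \<cdot> Inv C (\<alpha> YY YY BB)"

lemma tq_act: "t \<cdot> q = act (Suc 0)"
  by (simp add: tq act_Suc act_0)

lemmas compare_A = compare[OF over_MA q_invertible _ _ tq_act, of "YY \<odot> BB", simplified]

lemma b2_simps [simp]:
  "b2 \<in> Arr C" "Dom C b2 = YY \<odot> YY \<odot> BB" "Cod C b2 = PB (cl BB) (act (Suc 0))"
  by (simp_all add: b_Suc_eq compare_A)

lemma q_box_b2: "q_box \<cdot> b2 = qA \<cdot> (\<one> YY \<otimes> q)"
  by (simp add: b_Suc_eq compare_A)

lemma b2_invertible: "invertible C b2 \<longleftrightarrow> invertible C qA"
  by (simp add: b_Suc_eq compare_A)

lemma q_box_simps [simp]: "q_box \<in> Arr C" "Dom C q_box = PB (cl BB) (act (Suc 0))" "Cod C q_box = PB s t" "invertible C q_box"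
  using compare_A invertible_Arr by auto

text \<open>\<open>compare\<close> with \<open>N\<close> = A \<box> A, for which \<open>y\<close> is
  the counterpart of \<open>yn 2\<close> with values in A \<box> A in place of A \<box> (A \<box>
  B).\<close>

lemma q3_invertible:
  assumes "invertible C b2" "invertible C (b_Suc C S X (Suc (Suc 0)))"
  shows "invertible C (qn A2 (nxt_leg t) (nxt_unit t i))"
proof -
  let ?y = "qA \<cdot> (\<one> YY \<otimes> q)"
  have [simp]: "invertible C qA" using assms(1) by (simp add: b2_invertible)
  have y: "invertible C ?y" by (rule invertible_Comp) (simp_all add: invertible_Tensor invertible_Ident)
  have "nxt_leg t \<cdot> ?y = (nxt_leg t \<cdot> qA) \<cdot> (\<one> YY \<otimes> q)" by simp
  also have "\<dots> = act (Suc (Suc 0))" unfolding qn(6)[OF over_MA] by (simp add: tq_act act_Suc)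
  finally show ?thesis
    using compare(13)[OF over_A2 y, of "YY \<odot> YY \<odot> BB" "act (Suc (Suc 0))"] assms(2)
    by (simp add: b_Suc_eq)
qed

lemma q_comp_Y: "q \<cdot> comp_Y = j \<star>\<^bsub>MA\<^esub> q"
proof -
  have "j \<star>\<^bsub>MA\<^esub> q = ((j \<star>\<^bsub>MA\<^esub> j) \<star>\<^bsub>MA\<^esub> i) \<cdot> Inv C (\<alpha> YY YY BB)" by (simp add: conv_assoc')
  also have "j \<star>\<^bsub>MA\<^esub> j = j \<cdot> Mul MY" using monoid_homD(4)[OF j] by (simp add: conv_def)
  finally show ?thesis by simp
qed

text \<open>Hence q identifies A with Y \<otimes> B as a monoid.\<close>

lemma q_hom: "monoid_hom C (distributive_monoid C MB MY x) MA q"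
  by (rule D.monoid_hom_from_YB[OF MA j i qx])

text \<open>Read through the isomorphisms \<open>q\<close> and \<open>q_box\<close>, the composition
  is the inverse of b_2 followed by m \<otimes> 1. This is the expression in (d') and the
  composition in \<open>to_catmon\<close>.\<close>

lemma d_q_box:
  assumes [simp]: "invertible C b2" "d \<in> Arr C" "Dom C d = PB s t" "Cod C d = AA" and d: "d \<cdot> qA = j \<star>\<^bsub>MA\<^esub> \<one> AA"
  shows "d \<cdot> q_box = q \<cdot> comp_Y \<cdot> Inv C b2"
proof -
  have "(d \<cdot> q_box) \<cdot> b2 = (d \<cdot> qA) \<cdot> (\<one> YY \<otimes> q)" by (simp add: q_box_b2)
  also have "\<dots> = q \<cdot> comp_Y" unfolding d q_comp_Y by simp
  also have "\<dots> = (q \<cdot> comp_Y \<cdot> Inv C b2) \<cdot> b2" by simp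
  finally show ?thesis by (rule cancel_epi) simp_all
qed

text \<open>Both sides of (d') are composed with \<open>q\<close> and precomposed with an
  isomorphism. On the right, \<open>d_q_box\<close> brings in d, and the multiplicative
  \<open>q_box\<close> takes the two unit insertions to \<open>lA \<circ> q\<close> and
  \<open>rA \<circ> j\<close>; on the left, associativity gives multiplication by j.\<close>

lemma peiffer_iff:
  assumes b2 [simp]: "invertible C b2" and [simp]: "d \<in> Arr C" "Dom C d = PB s t" "Cod C d = AA" and d: "d \<cdot> qA = j \<star>\<^bsub>MA\<^esub> \<one> AA"
  shows "peiffer C S X \<longleftrightarrow> d \<cdot> (lA \<star>\<^bsub>A2\<^esub> (rA \<cdot> j)) = \<one> AA \<star>\<^bsub>MA\<^esub> j"
proof -
  let ?P = "rpb_mon C S (distributive_monoid C MB MY x) (distributive_monoid C MB MY x) (cl BB) (act (Suc 0))"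
  let ?ul = "(Unt MY \<otimes> \<one> (YY \<odot> BB)) \<cdot> Inv C (\<ell> (YY \<odot> BB))"
  let ?ur = "(\<one> YY \<otimes> ((Unt MY \<otimes> Unt MB) \<cdot> Inv C (\<ell> \<I>))) \<cdot> Inv C (\<rho> YY)"
  let ?a = "Inv C (\<alpha> YY BB YY)"
  note [simp] = D.monoid_in_YB
  have hcl: "monoid_hom C (distributive_monoid C MB MY x) MB (cl BB)"
    using monoid_hom_Comp[OF D.monoid_in_YB MA MB q_hom s] by (simp add: sq)
  have hact: "monoid_hom C (distributive_monoid C MB MY x) MB (act (Suc 0))"
    using monoid_hom_Comp[OF D.monoid_in_YB MA MB q_hom t] by (simp add: tq_act)
  note r = rpb_mon[OF compare_A(1) D.monoid_in_YB D.monoid_in_YB MB hcl hact]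
  note [simp] = r(1,2)
  have hbx: "monoid_hom C ?P A2 q_box"
    by (rule hom_nxt[OF over_MA])
      (use monoid_hom_Comp[OF r(2) D.monoid_in_YB MA r(3) q_hom] monoid_hom_Comp[OF r(2) D.monoid_in_YB MA r(4) q_hom]
        in \<open>simp_all add: compare_A\<close>)
  have qb: "q_box \<cdot> b2 \<cdot> r = qA \<cdot> (\<one> YY \<otimes> q) \<cdot> r" if "r \<in> Arr C" "Cod C r = YY \<odot> YY \<odot> BB" for r
    by (rule reassoc2[OF q_box_b2]) (use that in simp_all)
  have uA: "lA \<cdot> Unt MA = Unt A2" "rA \<cdot> Unt MA = Unt A2"
    using monoid_homD(5)[OF lam_hom[OF over_MA]] monoid_homD(5)[OF rho_hom[OF over_MA]] by simp_all
  have bl: "q_box \<cdot> b2 \<cdot> ?ul = lA \<cdot> q"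
    by (simp add: qb qn_def uA conv_unit_left)
  have br: "q_box \<cdot> b2 \<cdot> ?ur = rA \<cdot> j"
    by (simp add: qb qn_def uA conv_unit_left conv_unit_right lunit_runit_unit)
  let ?LHS = "(Mul MY \<otimes> \<one> BB) \<cdot> Inv C (\<alpha> YY YY BB) \<cdot> (\<one> YY \<otimes> x)"
  let ?RHS = "(Mul MY \<otimes> \<one> BB) \<cdot> Inv C (\<alpha> YY YY BB) \<cdot> Inv C b2 \<cdot> Mul ?P \<cdot> (b2 \<otimes> b2) \<cdot> (?ul \<otimes> ?ur) \<cdot> ?a"
  have p: "peiffer C S X \<longleftrightarrow> ?LHS = ?RHS"
    unfolding peiffer_def Let_def One_nat_def by simp
  have "q \<cdot> ?LHS = (q \<cdot> comp_Y) \<cdot> (\<one> YY \<otimes> x)" by simp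
  also have "\<dots> = j \<star>\<^bsub>MA\<^esub> (i \<star>\<^bsub>MA\<^esub> j)"
    unfolding q_comp_Y by (simp add: qx)
  also have "\<dots> = (\<one> AA \<star>\<^bsub>MA\<^esub> j) \<cdot> (q \<otimes> \<one> YY) \<cdot> ?a"
    by (simp add: conv_assoc')
  finally have L: "q \<cdot> ?LHS = (\<one> AA \<star>\<^bsub>MA\<^esub> j) \<cdot> (q \<otimes> \<one> YY) \<cdot> ?a" .
  have "q \<cdot> ?RHS = (q \<cdot> comp_Y \<cdot> Inv C b2) \<cdot> ((b2 \<cdot> ?ul) \<star>\<^bsub>?P\<^esub> (b2 \<cdot> ?ur)) \<cdot> ?a"
    by (simp add: conv_def)
  also have "\<dots> = d \<cdot> (q_box \<cdot> ((b2 \<cdot> ?ul) \<star>\<^bsub>?P\<^esub> (b2 \<cdot> ?ur))) \<cdot> ?a"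
    unfolding d_q_box[OF assms, symmetric] by simp
  also have "\<dots> = d \<cdot> ((q_box \<cdot> b2 \<cdot> ?ul) \<star>\<^bsub>A2\<^esub> (q_box \<cdot> b2 \<cdot> ?ur)) \<cdot> ?a"
    by (subst hom_conv[OF hbx]) simp_all
  also have "\<dots> = (d \<cdot> (lA \<star>\<^bsub>A2\<^esub> (rA \<cdot> j))) \<cdot> (q \<otimes> \<one> YY) \<cdot> ?a"
    unfolding bl br by simp
  finally have R: "q \<cdot> ?RHS = (d \<cdot> (lA \<star>\<^bsub>A2\<^esub> (rA \<cdot> j))) \<cdot> (q \<otimes> \<one> YY) \<cdot> ?a" .
  have inv: "invertible C ((q \<otimes> \<one> YY) \<cdot> ?a)"
    by (rule invertible_Comp) (simp_all add: invertible_Tensor invertible_Ident invertible_Inv)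
  show ?thesis
  proof
    assume "peiffer C S X"
    then have "(d \<cdot> (lA \<star>\<^bsub>A2\<^esub> (rA \<cdot> j))) \<cdot> ((q \<otimes> \<one> YY) \<cdot> ?a) = (\<one> AA \<star>\<^bsub>MA\<^esub> j) \<cdot> ((q \<otimes> \<one> YY) \<cdot> ?a)"
      using p L R by (simp del: assoc interchange interchange_r conv_Comp conv_Comp_r)
    then show "d \<cdot> (lA \<star>\<^bsub>A2\<^esub> (rA \<cdot> j)) = \<one> AA \<star>\<^bsub>MA\<^esub> j"
      by (rule cancel_epi[OF _ inv]) simp_all
  next
    assume "d \<cdot> (lA \<star>\<^bsub>A2\<^esub> (rA \<cdot> j)) = \<one> AA \<star>\<^bsub>MA\<^esub> j"
    then have "q \<cdot> ?LHS = q \<cdot> ?RHS" unfolding L R by simp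
    then have "?LHS = ?RHS" by (rule cancel_mono) simp_all
    then show "peiffer C S X" unfolding p .
  qed
qed

text \<open>The equations (b') are the images of \<open>qx\<close> under s and t. The locale
  supplies (a') and the distributive law, which leaves (c') and (d').\<close>

lemma xmod_object_iff:
  "xmod_object C S X \<longleftrightarrow> invertible C (f_map C S X) \<and> (\<forall>n. invertible C (b_Suc C S X n)) \<and> peiffer C S X"
proof -
  have "s \<cdot> q \<cdot> x = s \<cdot> (i \<star>\<^bsub>MA\<^esub> j)" "t \<cdot> q \<cdot> x = t \<cdot> (i \<star>\<^bsub>MA\<^esub> j)" by (simp_all add: qx)
  moreover have "s \<cdot> q \<cdot> x = cl BB \<cdot> x" by (rule reassoc[OF sq]) simp_all
  moreover have "t \<cdot> q \<cdot> x = (k \<star>\<^bsub>MB\<^esub> \<one> BB) \<cdot> x" by (rule reassoc[OF tq]) simp_all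
  ultimately have "cl BB \<cdot> x = \<rho> BB \<cdot> (\<one> BB \<otimes> e)" "Mul MB \<cdot> (k \<otimes> \<one> BB) \<cdot> x = Mul MB \<cdot> (\<one> BB \<otimes> k)"
    by (simp_all add: hom_conv[OF s] hom_conv[OF t] sj tj conv_counit_right, simp add: conv_def)
  then show ?thesis
    unfolding xmod_object_def Let_def using e k_hom S_k S_e S_B D.dlaw by simp
qed

section \<open>The kernel of s and the correspondence of objects\<close>

abbreviation "to_kernel \<equiv> pairing C S s (Unt MB) j e"

text \<open>The comparison of Y with the chosen pullback A \<box> I.\<close>

lemma to_kernel:
  "to_kernel \<in> Arr C" "Dom C to_kernel = YY" "Cod C to_kernel = PB s (Unt MB)"
  "p1 s (Unt MB) \<cdot> to_kernel = j" "p2 s (Unt MB) \<cdot> to_kernel = e"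
proof -
  have "S j e" using S_post_left[OF S_e, of j] by simp
  then show "to_kernel \<in> Arr C" "Dom C to_kernel = YY" "Cod C to_kernel = PB s (Unt MB)"
  "p1 s (Unt MB) \<cdot> to_kernel = j" "p2 s (Unt MB) \<cdot> to_kernel = e"
    using pairing[OF cospan_unit, of j e] by (simp_all add: sj)
qed

lemma cospan_cl_unit: "cospan (cl BB) (Unt MB)"
  using compare_A(1) cospan_unit by (simp add: cospan_def)

lemma f_map:
  "f_map C S X \<in> Arr C" "Dom C (f_map C S X) = YY" "Cod C (f_map C S X) = PB (cl BB) (Unt MB)"
  "p1 (cl BB) (Unt MB) \<cdot> f_map C S X = D.inY" "p2 (cl BB) (Unt MB) \<cdot> f_map C S X = e"
proof -
  have 1: "S D.inY e" using S_post_left[OF S_e, of "D.inY"] by simp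
  have "cl BB \<cdot> D.inY = s \<cdot> q \<cdot> D.inY" by (rule reassoc[symmetric, OF sq]) simp_all
  also have "\<dots> = Unt MB \<cdot> e" by (simp add: D.conv_in[OF MA j i] sj)
  finally have 2: "cl BB \<cdot> D.inY = Unt MB \<cdot> e" .
  show "f_map C S X \<in> Arr C" "Dom C (f_map C S X) = YY" "Cod C (f_map C S X) = PB (cl BB) (Unt MB)"
  "p1 (cl BB) (Unt MB) \<cdot> f_map C S X = D.inY" "p2 (cl BB) (Unt MB) \<cdot> f_map C S X = e"
    using pairing[OF cospan_cl_unit 1 _ _ 2] by (simp_all add: f_map_def Let_def flip: D.inY_def)
qed

text \<open>The isomorphism q \<box> 1 carries f to \<open>to_kernel\<close>.\<close>

lemma f_map_invertible: "invertible C (f_map C S X) \<longleftrightarrow> invertible C to_kernel"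
proof -
  let ?u = "Unt MB"
  let ?bx = "box C S (cl BB) ?u s ?u q (\<one> \<I>)"
  note b = box[OF cospan_cl_unit cospan_unit, of q "\<one> \<I>" "\<one> BB"]
  note [simp] = to_kernel(1-3) f_map(1-3) cospan_unit cospan_cl_unit
  have bx [simp]: "?bx \<in> Arr C" "Dom C ?bx = PB (cl BB) ?u" "Cod C ?bx = PB s ?u"
    and pb: "p1 s ?u \<cdot> ?bx = q \<cdot> p1 (cl BB) ?u" "p2 s ?u \<cdot> ?bx = p2 (cl BB) ?u"
    using b by (simp_all add: sq)
  have inv: "invertible C ?bx"
    by (rule box_invertible(1)) (simp_all add: sq invertible_Ident)
  have "?bx \<cdot> f_map C S X = to_kernel"
    by (rule pr_joint_mono[OF cospan_unit])
      (simp_all add: reassoc2[OF pb(1)] reassoc[OF pb(2)] f_map(4,5) to_kernel(4,5) D.conv_in[OF MA j i])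
  then show ?thesis
    using invertible_Comp[OF _ inv, of "f_map C S X"] invertible_cancel_left[OF _ inv, of "f_map C S X"] by auto
qed

text \<open>Precomposing q_(n+1) with \<open>to_kernel\<close> \<otimes> 1 replaces the chosen
  kernel by Y and gives \<open>qn\<close>.\<close>

lemma q_Suc_invertible:
  assumes k: "invertible C to_kernel"
  shows "invertible C (q_Suc C S (K d) n) \<longleftrightarrow> invertible C (qn (pw n) (tn n) (un n))"
proof -
  note o = over_pow[of n]
  note [simp] = over_simps[OF o] rho(1-3)[OF o] lam(1-3)[OF o] cospan_unit nxt(1,2)[OF o] to_kernel(1-3)
  have e: "q_Suc C S (K d) n \<cdot> (to_kernel \<otimes> \<one> (Car (pw n))) = qn (pw n) (tn n) (un n)"
    by (simp add: q_Suc_eq qn_def to_kernel(4))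
  have inv: "invertible C (to_kernel \<otimes> \<one> (Car (pw n)))" using k by (simp add: invertible_Tensor invertible_Ident)
  have [simp]: "q_Suc C S (K d) n \<in> Arr C" "Dom C (q_Suc C S (K d) n) = PB s (Unt MB) \<odot> Car (pw n)"
    by (simp_all add: q_Suc_eq)
  show ?thesis
    using invertible_Comp[OF inv, of "q_Suc C S (K d) n"] invertible_cancel_right[OF _ inv, of "q_Suc C S (K d) n"] e by auto
qed

text \<open>Invertibility of b_2 and b_3 gives the two isomorphisms demanded by
  \<open>composition\<close>, and the Peiffer condition gives \<open>d_exchange\<close>; the axioms
  for d are consequences of these.\<close>

lemma catmon_object_K:
  assumes X: "xmod_object C S X" and [simp]: "d \<in> Arr C" "Dom C d = PB s t" "Cod C d = AA" and d: "d \<cdot> qA = j \<star>\<^bsub>MA\<^esub> \<one> AA"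
  shows "catmon_object C S (K d)"
proof -
  have f: "invertible C to_kernel" and b: "\<forall>n. invertible C (b_Suc C S X n)" and p: "peiffer C S X"
    using X by (simp_all add: xmod_object_iff f_map_invertible)
  interpret composition C S MB MA i s t MY j e k x d
    by unfold_locales (use b b2_invertible q3_invertible d p peiffer_iff[of d] in auto)
  show ?thesis
    unfolding catmon_object_def using relative_category_in_monoids b q_Suc_invertible[OF f] qn_b_invertible by simp
qed

text \<open>A multiplicative d obeying the unit laws is determined on products of values of
  \<open>rA\<close> and \<open>lA\<close>: on (\<open>rA \<circ> j\<close>) \<star>
  \<open>lA\<close> this is the formula for d \<circ> \<open>qA\<close>, and on \<open>lA\<close>
  \<star> (\<open>rA \<circ> j\<close>) it is the Peiffer condition.\<close>

lemma xmod_object_X: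
  assumes K: "catmon_object C S (K d)" and f: "invertible C to_kernel"
  shows "xmod_object C S X" "d \<cdot> qA = j \<star>\<^bsub>MA\<^esub> \<one> AA"
proof -
  have rc: "relative_category C S BB AA i s t d" and h: "monoid_hom C A2 MA d" and "\<forall>n. invertible C (q_Suc C S (K d) n)"
    using K by (simp_all add: catmon_object_def relative_category_in_monoids_def nxt_def)
  then have b: "\<forall>n. invertible C (b_Suc C S X n)"
    using q_Suc_invertible[OF f] qn_b_invertible by simp
  have [simp]: "d \<in> Arr C" "Dom C d = PB s t" "Cod C d = AA" and dr: "d \<cdot> rA = \<one> AA" and dl: "d \<cdot> lA = \<one> AA"
    using rc by (simp_all add: relative_category_iff)
  have drj: "d \<cdot> rA \<cdot> j = j" using reassoc[OF dr, of j] by simp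
  show d: "d \<cdot> qA = j \<star>\<^bsub>MA\<^esub> \<one> AA"
    by (simp add: qn_def hom_conv[OF h] drj dl)
  have "d \<cdot> (lA \<star>\<^bsub>A2\<^esub> (rA \<cdot> j)) = \<one> AA \<star>\<^bsub>MA\<^esub> j"
    by (simp add: hom_conv[OF h] drj dl)
  then have "peiffer C S X" using peiffer_iff[of d] b d by simp
  then show "xmod_object C S X" using b f by (simp add: xmod_object_iff f_map_invertible)
qed

end

context split_graph
begin

text \<open>The displayed object is \<open>to_catmon X\<close> written out, so q is an isomorphism
  from the reconstructed relative category to the given one.\<close>

lemma relative_functor_q:
  assumes "catmon_object C S (K d)" "invertible C to_kernel"
  shows "relative_functor C S
    \<lparr>cat_B = MB, cat_A = distributive_monoid C MB MY x, cat_i = (Unt MY \<otimes> \<one> BB) \<cdot> Inv C (\<ell> BB),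
     cat_s = cl BB, cat_t = act 1, cat_d = (Mul MY \<otimes> \<one> BB) \<cdot> Inv C (\<alpha> YY YY BB) \<cdot> Inv C (b_Suc C S X 1)\<rparr>
    (K d) (\<one> BB) q"
proof -
  note x = xmod_object_X[OF assms]
  have b: "invertible C b2" using x(1) by (simp add: xmod_object_iff)
  have [simp]: "d \<in> Arr C" "Dom C d = PB s t" "Cod C d = AA"
    using assms(1) by (simp_all add: catmon_object_def relative_category_in_monoids_def relative_category_iff)
  show ?thesis
    unfolding relative_functor_def One_nat_def
    using d_q_box[OF b _ _ _ x(2)] b D.conv_in(2)[OF MA j i]
    by (simp add: q_hom monoid_hom_Ident sq tq_act flip: D.inB_def)
qed

end

section \<open>Passage between the two kinds of objects\<close>

context relative_setting
begin

lemma box_Ident: "cospan f g \<Longrightarrow> box C S f g f g (\<one> (Dom C f)) (\<one> (Dom C g)) = \<one> (PB f g)"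
  by (rule pr_joint_mono[of f g])
    (use box[of f g f g "\<one> (Dom C f)" "\<one> (Dom C g)" "\<one> (Cod C f)"] cospan_simps[of f g] in simp_all)

lemma box_Comp:
  assumes "cospan f g" "cospan f' g'" "cospan f'' g''"
    "a \<in> Arr C" "c \<in> Arr C" "Dom C a = Dom C f" "Dom C c = Dom C g" "Cod C a = Dom C f'" "Cod C c = Dom C g'"
    "f' \<cdot> a = b \<cdot> f" "g' \<cdot> c = b \<cdot> g" "b \<in> Arr C" "Dom C b = Cod C f"
    "a' \<in> Arr C" "c' \<in> Arr C" "Dom C a' = Dom C f'" "Dom C c' = Dom C g'" "Cod C a' = Dom C f''" "Cod C c' = Dom C g''"
    "f'' \<cdot> a' = b' \<cdot> f'" "g'' \<cdot> c' = b' \<cdot> g'" "b' \<in> Arr C" "Dom C b' = Cod C f'"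
  shows "box C S f' g' f'' g'' a' c' \<cdot> box C S f g f' g' a c = box C S f g f'' g'' (a' \<cdot> a) (c' \<cdot> c)"
proof -
  note [simp] = cospan_simps[OF assms(1)] cospan_simps[OF assms(2)] cospan_simps[OF assms(3)] assms(1-9) assms(12-19) assms(22-23)
  note b1 = box[OF assms(1,2,4-13)] and b2 = box[OF assms(2,3,14-23)]
  have cb: "Cod C b = Cod C f'" using arg_cong[OF assms(10), of "Cod C"] by simp
  have "f'' \<cdot> a' \<cdot> a = (b' \<cdot> f') \<cdot> a" using assms(20) by (simp flip: assoc)
  then have e1: "f'' \<cdot> (a' \<cdot> a) = (b' \<cdot> b) \<cdot> f" by (simp add: assms(10) cb)
  have "g'' \<cdot> c' \<cdot> c = (b' \<cdot> g') \<cdot> c" using assms(21) by (simp flip: assoc)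
  then have e2: "g'' \<cdot> (c' \<cdot> c) = (b' \<cdot> b) \<cdot> g" by (simp add: assms(11) cb)
  note b3 = box[OF assms(1,3) _ _ _ _ _ _ e1 e2]
  show ?thesis
    by (rule pr_joint_mono[OF assms(3)])
      (simp_all add: b1 b2 b3 cb reassoc2[OF b2(4)] reassoc2[OF b2(5)])
qed

definition to_xmod :: "('o, 'a) catmon_obj \<Rightarrow> ('o, 'a) xmod_obj" where
  "to_xmod K = (let s = cat_s K; u = Unt (cat_B K); j = p1 s u in
     \<lparr>xmod_B = cat_B K, xmod_Y = rpb_mon C S (cat_A K) (trivial_monoid C) s u,
      xmod_e = p2 s u, xmod_k = cat_t K \<cdot> j,
      xmod_x = Inv C (j \<star>\<^bsub>cat_A K\<^esub> cat_i K) \<cdot> (cat_i K \<star>\<^bsub>cat_A K\<^esub> j)\<rparr>)"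

text \<open>The composition is the formula of \<open>d_q_box\<close> in the case where
  \<open>q\<close> and \<open>q_box\<close> are identities.\<close>

definition to_catmon :: "('o, 'a) xmod_obj \<Rightarrow> ('o, 'a) catmon_obj" where
  "to_catmon X = (let MB = xmod_B X; MY = xmod_Y X; B = Car MB; Y = Car MY in
     \<lparr>cat_B = MB, cat_A = distributive_monoid C MB MY (xmod_x X),
      cat_i = (Unt MY \<otimes> \<one> B) \<cdot> Inv C (\<ell> B), cat_s = counit_left C X B, cat_t = xmod_act C X 1,
      cat_d = (Mul MY \<otimes> \<one> B) \<cdot> Inv C (\<alpha> Y Y B) \<cdot> Inv C (b_Suc C S X 1)\<rparr>)"

text \<open>The locales describe objects by record displays of their components; this folds a
  display back into the given object.\<close>

lemma catmon_obj_eta [simp]: "\<lparr>cat_B = cat_B K, cat_A = cat_A K, cat_i = cat_i K, cat_s = cat_s K, cat_t = cat_t K, cat_d = cat_d K\<rparr> = K"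
  by simp

lemma xmod_obj_eta [simp]: "\<lparr>xmod_B = xmod_B X, xmod_Y = xmod_Y X, xmod_e = xmod_e X, xmod_k = xmod_k X, xmod_x = xmod_x X\<rparr> = X"
  by simp

lemma catmon_reflexive_graph:
  assumes "catmon_object C S K"
  shows "reflexive_graph C S (cat_B K) (cat_A K) (cat_i K) (cat_s K) (cat_t K)"
proof -
  have rm: "relative_category_in_monoids C S K" using assms by (simp add: catmon_object_def)
  then have "relative_category C S (Car (cat_B K)) (Car (cat_A K)) (cat_i K) (cat_s K) (cat_t K) (cat_d K)"
    by (simp add: relative_category_in_monoids_def Let_def)
  then show ?thesis
    by unfold_locales
      (use rm in \<open>auto simp: relative_category_in_monoids_def relative_category_def Let_def span_legs_in_def\<close>)
qed

abbreviation "ker_arr K \<equiv> p1 (cat_s K) (Unt (cat_B K))"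

lemma catmon_split_graph:
  assumes K: "catmon_object C S K"
  shows "split_graph C S (cat_B K) (cat_A K) (cat_i K) (cat_s K) (cat_t K)
    (xmod_Y (to_xmod K)) (ker_arr K) (xmod_e (to_xmod K)) (xmod_k (to_xmod K)) (xmod_x (to_xmod K))"
proof -
  interpret reflexive_graph C S "cat_B K" "cat_A K" "cat_i K" "cat_s K" "cat_t K"
    by (rule catmon_reflexive_graph[OF K])
  let ?s = "cat_s K" and ?t = "cat_t K" and ?i = "cat_i K" and ?A = "cat_A K" and ?B = "cat_B K" and ?u = "Unt (cat_B K)"
  note [simp] = cospan_unit
  note r = rpb_mon[OF cospan_unit MA monoid_in_trivial MB s monoid_hom_Unt[OF MB]]
  \<comment> \<open>By definition q_1 takes values in A \<box> B. Its composite with the isomorphism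
    \<open>p1\<close> onto A is the product of the kernel inclusion and i.\<close>
  have q: "invertible C (ker_arr K \<star>\<^bsub>?A\<^esub> ?i)"
  proof -
    let ?one = "\<one> (Car ?B)"
    note o = over_base
    note [simp] = cospan_id(1) nxt(1,2)[OF o] rho(1-3)[OF o] lam(1-3)[OF o]
    have e: "q_Suc C S K 0 = (rho ?one ?one \<cdot> ker_arr K) \<star>\<^bsub>nxt ?B ?one\<^esub> lam ?B ?one"
      using q_Suc_eq[of "cat_d K" 0] by simp
    have [simp]: "invertible C (q_Suc C S K 0)" using K by (simp add: catmon_object_def)
    have [simp]: "Cod C (q_Suc C S K 0) = PB ?s ?one" by (simp add: e)
    have "p1 ?s ?one \<cdot> rho ?one ?one \<cdot> ker_arr K = ker_arr K"
      using reassoc[OF rho(4)[OF o], of "ker_arr K"] by simp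
    then have pq: "p1 ?s ?one \<cdot> q_Suc C S K 0 = ker_arr K \<star>\<^bsub>?A\<^esub> ?i"
      by (simp add: e hom_conv[OF nxt(3)[OF o]] lam(4)[OF o])
    have pc: "?s \<cdot> p1 ?s ?one = p2 ?s ?one" using pr_commute[OF cospan_id(1)] by simp
    have "rho ?one ?one \<cdot> p1 ?s ?one = \<one> (PB ?s ?one)"
      by (rule pr_joint_mono[OF cospan_id(1)]) (simp_all add: reassoc[OF rho(4)[OF o]] reassoc2[OF rho(5)[OF o]] pc)
    then have "invertible C (p1 ?s ?one)"
      by (intro invertibleI[of "p1 ?s ?one" "rho ?one ?one"]) (simp_all add: rho(4)[OF o])
    then show ?thesis using invertible_Comp[of "q_Suc C S K 0" "p1 ?s ?one"] pq by simp
  qed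
  \<comment> \<open>Both memberships for the kernel follow by reflection from those of its two
    projections.\<close>
  have Sk: "S (?t \<cdot> ker_arr K) (\<one> (PB ?s ?u))"
  proof -
    have 1: "S (?t \<cdot> ker_arr K) (ker_arr K)" using S_pre[OF S_t, of "ker_arr K"] by simp
    have 2: "S (?t \<cdot> ker_arr K) (p2 ?s ?u)" by (rule S_post_left[OF pr_S]) simp_all
    show ?thesis by (rule pr_reflect_right[OF cospan_unit]) (use 1 2 in simp_all)
  qed
  have Se: "S (\<one> (PB ?s ?u)) (p2 ?s ?u)"
  proof -
    have 1: "S (p2 ?s ?u) (p2 ?s ?u)" using S_pre[OF S_Unit, of "p2 ?s ?u"] by simp
    show ?thesis by (rule pr_reflect_left[OF cospan_unit]) (use 1 pr_S[OF cospan_unit] in simp_all)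
  qed
  have d: "xmod_Y (to_xmod K) = rpb_mon C S ?A (trivial_monoid C) ?s ?u" "xmod_e (to_xmod K) = p2 ?s ?u"
    "xmod_k (to_xmod K) = ?t \<cdot> ker_arr K" "xmod_x (to_xmod K) = Inv C (ker_arr K \<star>\<^bsub>?A\<^esub> ?i) \<cdot> (?i \<star>\<^bsub>?A\<^esub> ker_arr K)"
    by (simp_all add: to_xmod_def Let_def)
  show ?thesis
    unfolding d by unfold_locales (use r q Sk Se pr_commute[OF cospan_unit] in simp_all)
qed

lemma xmod_B_to_xmod [simp]: "xmod_B (to_xmod K) = cat_B K"
  by (simp add: to_xmod_def Let_def)

text \<open>Here Y is the chosen kernel itself; through \<open>f_map_invertible\<close> this settles
  the condition on f in (c').\<close>

lemma to_kernel_Ident: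
  assumes K: "catmon_object C S K"
  shows "pairing C S (cat_s K) (Unt (cat_B K)) (ker_arr K) (xmod_e (to_xmod K)) = \<one> (PB (cat_s K) (Unt (cat_B K)))"
proof -
  interpret split_graph C S "cat_B K" "cat_A K" "cat_i K" "cat_s K" "cat_t K" "xmod_Y (to_xmod K)"
    "ker_arr K" "xmod_e (to_xmod K)" "xmod_k (to_xmod K)" "xmod_x (to_xmod K)"
    by (rule catmon_split_graph[OF K])
  have "xmod_e (to_xmod K) = p2 (cat_s K) (Unt (cat_B K))" by (simp add: to_xmod_def Let_def)
  note e = this
  have [simp]: "YY = PB (cat_s K) (Unt (cat_B K))"
    using trans[OF j_simps(2)[symmetric] pr_simps(2)[OF cospan_unit]] .
  show ?thesis
  proof (rule pr_joint_mono[OF cospan_unit])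
    show "p2 (cat_s K) (Unt (cat_B K)) \<cdot> to_kernel = p2 (cat_s K) (Unt (cat_B K)) \<cdot> \<one> (PB (cat_s K) (Unt (cat_B K)))"
      unfolding to_kernel(5) by (simp add: e cospan_unit)
  qed (simp_all add: to_kernel cospan_unit)
qed

lemma to_xmod_object:
  assumes K: "catmon_object C S K"
  shows "xmod_object C S (to_xmod K)"
    "relative_functor C S (to_catmon (to_xmod K)) K (\<one> (Car (cat_B K))) (ker_arr K \<star>\<^bsub>cat_A K\<^esub> cat_i K)"
proof -
  interpret split_graph C S "cat_B K" "cat_A K" "cat_i K" "cat_s K" "cat_t K" "xmod_Y (to_xmod K)"
    "ker_arr K" "xmod_e (to_xmod K)" "xmod_k (to_xmod K)" "xmod_x (to_xmod K)"
    by (rule catmon_split_graph[OF K])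
  have eta: "\<lparr>xmod_B = cat_B K, xmod_Y = xmod_Y (to_xmod K), xmod_e = xmod_e (to_xmod K),
    xmod_k = xmod_k (to_xmod K), xmod_x = xmod_x (to_xmod K)\<rparr> = to_xmod K"
    using xmod_obj_eta[of "to_xmod K"] by simp
  have 1: "invertible C to_kernel"
    unfolding to_kernel_Ident[OF K] by (rule invertible_Ident) (simp add: cospan_unit)
  have 2: "catmon_object C S \<lparr>cat_B = cat_B K, cat_A = cat_A K, cat_i = cat_i K, cat_s = cat_s K, cat_t = cat_t K, cat_d = cat_d K\<rparr>"
    using K by simp
  show "xmod_object C S (to_xmod K)"
    using xmod_object_X(1)[OF 2 1] unfolding eta .
  show "relative_functor C S (to_catmon (to_xmod K)) K (\<one> (Car (cat_B K))) (ker_arr K \<star>\<^bsub>cat_A K\<^esub> cat_i K)"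
    using relative_functor_q[OF 2 1] unfolding eta catmon_obj_eta by (simp add: to_catmon_def Let_def)
qed

abbreviation "in_Y X \<equiv> (\<one> (Car (xmod_Y X)) \<otimes> Unt (xmod_B X)) \<cdot> Inv C (\<rho> (Car (xmod_Y X)))"

lemma xmod_distributive:
  assumes "xmod_object C S X"
  shows "distributive C (xmod_B X) (xmod_Y X) (xmod_x X)"
  using assms by unfold_locales (simp_all add: xmod_object_def Let_def)

text \<open>By (b'), the pairs (u \<circ> e, 1) and (k, 1) are compatible with x as the universal
  property of Y \<otimes> B demands, which makes the source and target maps multiplicative. Here q
  is the identity, by \<open>in_conv\<close>.\<close>

lemma xmod_split_graph:
  assumes X: "xmod_object C S X"
  shows "split_graph C S (xmod_B X) (cat_A (to_catmon X)) (cat_i (to_catmon X)) (cat_s (to_catmon X))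
    (cat_t (to_catmon X)) (xmod_Y X) (in_Y X) (xmod_e X) (xmod_k X) (xmod_x X)"
proof -
  interpret distributive C "xmod_B X" "xmod_Y X" "xmod_x X" by (rule xmod_distributive[OF X])
  let ?e = "xmod_e X" and ?k = "xmod_k X"
  have e: "monoid_hom C (xmod_Y X) (trivial_monoid C) ?e" and k: "monoid_hom C (xmod_Y X) (xmod_B X) ?k"
    and Sk: "S ?k (\<one> Y)" and Se: "S (\<one> Y) ?e" and SB: "S (\<one> B) (\<one> B)"
    and cx: "counit_left C X B \<cdot> xmod_x X = \<rho> B \<cdot> (\<one> B \<otimes> ?e)"
    and kx: "Mul (xmod_B X) \<cdot> (?k \<otimes> \<one> B) \<cdot> xmod_x X = Mul (xmod_B X) \<cdot> (\<one> B \<otimes> ?k)"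
    using X by (simp_all add: xmod_object_def Let_def)
  note [simp] = monoid_homD(1-3,5)[OF e] monoid_homD(1-3,5)[OF k]
  let ?ue = "Unt (xmod_B X) \<cdot> ?e"
  have ue: "monoid_hom C (xmod_Y X) (xmod_B X) ?ue"
    by (rule monoid_hom_Comp[OF monoid_MY monoid_in_trivial monoid_MB e monoid_hom_Unt]) simp
  note id = monoid_hom_Ident[OF monoid_MB]
  have s_eq: "counit_left C X B = ?ue \<star>\<^bsub>xmod_B X\<^esub> \<one> B"
    by (simp add: conv_counit_left counit_left_def)
  have t_eq: "xmod_act C X (Suc 0) = ?k \<star>\<^bsub>xmod_B X\<^esub> \<one> B"
    by (simp add: xmod_act_def conv_def)
  have cx': "(?ue \<star>\<^bsub>xmod_B X\<^esub> \<one> B) \<cdot> xmod_x X = \<one> B \<star>\<^bsub>xmod_B X\<^esub> ?ue"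
    using cx by (simp add: conv_counit_right flip: s_eq)
  have kx': "(?k \<star>\<^bsub>xmod_B X\<^esub> \<one> B) \<cdot> xmod_x X = \<one> B \<star>\<^bsub>xmod_B X\<^esub> ?k"
    using kx by (simp add: conv_def)
  note s_hom = monoid_hom_from_YB[OF monoid_MB ue id cx'] and t_hom = monoid_hom_from_YB[OF monoid_MB k id kx']
  note s_in = conv_in[OF monoid_MB ue id] and t_in = conv_in[OF monoid_MB k id]
  have St: "S (?k \<star>\<^bsub>xmod_B X\<^esub> \<one> B) (\<one> (Y \<odot> B))"
    unfolding conv_def using S_post_left[OF S_Tensor[OF Sk SB], of "Mul (xmod_B X)"] by simp
  have "S (\<one> Y \<otimes> \<one> B) (\<ell> B \<cdot> (?e \<otimes> \<one> B))"
    by (rule S_post_right[OF S_Tensor[OF Se SB]]) simp_all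
  then have Ss: "S (\<one> (Y \<odot> B)) (?ue \<star>\<^bsub>xmod_B X\<^esub> \<one> B)"
    by (simp add: counit_left_def flip: s_eq)
  have d: "cat_A (to_catmon X) = YB" "cat_i (to_catmon X) = inB" "cat_s (to_catmon X) = ?ue \<star>\<^bsub>xmod_B X\<^esub> \<one> B"
    "cat_t (to_catmon X) = ?k \<star>\<^bsub>xmod_B X\<^esub> \<one> B"
    by (simp_all add: to_catmon_def Let_def s_eq t_eq inB_def)
  show ?thesis
    unfolding d inY_def[symmetric]
    by unfold_locales
      (use s_hom t_hom s_in t_in St Ss monoid_in_YB monoid_hom_inB monoid_hom_inY SB e Sk Se in
        \<open>simp_all add: in_conv invertible_Ident\<close>)
qed

lemma cat_B_to_catmon [simp]: "cat_B (to_catmon X) = xmod_B X"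
  by (simp add: to_catmon_def Let_def)

lemma to_catmon_simps:
  "cat_A (to_catmon X) = distributive_monoid C (xmod_B X) (xmod_Y X) (xmod_x X)"
  "Car (cat_A (to_catmon X)) = Car (xmod_Y X) \<odot> Car (xmod_B X)"
  "cat_s (to_catmon X) = counit_left C X (Car (xmod_B X))"
  "cat_t (to_catmon X) = xmod_act C X (Suc 0)"
  by (simp_all add: to_catmon_def distributive_monoid_def Let_def)

text \<open>As \<open>q\<close> is the identity, so is \<open>q_box\<close>, and hence b_2 coincides
  with \<open>qA\<close>. The composition therefore takes \<open>qA\<close> to m \<otimes> 1, which
  is left multiplication by Y, as \<open>catmon_object_K\<close> requires.\<close>

lemma to_catmon_object:
  assumes X: "xmod_object C S X"
  shows "catmon_object C S (to_catmon X)"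
proof -
  interpret split_graph C S "xmod_B X" "cat_A (to_catmon X)" "cat_i (to_catmon X)" "cat_s (to_catmon X)"
    "cat_t (to_catmon X)" "xmod_Y X" "in_Y X" "xmod_e X" "xmod_k X" "xmod_x X"
    by (rule xmod_split_graph[OF X])
  let ?d = "cat_d (to_catmon X)"
  have in_eq: "in_Y X = D.inY" "cat_i (to_catmon X) = D.inB"
    by (simp_all add: D.inY_def D.inB_def to_catmon_def Let_def)
  have q1: "q = \<one> (YY \<odot> BB)"
    unfolding in_eq to_catmon_simps(1) by (rule D.in_conv)
  note [simp] = cl_simps[unfolded xmod_obj_eta] act_simps[unfolded xmod_obj_eta] b2_simps[unfolded xmod_obj_eta]
  have b: "invertible C b2" using X by (simp add: xmod_object_def Let_def)
  have "q_box = \<one> (PB (cat_s (to_catmon X)) (cat_t (to_catmon X)))"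
    using box_Ident[OF over_simps(11)[OF over_MA]] unfolding q1 by (simp add: to_catmon_simps)
  then have bq: "b2 = qA"
    using q_box_b2 qA_simps unfolding q1 by (simp add: to_catmon_simps)
  have d: "?d = comp_Y \<cdot> Inv C b2" using b by (simp add: to_catmon_def Let_def)
  have "?d \<cdot> qA = q \<cdot> comp_Y" unfolding bq[symmetric] q1 using b by (simp add: d)
  also have "\<dots> = in_Y X \<star>\<^bsub>cat_A (to_catmon X)\<^esub> q" by (rule q_comp_Y)
  also have "q = \<one> (Car (cat_A (to_catmon X)))" by (simp only: q1 to_catmon_simps(2))
  finally have dq: "?d \<cdot> qA = in_Y X \<star>\<^bsub>cat_A (to_catmon X)\<^esub> \<one> (Car (cat_A (to_catmon X)))" .
  have [simp]: "?d \<in> Arr C" "Dom C ?d = PB (cat_s (to_catmon X)) (cat_t (to_catmon X))" "Cod C ?d = Car (cat_A (to_catmon X))"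
    using b by (simp_all add: d to_catmon_simps)
  have "catmon_object C S (K ?d)"
    by (rule catmon_object_K) (use X dq in simp_all)
  then show ?thesis by (simp flip: cat_B_to_catmon)
qed

section \<open>The category of relative categories in monoids\<close>

abbreviation "arr_box K K' a \<equiv> box C S (cat_s K) (cat_t K) (cat_s K') (cat_t K') a a"

lemma relative_functor_simps:
  assumes "relative_functor C S K K' b a"
  shows "b \<in> Arr C" "Dom C b = Car (cat_B K)" "Cod C b = Car (cat_B K')" "b \<cdot> Unt (cat_B K) = Unt (cat_B K')"
    "a \<in> Arr C" "Dom C a = Car (cat_A K)" "Cod C a = Car (cat_A K')"
    "cat_s K' \<cdot> a = b \<cdot> cat_s K" "cat_t K' \<cdot> a = b \<cdot> cat_t K" "cat_i K' \<cdot> b = a \<cdot> cat_i K"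
    "a \<cdot> cat_d K = cat_d K' \<cdot> arr_box K K' a"
  using assms monoid_homD[of "cat_B K" "cat_B K'" b] monoid_homD[of "cat_A K" "cat_A K'" a]
  unfolding relative_functor_def by blast+

lemma catmon_cospan:
  assumes "catmon_object C S K"
  shows "cospan (cat_s K) (cat_t K)" "cospan (cat_s K) (Unt (cat_B K))"
    "cat_d K \<in> Arr C" "Dom C (cat_d K) = PB (cat_s K) (cat_t K)" "Cod C (cat_d K) = Car (cat_A K)"
    "cat_s K \<in> Arr C" "Dom C (cat_s K) = Car (cat_A K)" "Cod C (cat_s K) = Car (cat_B K)"
    "cat_t K \<in> Arr C" "Dom C (cat_t K) = Car (cat_A K)" "Cod C (cat_t K) = Car (cat_B K)"
    "cat_i K \<in> Arr C" "Dom C (cat_i K) = Car (cat_B K)" "Cod C (cat_i K) = Car (cat_A K)"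
    "monoid_in C (cat_A K)" "monoid_in C (cat_B K)"
proof -
  interpret reflexive_graph C S "cat_B K" "cat_A K" "cat_i K" "cat_s K" "cat_t K"
    by (rule catmon_reflexive_graph[OF assms])
  show "cospan (cat_s K) (cat_t K)" by simp
  show "cospan (cat_s K) (Unt (cat_B K))" by (rule cospan_unit)
  show "cat_d K \<in> Arr C" "Dom C (cat_d K) = PB (cat_s K) (cat_t K)" "Cod C (cat_d K) = Car (cat_A K)"
    using assms by (simp_all add: catmon_object_def relative_category_in_monoids_def Let_def relative_category_iff)
qed (use monoid_homD catmon_reflexive_graph[OF assms] in \<open>auto simp: reflexive_graph_def reflexive_graph_axioms_def\<close>)

lemma relative_functor_Ident:
  assumes "catmon_object C S K"
  shows "relative_functor C S K K (\<one> (Car (cat_B K))) (\<one> (Car (cat_A K)))"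
  using catmon_cospan[OF assms] box_Ident[of "cat_s K" "cat_t K"]
  unfolding relative_functor_def by (simp add: monoid_hom_Ident)

lemma box_functor:
  assumes "catmon_object C S K" "catmon_object C S K'" "relative_functor C S K K' b a"
  shows "arr_box K K' a \<in> Arr C"
    "Dom C (arr_box K K' a) = PB (cat_s K) (cat_t K)"
    "Cod C (arr_box K K' a) = PB (cat_s K') (cat_t K')"
    "p1 (cat_s K') (cat_t K') \<cdot> arr_box K K' a = a \<cdot> p1 (cat_s K) (cat_t K)"
    "p2 (cat_s K') (cat_t K') \<cdot> arr_box K K' a = a \<cdot> p2 (cat_s K) (cat_t K)"
  using box[of "cat_s K" "cat_t K" "cat_s K'" "cat_t K'" a a b] catmon_cospan[OF assms(1)] catmon_cospan[OF assms(2)]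
    relative_functor_simps[OF assms(3)] by simp_all

lemma relative_functor_Comp:
  assumes K: "catmon_object C S K" "catmon_object C S K'" "catmon_object C S K''"
    and f: "relative_functor C S K K' b a" and g: "relative_functor C S K' K'' b' a'"
  shows "relative_functor C S K K'' (b' \<cdot> b) (a' \<cdot> a)"
proof -
  note [simp] = catmon_cospan[OF K(1)] catmon_cospan[OF K(2)] catmon_cospan[OF K(3)]
    relative_functor_simps(1-7)[OF f] relative_functor_simps(1-7)[OF g] box_functor(1-3)[OF K(1,2) f] box_functor(1-3)[OF K(2,3) g]
  note f' = relative_functor_simps(8-11)[OF f] and g' = relative_functor_simps(8-11)[OF g]
  have h: "monoid_hom C (cat_B K) (cat_B K'') (b' \<cdot> b)" "monoid_hom C (cat_A K) (cat_A K'') (a' \<cdot> a)"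
    using f g by (auto simp: relative_functor_def intro: monoid_hom_Comp[of _ "cat_B K'"] monoid_hom_Comp[of _ "cat_A K'"])
  have "cat_s K'' \<cdot> a' \<cdot> a = b' \<cdot> cat_s K' \<cdot> a"
    by (rule reassoc2[OF g'(1)]) simp_all
  moreover have "cat_t K'' \<cdot> a' \<cdot> a = b' \<cdot> cat_t K' \<cdot> a"
    by (rule reassoc2[OF g'(2)]) simp_all
  moreover have "cat_i K'' \<cdot> b' \<cdot> b = a' \<cdot> cat_i K' \<cdot> b"
    by (rule reassoc2[OF g'(3)]) simp_all
  moreover have "arr_box K' K'' a' \<cdot> arr_box K K' a
    = arr_box K K'' (a' \<cdot> a)"
    by (rule box_Comp[of _ _ _ _ _ _ _ _ b _ _ b']) (simp_all add: f' g')
  moreover have "a' \<cdot> a \<cdot> cat_d K = a' \<cdot> cat_d K' \<cdot> arr_box K K' a"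
    by (simp add: f')
  moreover have "\<dots> = cat_d K'' \<cdot> arr_box K' K'' a' \<cdot> arr_box K K' a"
    by (rule reassoc2[OF g'(4)]) simp_all
  ultimately show ?thesis
    using h f' unfolding relative_functor_def by simp
qed

text \<open>Functoriality of \<box> makes the box of the inverse a right inverse of the box of
  \<open>a\<close>, so the equation for the compositions can be inverted.\<close>

lemma relative_functor_Inv:
  assumes K: "catmon_object C S K" "catmon_object C S K'" and f: "relative_functor C S K K' b a"
    and inv [simp]: "invertible C b" "invertible C a"
  shows "relative_functor C S K' K (Inv C b) (Inv C a)"
proof -
  note [simp] = catmon_cospan[OF K(1)] catmon_cospan[OF K(2)]
    relative_functor_simps(1-7)[OF f] box_functor(1-3)[OF K f]
  note f' = relative_functor_simps(8-11)[OF f]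
  have h: "monoid_hom C (cat_B K') (cat_B K) (Inv C b)" "monoid_hom C (cat_A K') (cat_A K) (Inv C a)"
    using f by (auto simp: relative_functor_def intro: monoid_hom_Inv)
  have s: "cat_s K \<cdot> Inv C a = Inv C b \<cdot> cat_s K'"
  proof -
    have "Inv C b \<cdot> (cat_s K' \<cdot> a) \<cdot> Inv C a = cat_s K \<cdot> Inv C a" unfolding f' by simp
    then show ?thesis by simp
  qed
  have t: "cat_t K \<cdot> Inv C a = Inv C b \<cdot> cat_t K'"
  proof -
    have "Inv C b \<cdot> (cat_t K' \<cdot> a) \<cdot> Inv C a = cat_t K \<cdot> Inv C a" unfolding f' by simp
    then show ?thesis by simp
  qed
  have i: "cat_i K \<cdot> Inv C b = Inv C a \<cdot> cat_i K'"
  proof -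
    have "Inv C a \<cdot> (cat_i K' \<cdot> b) \<cdot> Inv C b = cat_i K \<cdot> Inv C b" unfolding f' by simp
    then show ?thesis by simp
  qed
  let ?b = "arr_box K K' a"
  let ?b' = "arr_box K' K (Inv C a)"
  have [simp]: "?b' \<in> Arr C" "Dom C ?b' = PB (cat_s K') (cat_t K')" "Cod C ?b' = PB (cat_s K) (cat_t K)"
    using box[of "cat_s K'" "cat_t K'" "cat_s K" "cat_t K" "Inv C a" "Inv C a" "Inv C b"] s t by simp_all
  have "?b \<cdot> ?b' = arr_box K' K' (a \<cdot> Inv C a)"
    by (rule box_Comp[of _ _ _ _ _ _ _ _ "Inv C b" _ _ b]) (simp_all add: f' s t)
  then have bb: "?b \<cdot> ?b' = \<one> (PB (cat_s K') (cat_t K'))"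
    using box_Ident[of "cat_s K'" "cat_t K'"] by simp
  have "Inv C a \<cdot> cat_d K' = Inv C a \<cdot> cat_d K' \<cdot> ?b \<cdot> ?b'" by (simp add: bb)
  also have "\<dots> = Inv C a \<cdot> (cat_d K' \<cdot> ?b) \<cdot> ?b'" by simp
  also have "\<dots> = cat_d K \<cdot> ?b'" unfolding f'(4)[symmetric] by simp
  finally show ?thesis
    unfolding relative_functor_def using h s t i by simp
qed

lemma CatMon_simps [simp]:
  "X \<in> Obj (CatMon C S) \<longleftrightarrow> catmon_object C S X"
  "(X, X', b, a) \<in> Arr (CatMon C S) \<longleftrightarrow> catmon_object C S X \<and> catmon_object C S X' \<and> relative_functor C S X X' b a"
  "Dom (CatMon C S) (X, X', b, a) = X" "Cod (CatMon C S) (X, X', b, a) = X'"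
  "Ident (CatMon C S) X = (X, X, \<one> (Car (cat_B X)), \<one> (Car (cat_A X)))"
  "Comp (CatMon C S) (Y, Y', b', a') (X, X', b, a) = (X, Y', b' \<cdot> b, a' \<cdot> a)"
  by (simp_all add: CatMon_def)

lemma category_CatMon: "category (CatMon C S)"
proof
  fix f assume "f \<in> Arr (CatMon C S)"
  then show "Dom (CatMon C S) f \<in> Obj (CatMon C S)" "Cod (CatMon C S) f \<in> Obj (CatMon C S)"
    by (cases f; simp)+
next
  fix X assume "X \<in> Obj (CatMon C S)"
  then show "Ident (CatMon C S) X \<in> hom (CatMon C S) X X"
    by (simp add: hom_def relative_functor_Ident)
next
  fix f g X Y Z assume "f \<in> hom (CatMon C S) X Y" "g \<in> hom (CatMon C S) Y Z"
  then show "Comp (CatMon C S) g f \<in> hom (CatMon C S) X Z"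
    by (cases f; cases g) (auto simp: hom_def intro: relative_functor_Comp[of _ Y])
next
  fix f X Y assume "f \<in> hom (CatMon C S) X Y"
  then show "Comp (CatMon C S) f (Ident (CatMon C S) X) = f" "Comp (CatMon C S) (Ident (CatMon C S) Y) f = f"
    by (cases f; auto simp: hom_def relative_functor_simps)+
next
  fix f g h W X Y Z assume "f \<in> hom (CatMon C S) W X" "g \<in> hom (CatMon C S) X Y" "h \<in> hom (CatMon C S) Y Z"
  then show "Comp (CatMon C S) (Comp (CatMon C S) h g) f = Comp (CatMon C S) h (Comp (CatMon C S) g f)"
    by (cases f; cases g; cases h) (auto simp: hom_def relative_functor_simps)
qed

lemma CatMon_invertible:
  assumes "catmon_object C S K" "catmon_object C S K'" "relative_functor C S K K' b a" "invertible C b" "invertible C a"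
  shows "invertible (CatMon C S) (K, K', b, a)"
  unfolding invertible_def inverse_arrows_def
  by (rule exI[of _ "(K', K, Inv C b, Inv C a)"])
    (use assms relative_functor_simps[OF assms(3)] in \<open>simp add: relative_functor_Inv\<close>)

section \<open>The category of crossed modules\<close>

lemma xmod_morphism_simps:
  assumes "xmod_morphism C X X' b y"
  shows "b \<in> Arr C" "Dom C b = Car (xmod_B X)" "Cod C b = Car (xmod_B X')" "b \<cdot> Unt (xmod_B X) = Unt (xmod_B X')"
    "y \<in> Arr C" "Dom C y = Car (xmod_Y X)" "Cod C y = Car (xmod_Y X')"
    "xmod_e X' \<cdot> y = xmod_e X" "xmod_k X' \<cdot> y = b \<cdot> xmod_k X" "xmod_x X' \<cdot> (b \<otimes> y) = (y \<otimes> b) \<cdot> xmod_x X"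
  using assms monoid_homD[of "xmod_B X" "xmod_B X'" b] monoid_homD[of "xmod_Y X" "xmod_Y X'" y]
  unfolding xmod_morphism_def by blast+

lemma xmod_object_simps:
  assumes "xmod_object C S X"
  shows "monoid_in C (xmod_B X)" "monoid_in C (xmod_Y X)"
    "xmod_e X \<in> Arr C" "Dom C (xmod_e X) = Car (xmod_Y X)" "Cod C (xmod_e X) = \<I>"
    "xmod_k X \<in> Arr C" "Dom C (xmod_k X) = Car (xmod_Y X)" "Cod C (xmod_k X) = Car (xmod_B X)"
    "xmod_x X \<in> Arr C" "Dom C (xmod_x X) = Car (xmod_B X) \<odot> Car (xmod_Y X)" "Cod C (xmod_x X) = Car (xmod_Y X) \<odot> Car (xmod_B X)"
proof -
  interpret distributive C "xmod_B X" "xmod_Y X" "xmod_x X" by (rule xmod_distributive[OF assms])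
  show "monoid_in C (xmod_B X)" "monoid_in C (xmod_Y X)"
    "xmod_x X \<in> Arr C" "Dom C (xmod_x X) = B \<odot> Y" "Cod C (xmod_x X) = Y \<odot> B" by simp_all
  have "monoid_hom C (xmod_Y X) (trivial_monoid C) (xmod_e X)" "monoid_hom C (xmod_Y X) (xmod_B X) (xmod_k X)"
    using assms by (simp_all add: xmod_object_def Let_def)
  from monoid_homD(1-3)[OF this(1)] monoid_homD(1-3)[OF this(2)]
  show "xmod_e X \<in> Arr C" "Dom C (xmod_e X) = Y" "Cod C (xmod_e X) = \<I>"
    "xmod_k X \<in> Arr C" "Dom C (xmod_k X) = Y" "Cod C (xmod_k X) = B" by simp_all
qed

lemma xmod_morphism_Ident:
  assumes "xmod_object C S X"
  shows "xmod_morphism C X X (\<one> (Car (xmod_B X))) (\<one> (Car (xmod_Y X)))"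
  using xmod_object_simps[OF assms] by (simp add: xmod_morphism_def monoid_hom_Ident)

lemma xmod_morphism_Comp:
  assumes X: "xmod_object C S X" "xmod_object C S X'" "xmod_object C S X''"
    and f: "xmod_morphism C X X' b y" and g: "xmod_morphism C X' X'' b' y'"
  shows "xmod_morphism C X X'' (b' \<cdot> b) (y' \<cdot> y)"
proof -
  note [simp] = xmod_object_simps[OF X(1)] xmod_object_simps[OF X(2)] xmod_object_simps[OF X(3)]
    xmod_morphism_simps(1-7)[OF f] xmod_morphism_simps(1-7)[OF g]
  note f' = xmod_morphism_simps(8-10)[OF f] and g' = xmod_morphism_simps(8-10)[OF g]
  have h: "monoid_hom C (xmod_B X) (xmod_B X'') (b' \<cdot> b)" "monoid_hom C (xmod_Y X) (xmod_Y X'') (y' \<cdot> y)"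
    using f g by (auto simp: xmod_morphism_def intro: monoid_hom_Comp[of _ "xmod_B X'"] monoid_hom_Comp[of _ "xmod_Y X'"])
  have 1: "xmod_e X'' \<cdot> y' \<cdot> y = xmod_e X' \<cdot> y" by (rule reassoc[OF g'(1)]) simp_all
  have 2: "xmod_k X'' \<cdot> y' \<cdot> y = b' \<cdot> xmod_k X' \<cdot> y" by (rule reassoc2[OF g'(2)]) simp_all
  have "xmod_x X'' \<cdot> ((b' \<cdot> b) \<otimes> (y' \<cdot> y)) = xmod_x X'' \<cdot> (b' \<otimes> y') \<cdot> (b \<otimes> y)" by simp
  also have "\<dots> = (y' \<otimes> b') \<cdot> xmod_x X' \<cdot> (b \<otimes> y)" by (rule reassoc2[OF g'(3)]) simp_all
  also have "\<dots> = ((y' \<cdot> y) \<otimes> (b' \<cdot> b)) \<cdot> xmod_x X" by (simp add: f')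
  finally show ?thesis
    unfolding xmod_morphism_def using h 1 2 f' by simp
qed

lemma xmod_morphism_Inv:
  assumes X: "xmod_object C S X" "xmod_object C S X'" and f: "xmod_morphism C X X' b y"
    and inv [simp]: "invertible C b" "invertible C y"
  shows "xmod_morphism C X' X (Inv C b) (Inv C y)"
proof -
  note [simp] = xmod_object_simps[OF X(1)] xmod_object_simps[OF X(2)] xmod_morphism_simps(1-7)[OF f]
  note f' = xmod_morphism_simps(8-10)[OF f]
  have h: "monoid_hom C (xmod_B X') (xmod_B X) (Inv C b)" "monoid_hom C (xmod_Y X') (xmod_Y X) (Inv C y)"
    using f by (auto simp: xmod_morphism_def intro: monoid_hom_Inv)
  have e: "xmod_e X \<cdot> Inv C y = xmod_e X'" unfolding f'(1)[symmetric] by simp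
  have "Inv C b \<cdot> (xmod_k X' \<cdot> y) \<cdot> Inv C y = xmod_k X \<cdot> Inv C y" unfolding f' by simp
  then have k: "xmod_k X \<cdot> Inv C y = Inv C b \<cdot> xmod_k X'" by simp
  have "(Inv C y \<otimes> Inv C b) \<cdot> (xmod_x X' \<cdot> (b \<otimes> y)) \<cdot> (Inv C b \<otimes> Inv C y) = xmod_x X \<cdot> (Inv C b \<otimes> Inv C y)"
    unfolding f' by simp
  then have "xmod_x X \<cdot> (Inv C b \<otimes> Inv C y) = (Inv C y \<otimes> Inv C b) \<cdot> xmod_x X'" by simp
  then show ?thesis unfolding xmod_morphism_def using h e k by simp
qed

lemma Xmod_simps [simp]:
  "X \<in> Obj (Xmod C S) \<longleftrightarrow> xmod_object C S X"
  "(X, X', b, y) \<in> Arr (Xmod C S) \<longleftrightarrow> xmod_object C S X \<and> xmod_object C S X' \<and> xmod_morphism C X X' b y"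
  "Dom (Xmod C S) (X, X', b, y) = X" "Cod (Xmod C S) (X, X', b, y) = X'"
  "Ident (Xmod C S) X = (X, X, \<one> (Car (xmod_B X)), \<one> (Car (xmod_Y X)))"
  "Comp (Xmod C S) (Y, Y', b', y') (X, X', b, y) = (X, Y', b' \<cdot> b, y' \<cdot> y)"
  by (simp_all add: Xmod_def)

lemma category_Xmod: "category (Xmod C S)"
proof
  fix f assume "f \<in> Arr (Xmod C S)"
  then show "Dom (Xmod C S) f \<in> Obj (Xmod C S)" "Cod (Xmod C S) f \<in> Obj (Xmod C S)"
    by (cases f; simp)+
next
  fix X assume "X \<in> Obj (Xmod C S)"
  then show "Ident (Xmod C S) X \<in> hom (Xmod C S) X X"
    by (simp add: hom_def xmod_morphism_Ident)
next
  fix f g X Y Z assume "f \<in> hom (Xmod C S) X Y" "g \<in> hom (Xmod C S) Y Z"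
  then show "Comp (Xmod C S) g f \<in> hom (Xmod C S) X Z"
    by (cases f; cases g) (auto simp: hom_def intro: xmod_morphism_Comp[of _ Y])
next
  fix f X Y assume "f \<in> hom (Xmod C S) X Y"
  then show "Comp (Xmod C S) f (Ident (Xmod C S) X) = f" "Comp (Xmod C S) (Ident (Xmod C S) Y) f = f"
    by (cases f; auto simp: hom_def xmod_morphism_simps)+
next
  fix f g h W X Y Z assume "f \<in> hom (Xmod C S) W X" "g \<in> hom (Xmod C S) X Y" "h \<in> hom (Xmod C S) Y Z"
  then show "Comp (Xmod C S) (Comp (Xmod C S) h g) f = Comp (Xmod C S) h (Comp (Xmod C S) g f)"
    by (cases f; cases g; cases h) (auto simp: hom_def xmod_morphism_simps)
qed

lemma Xmod_invertible:
  assumes "xmod_object C S X" "xmod_object C S X'" "xmod_morphism C X X' b y" "invertible C b" "invertible C y"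
  shows "invertible (Xmod C S) (X, X', b, y)"
  unfolding invertible_def inverse_arrows_def
  by (rule exI[of _ "(X', X, Inv C b, Inv C y)"])
    (use assms xmod_morphism_simps[OF assms(3)] in \<open>simp add: xmod_morphism_Inv\<close>)

section \<open>The equivalence\<close>

abbreviation "kernel_box K K' a \<equiv> box C S (cat_s K) (Unt (cat_B K)) (cat_s K') (Unt (cat_B K')) a (\<one> \<I>)"
abbreviation "split_iso K \<equiv> ker_arr K \<star>\<^bsub>cat_A K\<^esub> cat_i K"

definition to_xmod_arr where
  "to_xmod_arr = (\<lambda>(K, K', b, a). (to_xmod K, to_xmod K', b, kernel_box K K' a))"

definition to_catmon_arr where
  "to_catmon_arr = (\<lambda>(X, X', b, y). (to_catmon X, to_catmon X', b, y \<otimes> b))"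

lemma to_xmod_simps:
  assumes K: "catmon_object C S K"
  shows "Car (xmod_Y (to_xmod K)) = PB (cat_s K) (Unt (cat_B K))"
    "monoid_in C (xmod_Y (to_xmod K))"
    "monoid_hom C (xmod_Y (to_xmod K)) (cat_A K) (ker_arr K)"
    "monoid_hom C (xmod_Y (to_xmod K)) (trivial_monoid C) (p2 (cat_s K) (Unt (cat_B K)))"
    "xmod_e (to_xmod K) = p2 (cat_s K) (Unt (cat_B K))"
    "xmod_k (to_xmod K) = cat_t K \<cdot> ker_arr K"
    "invertible C (split_iso K)"
    "split_iso K \<cdot> xmod_x (to_xmod K) = cat_i K \<star>\<^bsub>cat_A K\<^esub> ker_arr K"
proof -
  interpret reflexive_graph C S "cat_B K" "cat_A K" "cat_i K" "cat_s K" "cat_t K"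
    by (rule catmon_reflexive_graph[OF K])
  note r = rpb_mon[OF cospan_unit MA monoid_in_trivial MB s monoid_hom_Unt[OF MB]]
  have Y: "xmod_Y (to_xmod K) = rpb_mon C S (cat_A K) (trivial_monoid C) (cat_s K) (Unt (cat_B K))"
    by (simp add: to_xmod_def Let_def)
  show "Car (xmod_Y (to_xmod K)) = PB (cat_s K) (Unt (cat_B K))"
    "monoid_in C (xmod_Y (to_xmod K))"
    "monoid_hom C (xmod_Y (to_xmod K)) (cat_A K) (ker_arr K)"
    "monoid_hom C (xmod_Y (to_xmod K)) (trivial_monoid C) (p2 (cat_s K) (Unt (cat_B K)))"
    unfolding Y by (rule r)+
  show "xmod_e (to_xmod K) = p2 (cat_s K) (Unt (cat_B K))"
    "xmod_k (to_xmod K) = cat_t K \<cdot> ker_arr K"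
    by (simp_all add: to_xmod_def Let_def)
  show "invertible C (split_iso K)" "split_iso K \<cdot> xmod_x (to_xmod K) = cat_i K \<star>\<^bsub>cat_A K\<^esub> ker_arr K"
    using catmon_split_graph[OF K] by (simp_all add: split_graph_def split_graph_axioms_def)
qed

lemma hom_to_kernel:
  assumes K: "catmon_object C S K" and "monoid_in C N" "h \<in> Arr C" "Dom C h = Car N" "Cod C h = PB (cat_s K) (Unt (cat_B K))"
    "monoid_hom C N (cat_A K) (ker_arr K \<cdot> h)" "monoid_hom C N (trivial_monoid C) (p2 (cat_s K) (Unt (cat_B K)) \<cdot> h)"
  shows "monoid_hom C N (xmod_Y (to_xmod K)) h"
proof -
  interpret reflexive_graph C S "cat_B K" "cat_A K" "cat_i K" "cat_s K" "cat_t K"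
    by (rule catmon_reflexive_graph[OF K])
  have Y: "xmod_Y (to_xmod K) = rpb_mon C S (cat_A K) (trivial_monoid C) (cat_s K) (Unt (cat_B K))"
    by (simp add: to_xmod_def Let_def)
  show ?thesis
    unfolding Y by (rule monoid_hom_rpb[OF cospan_unit MA monoid_in_trivial MB s monoid_hom_Unt[OF MB] assms(2-)])
qed

text \<open>The last equation is naturality of \<open>split_iso\<close>, valid because
  \<open>a\<close> is multiplicative and commutes with i and the kernel inclusions. It gives both
  compatibility with the distributive laws and naturality of the unit.\<close>

lemma kernel_box:
  assumes K: "catmon_object C S K" "catmon_object C S K'" and f: "relative_functor C S K K' b a"
  shows "kernel_box K K' a \<in> Arr C" "Dom C (kernel_box K K' a) = PB (cat_s K) (Unt (cat_B K))"
    "Cod C (kernel_box K K' a) = PB (cat_s K') (Unt (cat_B K'))"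
    "ker_arr K' \<cdot> kernel_box K K' a = a \<cdot> ker_arr K"
    "p2 (cat_s K') (Unt (cat_B K')) \<cdot> kernel_box K K' a = p2 (cat_s K) (Unt (cat_B K))"
    "split_iso K' \<cdot> (kernel_box K K' a \<otimes> b) = a \<cdot> split_iso K"
proof -
  note [simp] = catmon_cospan[OF K(1)] catmon_cospan[OF K(2)] relative_functor_simps(1-7)[OF f]
  note f' = relative_functor_simps(8-11)[OF f]
  note b = box[of "cat_s K" "Unt (cat_B K)" "cat_s K'" "Unt (cat_B K')" a "\<one> \<I>" b]
  show b: "kernel_box K K' a \<in> Arr C" "Dom C (kernel_box K K' a) = PB (cat_s K) (Unt (cat_B K))"
    "Cod C (kernel_box K K' a) = PB (cat_s K') (Unt (cat_B K'))"
    "ker_arr K' \<cdot> kernel_box K K' a = a \<cdot> ker_arr K"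
    "p2 (cat_s K') (Unt (cat_B K')) \<cdot> kernel_box K K' a = p2 (cat_s K) (Unt (cat_B K))"
    using b by (simp_all add: f'(1))
  have "monoid_hom C (cat_A K) (cat_A K') a" using f by (simp add: relative_functor_def)
  from hom_conv[OF this]
  show "split_iso K' \<cdot> (kernel_box K K' a \<otimes> b) = a \<cdot> split_iso K"
    by (simp add: b f')
qed

lemma xmod_morphism_kernel_box:
  assumes K: "catmon_object C S K" "catmon_object C S K'" and f: "relative_functor C S K K' b a"
  shows "xmod_morphism C (to_xmod K) (to_xmod K') b (kernel_box K K' a)"
proof -
  note [simp] = catmon_cospan[OF K(1)] catmon_cospan[OF K(2)] relative_functor_simps(1-7)[OF f]
    to_xmod_simps(1,2,5-7)[OF K(1)] to_xmod_simps(1,2,5-7)[OF K(2)] kernel_box(1-3)[OF K f]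
    xmod_object_simps(9-11)[OF to_xmod_object(1)[OF K(1)]] xmod_object_simps(9-11)[OF to_xmod_object(1)[OF K(2)]]
  note f' = relative_functor_simps(8-11)[OF f] and kb = kernel_box(4-6)[OF K f]
  let ?y = "kernel_box K K' a"
  have h: "monoid_hom C (cat_B K) (cat_B K') b" "monoid_hom C (cat_A K) (cat_A K') a"
    using f by (simp_all add: relative_functor_def)
  have y: "monoid_hom C (xmod_Y (to_xmod K)) (xmod_Y (to_xmod K')) ?y"
    by (rule hom_to_kernel[OF K(2)])
      (use monoid_hom_Comp[OF _ _ _ to_xmod_simps(3)[OF K(1)] h(2)] to_xmod_simps(4)[OF K(1)] in \<open>simp_all add: kb\<close>)
  have k: "cat_t K' \<cdot> ker_arr K' \<cdot> ?y = b \<cdot> cat_t K \<cdot> ker_arr K"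
    using reassoc2[OF f'(2), of "ker_arr K"] by (simp add: kb)
  let ?q = "split_iso K'"
  \<comment> \<open>A distributive law is known here only through q \<circ> x = i \<star> j, so the
    equation is tested after composing with the isomorphism \<open>?q\<close>.\<close>
  have "?q \<cdot> (xmod_x (to_xmod K') \<cdot> (b \<otimes> ?y)) = (cat_i K' \<star>\<^bsub>cat_A K'\<^esub> ker_arr K') \<cdot> (b \<otimes> ?y)"
    by (rule reassoc[OF to_xmod_simps(8)[OF K(2)]]) simp_all
  also have "\<dots> = a \<cdot> (cat_i K \<star>\<^bsub>cat_A K\<^esub> ker_arr K)"
    by (simp add: hom_conv[OF h(2)] kb f')
  also have "\<dots> = a \<cdot> split_iso K \<cdot> xmod_x (to_xmod K)"
    by (simp add: to_xmod_simps(8)[OF K(1)])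
  also have "\<dots> = ?q \<cdot> ((?y \<otimes> b) \<cdot> xmod_x (to_xmod K))"
    by (rule reassoc2[OF kb(3)[symmetric], symmetric, THEN sym]) simp_all
  finally have "xmod_x (to_xmod K') \<cdot> (b \<otimes> ?y) = (?y \<otimes> b) \<cdot> xmod_x (to_xmod K)"
    by (rule cancel_mono) simp_all
  then show ?thesis
    unfolding xmod_morphism_def using h y k kb by simp
qed

section \<open>The two functors\<close>

lemma functor_to_xmod: "is_functor (CatMon C S) (Xmod C S) to_xmod to_xmod_arr"
  unfolding is_functor_def
proof (intro conjI ballI impI)
  fix K assume K: "K \<in> Obj (CatMon C S)"
  then show "to_xmod K \<in> Obj (Xmod C S)" by (simp add: to_xmod_object)
  show "to_xmod_arr (Ident (CatMon C S) K) = Ident (Xmod C S) (to_xmod K)"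
    using K box_Ident[of "cat_s K" "Unt (cat_B K)"] catmon_cospan[of K]
    by (simp add: to_xmod_arr_def to_xmod_simps)
next
  fix f assume "f \<in> Arr (CatMon C S)"
  then show "to_xmod_arr f \<in> hom (Xmod C S) (to_xmod (Dom (CatMon C S) f)) (to_xmod (Cod (CatMon C S) f))"
    by (cases f) (simp add: hom_def to_xmod_arr_def to_xmod_object xmod_morphism_kernel_box)
next
  fix f g assume fg: "f \<in> Arr (CatMon C S)" "g \<in> Arr (CatMon C S)" "Dom (CatMon C S) g = Cod (CatMon C S) f"
  obtain K K' b a where f: "f = (K, K', b, a)" by (cases f)
  obtain K'' b' a' where g: "g = (K', K'', b', a')" using fg(3) f by (cases g) simp
  have K: "catmon_object C S K" "catmon_object C S K'" "catmon_object C S K''"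
    and r: "relative_functor C S K K' b a" "relative_functor C S K' K'' b' a'"
    using fg by (simp_all add: f g)
  note [simp] = catmon_cospan[OF K(1)] catmon_cospan[OF K(2)] catmon_cospan[OF K(3)]
    relative_functor_simps(1-7)[OF r(1)] relative_functor_simps(1-7)[OF r(2)]
  have "kernel_box K' K'' a' \<cdot> kernel_box K K' a = box C S (cat_s K) (Unt (cat_B K)) (cat_s K'') (Unt (cat_B K'')) (a' \<cdot> a) (\<one> \<I> \<cdot> \<one> \<I>)"
    by (rule box_Comp[of _ _ _ _ _ _ _ _ b _ _ b'])
      (simp_all add: relative_functor_simps(8)[OF r(1)] relative_functor_simps(8)[OF r(2)])
  then show "to_xmod_arr (Comp (CatMon C S) g f) = Comp (Xmod C S) (to_xmod_arr g) (to_xmod_arr f)"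
    by (simp add: f g to_xmod_arr_def)
qed

lemma counit_left_natural:
  assumes X: "xmod_object C S X" "xmod_object C S X'" and f: "xmod_morphism C X X' b y" and "g \<in> Arr C" "Cod C g = Z"
  shows "counit_left C X' Z \<cdot> (y \<otimes> g) = g \<cdot> counit_left C X (Dom C g)"
proof -
  note [simp] = xmod_object_simps(3-5)[OF X(1)] xmod_object_simps(3-5)[OF X(2)] xmod_morphism_simps(5-8)[OF f] assms(4)
  have "counit_left C X' Z \<cdot> (y \<otimes> g) = (\<ell> Z \<cdot> (\<one> \<I> \<otimes> g)) \<cdot> (xmod_e X \<otimes> \<one> (Dom C g))"
    using assms(5) by (auto simp: counit_left_def)
  then show ?thesis using assms(5) by (auto simp: counit_left_def lunit_nat)
qed

text \<open>By the universal property of Y \<otimes> B, \<open>y \<otimes> b\<close> is the monoid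
  morphism with restrictions \<open>in_Y X' \<circ> y\<close> and i' \<circ> b. Its compatibility
  with s and t is checked on the two inclusions, that with d after the isomorphism
  \<open>P.qA\<close>.\<close>

lemma relative_functor_Tensor:
  assumes X: "xmod_object C S X" "xmod_object C S X'" and f: "xmod_morphism C X X' b y"
  shows "relative_functor C S (to_catmon X) (to_catmon X') b (y \<otimes> b)"
    "(y \<otimes> b) \<cdot> in_Y X = in_Y X' \<cdot> y"
proof -
  let ?G = "to_catmon X" and ?G' = "to_catmon X'"
  interpret P: split_graph C S "xmod_B X" "cat_A ?G" "cat_i ?G" "cat_s ?G" "cat_t ?G" "xmod_Y X" "in_Y X" "xmod_e X" "xmod_k X" "xmod_x X"
    by (rule xmod_split_graph[OF X(1)])
  interpret Q: split_graph C S "xmod_B X'" "cat_A ?G'" "cat_i ?G'" "cat_s ?G'" "cat_t ?G'" "xmod_Y X'" "in_Y X'" "xmod_e X'" "xmod_k X'" "xmod_x X'"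
    by (rule xmod_split_graph[OF X(2)])
  note [simp] = xmod_morphism_simps(1-7)[OF f]
  note f' = xmod_morphism_simps(8-10)[OF f]
  have hb: "monoid_hom C (xmod_B X) (xmod_B X') b" and hy: "monoid_hom C (xmod_Y X) (xmod_Y X') y"
    using f by (simp_all add: xmod_morphism_def)
  have carA: "Car (cat_A ?G) = P.YY \<odot> P.BB" "Car (cat_A ?G') = Q.YY \<odot> Q.BB" by (simp_all add: to_catmon_simps)
  have in1: "in_Y X \<star>\<^bsub>cat_A ?G\<^esub> cat_i ?G = \<one> (P.YY \<odot> P.BB)"
    unfolding to_catmon_simps(1) using P.D.in_conv(1) by (simp add: P.D.inY_def P.D.inB_def to_catmon_def Let_def)
  have in1': "in_Y X' \<star>\<^bsub>cat_A ?G'\<^esub> cat_i ?G' = \<one> (Q.YY \<odot> Q.BB)"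
    unfolding to_catmon_simps(1) using Q.D.in_conv(1) by (simp add: Q.D.inY_def Q.D.inB_def to_catmon_def Let_def)
  have a: "(in_Y X' \<cdot> y) \<star>\<^bsub>cat_A ?G'\<^esub> (cat_i ?G' \<cdot> b) = y \<otimes> b"
  proof -
    have "(in_Y X' \<cdot> y) \<star>\<^bsub>cat_A ?G'\<^esub> (cat_i ?G' \<cdot> b) = (in_Y X' \<star>\<^bsub>cat_A ?G'\<^esub> cat_i ?G') \<cdot> (y \<otimes> b)" by simp
    then show ?thesis unfolding in1' by simp
  qed
  \<comment> \<open>Compatibility of (b, y) with the distributive laws is what the universal
    property asks of the two restrictions.\<close>
  have ax: "((in_Y X' \<cdot> y) \<star>\<^bsub>cat_A ?G'\<^esub> (cat_i ?G' \<cdot> b)) \<cdot> xmod_x X = (cat_i ?G' \<cdot> b) \<star>\<^bsub>cat_A ?G'\<^esub> (in_Y X' \<cdot> y)"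
  proof -
    have "(y \<otimes> b) \<cdot> xmod_x X = (in_Y X' \<star>\<^bsub>cat_A ?G'\<^esub> cat_i ?G') \<cdot> xmod_x X' \<cdot> (b \<otimes> y)"
      unfolding in1' f'(3) by simp
    also have "\<dots> = (cat_i ?G' \<star>\<^bsub>cat_A ?G'\<^esub> in_Y X') \<cdot> (b \<otimes> y)"
      by (rule reassoc[OF Q.qx]) simp_all
    finally show ?thesis unfolding a by simp
  qed
  have hy': "monoid_hom C (xmod_Y X) (cat_A ?G') (in_Y X' \<cdot> y)"
    by (rule monoid_hom_Comp[OF P.MY Q.MY Q.MA hy Q.j])
  have hb': "monoid_hom C (xmod_B X) (cat_A ?G') (cat_i ?G' \<cdot> b)"
    by (rule monoid_hom_Comp[OF P.MB Q.MB Q.MA hb Q.i])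
  have ha: "monoid_hom C (cat_A ?G) (cat_A ?G') (y \<otimes> b)"
    using P.D.monoid_hom_from_YB[OF Q.MA hy' hb' ax] unfolding a to_catmon_simps(1)[of X] .
  have aY: "(y \<otimes> b) \<cdot> in_Y X = in_Y X' \<cdot> y"
    using P.D.conv_in(1)[OF Q.MA hy' hb'] unfolding a P.D.inY_def .
  then show "(y \<otimes> b) \<cdot> in_Y X = in_Y X' \<cdot> y" .
  have aB: "(y \<otimes> b) \<cdot> cat_i ?G = cat_i ?G' \<cdot> b"
    using P.D.conv_in(2)[OF Q.MA hy' hb'] unfolding a P.D.inB_def by (simp add: to_catmon_def Let_def)
  note [simp] = monoid_homD(1-3)[OF ha] monoid_homD(1-3)[OF P.s] monoid_homD(1-3)[OF P.t] monoid_homD(1-3)[OF Q.s] monoid_homD(1-3)[OF Q.t]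
  \<comment> \<open>The two inclusions are jointly epic for monoid morphisms, because their product
    \<open>P.q\<close> is invertible.\<close>
  have epi: "g = h" if "g \<cdot> in_Y X = h \<cdot> in_Y X" "g \<cdot> cat_i ?G = h \<cdot> cat_i ?G"
    "monoid_hom C (cat_A ?G) N g" "monoid_hom C (cat_A ?G) N h" "monoid_in C N" for g h N
  proof -
    note [simp] = monoid_homD(1-3)[OF that(3)] monoid_homD(1-3)[OF that(4)] that(5)
    have "g \<cdot> P.q = h \<cdot> P.q" by (simp add: hom_conv[OF that(3)] hom_conv[OF that(4)] that(1,2))
    then show ?thesis by (rule cancel_epi) simp_all
  qed
  have s: "cat_s ?G' \<cdot> (y \<otimes> b) = b \<cdot> cat_s ?G"
  proof (rule epi)
    show "(cat_s ?G' \<cdot> (y \<otimes> b)) \<cdot> in_Y X = (b \<cdot> cat_s ?G) \<cdot> in_Y X"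
      using reassoc2[OF Q.sj, of y] reassoc[OF xmod_morphism_simps(4)[OF f], of "xmod_e X"] by (simp add: aY P.sj f')
    show "(cat_s ?G' \<cdot> (y \<otimes> b)) \<cdot> cat_i ?G = (b \<cdot> cat_s ?G) \<cdot> cat_i ?G"
      by (simp add: aB)
  qed (rule monoid_hom_Comp[OF P.MA Q.MA Q.MB ha Q.s], rule monoid_hom_Comp[OF P.MA P.MB Q.MB P.s hb], rule Q.MB)
  have t: "cat_t ?G' \<cdot> (y \<otimes> b) = b \<cdot> cat_t ?G"
  proof (rule epi)
    show "(cat_t ?G' \<cdot> (y \<otimes> b)) \<cdot> in_Y X = (b \<cdot> cat_t ?G) \<cdot> in_Y X"
      using reassoc[OF Q.tj, of y] by (simp add: aY P.tj f')
    show "(cat_t ?G' \<cdot> (y \<otimes> b)) \<cdot> cat_i ?G = (b \<cdot> cat_t ?G) \<cdot> cat_i ?G"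
      by (simp add: aB)
  qed (rule monoid_hom_Comp[OF P.MA Q.MA Q.MB ha Q.t], rule monoid_hom_Comp[OF P.MA P.MB Q.MB P.t hb], rule Q.MB)
  let ?p1 = "p1 (cat_s ?G) (cat_t ?G)" and ?p2 = "p2 (cat_s ?G) (cat_t ?G)"
    and ?p1' = "p1 (cat_s ?G') (cat_t ?G')" and ?p2' = "p2 (cat_s ?G') (cat_t ?G')"
  let ?d = "cat_d ?G" and ?d' = "cat_d ?G'"
  let ?b = "arr_box ?G ?G' (y \<otimes> b)"
  have K: "catmon_object C S ?G" "catmon_object C S ?G'" using X by (simp_all add: to_catmon_object)
  note [simp] = catmon_cospan(3-5)[OF K(1)] catmon_cospan(3-5)[OF K(2)]
  have kr: "invertible C P.to_kernel" "invertible C Q.to_kernel"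
    using X P.xmod_object_iff P.f_map_invertible Q.xmod_object_iff Q.f_map_invertible by simp_all
  have dq: "?d \<cdot> P.qA = in_Y X \<star>\<^bsub>cat_A ?G\<^esub> \<one> P.AA" "?d' \<cdot> Q.qA = in_Y X' \<star>\<^bsub>cat_A ?G'\<^esub> \<one> Q.AA"
    using P.xmod_object_X(2)[OF _ kr(1), of ?d] Q.xmod_object_X(2)[OF _ kr(2), of ?d'] K by (simp_all flip: cat_B_to_catmon)
  have qi: "invertible C P.qA"
    using X(1) P.b2_invertible by (simp add: xmod_object_def Let_def)
  have bb [simp]: "?b \<in> Arr C" "Dom C ?b = PB (cat_s ?G) (cat_t ?G)" "Cod C ?b = PB (cat_s ?G') (cat_t ?G')"
    and pb: "?p1' \<cdot> ?b = (y \<otimes> b) \<cdot> ?p1"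
      "?p2' \<cdot> ?b = (y \<otimes> b) \<cdot> ?p2"
    using box[OF P.over_simps(11)[OF P.over_MA] Q.over_simps(11)[OF Q.over_MA], of "y \<otimes> b" "y \<otimes> b" b] s t by (simp_all add: carA)
  \<comment> \<open>Naturality of \<open>qA\<close>, tested on the two projections; it reduces the
    equation for d to the formulas \<open>dq\<close>.\<close>
  have bq: "?b \<cdot> P.qA = Q.qA \<cdot> (y \<otimes> (y \<otimes> b))"
  proof (rule pr_joint_mono[OF Q.over_simps(11)[OF Q.over_MA]])
    note q1 = P.qn(4)[OF P.over_MA] Q.qn(4)[OF Q.over_MA]
    note q2 = P.qn(5)[OF P.over_MA] Q.qn(5)[OF Q.over_MA]
    have "?p1' \<cdot> ?b \<cdot> P.qA = (y \<otimes> b) \<cdot> ?p1 \<cdot> P.qA"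
      by (rule reassoc2[OF pb(1)]) simp_all
    also have "\<dots> = ((y \<otimes> b) \<cdot> in_Y X) \<star>\<^bsub>cat_A ?G'\<^esub> ((y \<otimes> b) \<cdot> cat_i ?G \<cdot> cat_t ?G)"
      unfolding q1 by (rule hom_conv[OF ha]) simp_all
    also have "(y \<otimes> b) \<cdot> cat_i ?G \<cdot> cat_t ?G = cat_i ?G' \<cdot> b \<cdot> cat_t ?G"
      by (rule reassoc2[OF aB]) simp_all
    also have "((y \<otimes> b) \<cdot> in_Y X) \<star>\<^bsub>cat_A ?G'\<^esub> (cat_i ?G' \<cdot> b \<cdot> cat_t ?G)
      = (in_Y X' \<star>\<^bsub>cat_A ?G'\<^esub> (cat_i ?G' \<cdot> cat_t ?G')) \<cdot> (y \<otimes> (y \<otimes> b))"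
      unfolding aY t[symmetric] by (simp add: carA)
    also have "\<dots> = ?p1' \<cdot> Q.qA \<cdot> (y \<otimes> (y \<otimes> b))"
      by (rule reassoc[OF q1(2), symmetric]) (simp_all add: carA)
    finally show "?p1' \<cdot> ?b \<cdot> P.qA = ?p1' \<cdot> Q.qA \<cdot> (y \<otimes> (y \<otimes> b))" .
    have "?p2' \<cdot> ?b \<cdot> P.qA = (y \<otimes> b) \<cdot> ?p2 \<cdot> P.qA"
      by (rule reassoc2[OF pb(2)]) simp_all
    also have "\<dots> = Q.cl Q.AA \<cdot> (y \<otimes> (y \<otimes> b))"
      unfolding q2 using counit_left_natural[OF X f, of "y \<otimes> b" Q.AA] by (simp add: carA)
    also have "\<dots> = ?p2' \<cdot> Q.qA \<cdot> (y \<otimes> (y \<otimes> b))"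
      by (rule reassoc[OF q2(2), symmetric]) (simp_all add: carA)
    finally show "?p2' \<cdot> ?b \<cdot> P.qA = ?p2' \<cdot> Q.qA \<cdot> (y \<otimes> (y \<otimes> b))" .
  qed (simp_all add: carA)
  have "((y \<otimes> b) \<cdot> ?d) \<cdot> P.qA = (y \<otimes> b) \<cdot> (in_Y X \<star>\<^bsub>cat_A ?G\<^esub> \<one> P.AA)"
    using dq(1) by simp
  also have "\<dots> = ((y \<otimes> b) \<cdot> in_Y X) \<star>\<^bsub>cat_A ?G'\<^esub> ((y \<otimes> b) \<cdot> \<one> P.AA)"
    by (rule hom_conv[OF ha]) simp_all
  also have "\<dots> = (in_Y X' \<star>\<^bsub>cat_A ?G'\<^esub> \<one> Q.AA) \<cdot> (y \<otimes> (y \<otimes> b))"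
    unfolding aY by (simp add: carA)
  also have "\<dots> = ?d' \<cdot> Q.qA \<cdot> (y \<otimes> (y \<otimes> b))"
    by (rule reassoc[OF dq(2), symmetric]) (simp_all add: carA)
  also have "\<dots> = (?d' \<cdot> ?b) \<cdot> P.qA" unfolding bq[symmetric] by simp
  finally have d: "(y \<otimes> b) \<cdot> ?d = ?d' \<cdot> ?b" by (rule cancel_epi) (simp_all add: qi)
  show "relative_functor C S ?G ?G' b (y \<otimes> b)"
    unfolding relative_functor_def using hb ha s t aB d by simp
qed

lemma functor_to_catmon: "is_functor (Xmod C S) (CatMon C S) to_catmon to_catmon_arr"
  unfolding is_functor_def
proof (intro conjI ballI impI)
  fix X assume X: "X \<in> Obj (Xmod C S)"
  then show "to_catmon X \<in> Obj (CatMon C S)" by (simp add: to_catmon_object)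
  show "to_catmon_arr (Ident (Xmod C S) X) = Ident (CatMon C S) (to_catmon X)"
    using X xmod_object_simps(1,2)[of X] by (simp add: to_catmon_arr_def to_catmon_simps(2))
next
  fix f assume "f \<in> Arr (Xmod C S)"
  then show "to_catmon_arr f \<in> hom (CatMon C S) (to_catmon (Dom (Xmod C S) f)) (to_catmon (Cod (Xmod C S) f))"
    by (cases f) (simp add: hom_def to_catmon_arr_def to_catmon_object relative_functor_Tensor)
next
  fix f g assume "f \<in> Arr (Xmod C S)" "g \<in> Arr (Xmod C S)" "Dom (Xmod C S) g = Cod (Xmod C S) f"
  then show "to_catmon_arr (Comp (Xmod C S) g f) = Comp (CatMon C S) (to_catmon_arr g) (to_catmon_arr f)"
    by (cases f; cases g) (auto simp: to_catmon_arr_def xmod_morphism_simps)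
qed

text \<open>The isomorphism f of (c') turns out to be a morphism from X to the crossed module of its
  relative category, so its inverse can serve as the counit. Compatibility with the distributive
  laws is again tested after \<open>split_iso\<close>.\<close>

lemma f_map_props:
  assumes X: "xmod_object C S X"
  defines "G \<equiv> to_catmon X"
  shows "f_map C S X \<in> Arr C" "Dom C (f_map C S X) = Car (xmod_Y X)"
    "Cod C (f_map C S X) = PB (cat_s G) (Unt (cat_B G))"
    "ker_arr G \<cdot> f_map C S X = in_Y X" "p2 (cat_s G) (Unt (cat_B G)) \<cdot> f_map C S X = xmod_e X"
    "invertible C (f_map C S X)"
    "xmod_morphism C X (to_xmod G) (\<one> (Car (xmod_B X))) (f_map C S X)"
proof -
  interpret split_graph C S "xmod_B X" "cat_A (to_catmon X)" "cat_i (to_catmon X)" "cat_s (to_catmon X)"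
    "cat_t (to_catmon X)" "xmod_Y X" "in_Y X" "xmod_e X" "xmod_k X" "xmod_x X"
    by (rule xmod_split_graph[OF X])
  let ?f = "f_map C S X"
  have K: "catmon_object C S G" unfolding G_def by (rule to_catmon_object[OF X])
  note fm = f_map[unfolded xmod_obj_eta D.inY_def]
  have G: "cat_s G = counit_left C X BB" "cat_B G = xmod_B X" "cat_A G = cat_A (to_catmon X)"
    "cat_i G = cat_i (to_catmon X)" "cat_t G = cat_t (to_catmon X)"
    by (simp_all add: G_def to_catmon_simps)
  show f: "?f \<in> Arr C" "Dom C ?f = YY" "Cod C ?f = PB (cat_s G) (Unt (cat_B G))"
    "ker_arr G \<cdot> ?f = in_Y X" "p2 (cat_s G) (Unt (cat_B G)) \<cdot> ?f = xmod_e X"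
    unfolding G by (rule fm)+
  show "invertible C ?f" using X by (simp add: xmod_object_def Let_def)
  note [simp] = G(2) catmon_cospan[OF K, unfolded G(2)] f(1-3)[unfolded G(2)] to_xmod_simps(1,2,5-7)[OF K, unfolded G(2)]
    xmod_object_simps(9-11)[OF to_xmod_object(1)[OF K], unfolded xmod_B_to_xmod G(2)]
  note f45 = f(4,5)[unfolded G(2)]
  have hf: "monoid_hom C (xmod_Y X) (xmod_Y (to_xmod G)) ?f"
    by (rule hom_to_kernel[OF K]) (use j e in \<open>simp_all add: f45 G(3)\<close>)
  have k: "cat_t G \<cdot> ker_arr G \<cdot> ?f = xmod_k X" using tj by (simp add: f45 G(5))
  have "split_iso G \<cdot> (xmod_x (to_xmod G) \<cdot> (\<one> BB \<otimes> ?f)) = (cat_i G \<star>\<^bsub>cat_A G\<^esub> ker_arr G) \<cdot> (\<one> BB \<otimes> ?f)"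
    by (rule reassoc[OF to_xmod_simps(8)[OF K]]) simp_all
  also have "\<dots> = cat_i G \<star>\<^bsub>cat_A G\<^esub> in_Y X" by (simp add: f45)
  also have "\<dots> = (in_Y X \<star>\<^bsub>cat_A G\<^esub> cat_i G) \<cdot> xmod_x X" unfolding G(3,4) by (rule qx[symmetric])
  also have "in_Y X \<star>\<^bsub>cat_A G\<^esub> cat_i G = split_iso G \<cdot> (?f \<otimes> \<one> BB)" by (simp add: f45)
  finally have "split_iso G \<cdot> (xmod_x (to_xmod G) \<cdot> (\<one> BB \<otimes> ?f)) = split_iso G \<cdot> ((?f \<otimes> \<one> BB) \<cdot> xmod_x X)"
    by simp
  then have "xmod_x (to_xmod G) \<cdot> (\<one> BB \<otimes> ?f) = (?f \<otimes> \<one> BB) \<cdot> xmod_x X"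
    by (rule cancel_mono) simp_all
  then show "xmod_morphism C X (to_xmod G) (\<one> BB) ?f"
    unfolding xmod_morphism_def using hf k monoid_hom_Ident[OF MB] f45 by simp
qed

section \<open>The unit and counit of the equivalence\<close>

lemma natural_iso_catmon:
  "natural_iso (CatMon C S) (CatMon C S) (\<lambda>K. K) (\<lambda>f. f) (to_catmon \<circ> to_xmod) (to_catmon_arr \<circ> to_xmod_arr)
    (\<lambda>K. (K, to_catmon (to_xmod K), \<one> (Car (cat_B K)), Inv C (split_iso K)))"
  unfolding natural_iso_def
proof (intro conjI ballI)
  fix K assume "K \<in> Obj (CatMon C S)"
  then have K: "catmon_object C S K" by simp
  let ?K = "to_catmon (to_xmod K)"
  have K': "catmon_object C S ?K" by (rule to_catmon_object[OF to_xmod_object(1)[OF K]])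
  note [simp] = catmon_cospan(15,16)[OF K] to_xmod_simps(7)[OF K]
  note r = relative_functor_Inv[OF K' K to_xmod_object(2)[OF K] invertible_Ident to_xmod_simps(7)[OF K]]
  have id: "Inv C (\<one> (Car (cat_B K))) = \<one> (Car (cat_B K))" by (rule Inv_eq) simp_all
  have r': "relative_functor C S K ?K (\<one> (Car (cat_B K))) (Inv C (split_iso K))" using r by (simp add: id)
  then show "(K, ?K, \<one> (Car (cat_B K)), Inv C (split_iso K)) \<in> hom (CatMon C S) K ((to_catmon \<circ> to_xmod) K)"
    using K K' by (simp add: hom_def)
  show "invertible (CatMon C S) (K, ?K, \<one> (Car (cat_B K)), Inv C (split_iso K))"
    by (rule CatMon_invertible[OF K K' r']) (simp_all add: invertible_Ident invertible_Inv)
next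
  fix f assume "f \<in> Arr (CatMon C S)"
  then obtain K K' b a where f: "f = (K, K', b, a)" and K: "catmon_object C S K" "catmon_object C S K'"
    and r: "relative_functor C S K K' b a" by (cases f) auto
  note [simp] = relative_functor_simps(1-7)[OF r] catmon_cospan[OF K(1)] catmon_cospan[OF K(2)]
    to_xmod_simps(7)[OF K(1)] to_xmod_simps(7)[OF K(2)] kernel_box(1-3)[OF K r]
  have "split_iso K' \<cdot> (Inv C (split_iso K') \<cdot> a) = (split_iso K' \<cdot> (kernel_box K K' a \<otimes> b)) \<cdot> Inv C (split_iso K)"
    unfolding kernel_box(6)[OF K r] by simp
  also have "\<dots> = split_iso K' \<cdot> ((kernel_box K K' a \<otimes> b) \<cdot> Inv C (split_iso K))" by simp
  finally have "Inv C (split_iso K') \<cdot> a = (kernel_box K K' a \<otimes> b) \<cdot> Inv C (split_iso K)"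
    by (rule cancel_mono) simp_all
  then show "Comp (CatMon C S) (Cod (CatMon C S) f, to_catmon (to_xmod (Cod (CatMon C S) f)),
      \<one> (Car (cat_B (Cod (CatMon C S) f))), Inv C (split_iso (Cod (CatMon C S) f))) f
    = Comp (CatMon C S) ((to_catmon_arr \<circ> to_xmod_arr) f) (Dom (CatMon C S) f, to_catmon (to_xmod (Dom (CatMon C S) f)),
      \<one> (Car (cat_B (Dom (CatMon C S) f))), Inv C (split_iso (Dom (CatMon C S) f)))"
    by (simp add: f to_catmon_arr_def to_xmod_arr_def)
qed

lemma natural_iso_xmod:
  "natural_iso (Xmod C S) (Xmod C S) (to_xmod \<circ> to_catmon) (to_xmod_arr \<circ> to_catmon_arr) (\<lambda>X. X) (\<lambda>f. f)
    (\<lambda>X. (to_xmod (to_catmon X), X, \<one> (Car (xmod_B X)), Inv C (f_map C S X)))"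
  unfolding natural_iso_def
proof (intro conjI ballI)
  fix X assume "X \<in> Obj (Xmod C S)"
  then have X: "xmod_object C S X" by simp
  let ?X = "to_xmod (to_catmon X)"
  have X': "xmod_object C S ?X" by (rule to_xmod_object(1)[OF to_catmon_object[OF X]])
  note [simp] = xmod_object_simps(1,2)[OF X] f_map_props(6)[OF X]
  note r = xmod_morphism_Inv[OF X X' f_map_props(7)[OF X] invertible_Ident f_map_props(6)[OF X]]
  have id: "Inv C (\<one> (Car (xmod_B X))) = \<one> (Car (xmod_B X))" by (rule Inv_eq) simp_all
  have r': "xmod_morphism C ?X X (\<one> (Car (xmod_B X))) (Inv C (f_map C S X))" using r by (simp add: id)
  then show "(?X, X, \<one> (Car (xmod_B X)), Inv C (f_map C S X)) \<in> hom (Xmod C S) ((to_xmod \<circ> to_catmon) X) X"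
    using X X' by (simp add: hom_def)
  show "invertible (Xmod C S) (?X, X, \<one> (Car (xmod_B X)), Inv C (f_map C S X))"
    by (rule Xmod_invertible[OF X' X r']) (simp_all add: invertible_Ident invertible_Inv)
next
  fix f assume "f \<in> Arr (Xmod C S)"
  then obtain X X' b y where f: "f = (X, X', b, y)" and X: "xmod_object C S X" "xmod_object C S X'"
    and r: "xmod_morphism C X X' b y" by (cases f) auto
  let ?G = "to_catmon X" and ?G' = "to_catmon X'"
  have K: "catmon_object C S ?G" "catmon_object C S ?G'" using X by (simp_all add: to_catmon_object)
  note rf = relative_functor_Tensor[OF X r]
  note kb = kernel_box[OF K rf(1)] and F = f_map_props[OF X(1)] and F' = f_map_props[OF X(2)]
  let ?k = "kernel_box ?G ?G' (y \<otimes> b)"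
  note [simp del] = cat_B_to_catmon
  note [simp] = xmod_morphism_simps(1-7)[OF r] catmon_cospan[OF K(1)] catmon_cospan[OF K(2)]
    relative_functor_simps(5-7)[OF rf(1)] kb(1-3) F(1-3,6) F'(1-3,6) xmod_object_simps(1,2)[OF X(1)]
  have "?k \<cdot> f_map C S X = f_map C S X' \<cdot> y"
  proof (rule pr_joint_mono[OF catmon_cospan(2)[OF K(2)]])
    have "ker_arr ?G' \<cdot> ?k \<cdot> f_map C S X = (y \<otimes> b) \<cdot> ker_arr ?G \<cdot> f_map C S X"
      by (rule reassoc2[OF kb(4)]) simp_all
    also have "\<dots> = in_Y X' \<cdot> y" unfolding F(4) by (rule rf(2))
    also have "\<dots> = ker_arr ?G' \<cdot> f_map C S X' \<cdot> y"
      by (rule reassoc[OF F'(4), symmetric]) simp_all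
    finally show "ker_arr ?G' \<cdot> ?k \<cdot> f_map C S X = ker_arr ?G' \<cdot> f_map C S X' \<cdot> y" .
    have "p2 (cat_s ?G') (Unt (cat_B ?G')) \<cdot> ?k \<cdot> f_map C S X = p2 (cat_s ?G) (Unt (cat_B ?G)) \<cdot> f_map C S X"
      by (rule reassoc[OF kb(5)]) simp_all
    also have "\<dots> = xmod_e X' \<cdot> y" unfolding F(5) by (rule xmod_morphism_simps(8)[OF r, symmetric])
    also have "\<dots> = p2 (cat_s ?G') (Unt (cat_B ?G')) \<cdot> f_map C S X' \<cdot> y"
      by (rule reassoc[OF F'(5), symmetric]) simp_all
    finally show "p2 (cat_s ?G') (Unt (cat_B ?G')) \<cdot> ?k \<cdot> f_map C S X = p2 (cat_s ?G') (Unt (cat_B ?G')) \<cdot> f_map C S X' \<cdot> y" .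
  qed simp_all
  then have "Inv C (f_map C S X') \<cdot> (?k \<cdot> f_map C S X) \<cdot> Inv C (f_map C S X) = Inv C (f_map C S X') \<cdot> (f_map C S X' \<cdot> y) \<cdot> Inv C (f_map C S X)"
    by simp
  then have "Inv C (f_map C S X') \<cdot> ?k = y \<cdot> Inv C (f_map C S X)" by simp
  then show "Comp (Xmod C S) (to_xmod (to_catmon (Cod (Xmod C S) f)), Cod (Xmod C S) f,
      \<one> (Car (xmod_B (Cod (Xmod C S) f))), Inv C (f_map C S (Cod (Xmod C S) f))) ((to_xmod_arr \<circ> to_catmon_arr) f)
    = Comp (Xmod C S) f (to_xmod (to_catmon (Dom (Xmod C S) f)), Dom (Xmod C S) f,
      \<one> (Car (xmod_B (Dom (Xmod C S) f))), Inv C (f_map C S (Dom (Xmod C S) f)))"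
    by (simp add: f to_catmon_arr_def to_xmod_arr_def)
qed

lemma equivalence: "equivalent_categories (CatMon C S) (Xmod C S)"
  unfolding equivalent_categories_def
  using category_CatMon category_Xmod functor_to_xmod functor_to_catmon natural_iso_catmon natural_iso_xmod
  by blast

end

theorem theorem3p10:
  fixes C :: "('o, 'a) moncat" and S :: "'a \<Rightarrow> 'a \<Rightarrow> bool"
  assumes "monoidal_category C"
    and "admissible C S"
    and "monoidal_class C S"
    and "has_relative_pullbacks C S"
  shows "equivalent_categories (CatMon C S) (Xmod C S)"
  by (rule relative_setting.equivalence) (use assms in \<open>simp add: relative_setting_def relative_setting_axioms_def\<close>)

end
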